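(* Let $\Bbbk$ be a field, let $n\ge2$ be an integer, let $q\in\Bbbk^\times$ be a root of unity of (finite) order $m>2$, let $v$ be a positive integer, and let $A=\Bbbk_q[x_1,\dots,x_n]^{(v)}$. Suppose that one of the following is true: (a) $n$ is even and $m$ does not divide $v$; (b) $n$ is odd and $\gcd(m,v)\ne1$. Then: (1) If $q^v$ is either $1$ or $-1$, then $\operatorname{Aut}(A)\cong \mathbb{Z}/(n)\ltimes(\Bbbk^\times)^n$ (a semidirect product with respect to some action of $\mathbb{Z}/(n)$ on $(\Bbbk^\times)^n$ by group automorphisms). (2) If $q^v\ne\pm1$, then $\operatorname{Aut}(A)\cong(\Bbbk^\times)^n$.
   Context: $\operatorname{Aut}(A)$ is the group of $\Bbbk$-algebra automorphisms of $A$. $\Bbbk_q[x_1,\dots,x_n]$ is the $\Bbbk$-algebra generated by $x_1,\dots,x_n$ subject to $x_jx_i=q\,x_ix_j$ for all $1\le i<j\le n$; it is $\mathbb{N}$-graded with $\deg x_i=1$. For a $\mathbb{Z}$-graded algebra $C=\bigoplus_i C_i$ and a positive integer $v$, the $v$th Veronese subring is $C^{(v)}=\bigoplus_i C_{vi}$. *)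

theory Defs
  imports
    "HOL-Algebra.Algebra"
    "HOL-Library.Poly_Mapping"
begin

section \<open>Group-theoretic notions\<close>

definition field_units :: "'k::field monoid"
  where "field_units = \<lparr>carrier = - {0}, monoid.mult = (*), one = 1\<rparr>"

lemma group_field_units: "group (field_units :: 'k::field monoid)"
proof (rule groupI)
  fix x :: 'k
  assume "x \<in> carrier field_units"
  then show "\<exists>y\<in>carrier field_units. y \<otimes>\<^bsub>field_units\<^esub> x = \<one>\<^bsub>field_units\<^esub>"
    by (intro bexI [of _ "inverse x"]) (auto simp: field_units_def)
qed (auto simp: field_units_def)

text \<open>The external semidirect product \<open>H \<ltimes> N\<close>, for an action
  \<open>\<theta>\<close> of \<open>H\<close> on \<open>N\<close> by automorphisms, i.e. a homomorphism from \<open>H\<close> to \<^term>\<open>AutoGroup N\<close>.\<close>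

definition semidirect_product ::
    "('h, 'c) monoid_scheme \<Rightarrow> ('n, 'd) monoid_scheme \<Rightarrow> ('h \<Rightarrow> 'n \<Rightarrow> 'n) \<Rightarrow> ('h \<times> 'n) monoid"
  where "semidirect_product H N \<theta> =
    \<lparr>carrier = carrier H \<times> carrier N,
     monoid.mult = (\<lambda>(h, x) (k, y). (h \<otimes>\<^bsub>H\<^esub> k, x \<otimes>\<^bsub>N\<^esub> \<theta> h y)),
     one = (\<one>\<^bsub>H\<^esub>, \<one>\<^bsub>N\<^esub>)\<rparr>"

lemma group_semidirect_product:
  assumes H: "group H" and N: "group N" and \<theta>: "\<theta> \<in> hom H (AutoGroup N)"
  shows "group (semidirect_product H N \<theta>)"
proof -
  interpret H: group H by (rule H)
  interpret N: group N by (rule N)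
  interpret A: group "AutoGroup N" by (rule N.AutoGroup)
  interpret \<theta>: group_hom H "AutoGroup N" \<theta>
    by unfold_locales (rule \<theta>)
  have auto: "\<theta> h \<in> auto N" if "h \<in> carrier H" for h
    using \<theta>.hom_closed [OF that] by (simp add: AutoGroup_def)
  have cl: "\<theta> h x \<in> carrier N" if "h \<in> carrier H" "x \<in> carrier N" for h x
    using auto [OF that(1)] that(2) by (auto simp: auto_def hom_def)
  have mult: "\<theta> h (x \<otimes>\<^bsub>N\<^esub> y) = \<theta> h x \<otimes>\<^bsub>N\<^esub> \<theta> h y"
    if "h \<in> carrier H" "x \<in> carrier N" "y \<in> carrier N" for h x y
    using auto [OF that(1)] that(2,3) by (auto simp: auto_def hom_def)
  have comp: "\<theta> (h \<otimes>\<^bsub>H\<^esub> k) x = \<theta> h (\<theta> k x)"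
    if "h \<in> carrier H" "k \<in> carrier H" "x \<in> carrier N" for h k x
  proof -
    have "\<theta> h \<in> Bij (carrier N)" "\<theta> k \<in> Bij (carrier N)"
      using auto that by (auto simp: auto_def)
    then show ?thesis
      using \<theta>.hom_mult [OF that(1,2)] that(3)
      by (simp add: AutoGroup_def BijGroup_def compose_def)
  qed
  have one: "\<theta> \<one>\<^bsub>H\<^esub> x = x" if "x \<in> carrier N" for x
    using \<theta>.hom_one that by (simp add: AutoGroup_def BijGroup_def)
  show ?thesis
  proof (rule groupI)
    fix a
    assume "a \<in> carrier (semidirect_product H N \<theta>)"
    then obtain h x where a: "a = (h, x)" "h \<in> carrier H" "x \<in> carrier N"
      by (auto simp: semidirect_product_def)
    show "\<exists>b\<in>carrier (semidirect_product H N \<theta>).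
        b \<otimes>\<^bsub>semidirect_product H N \<theta>\<^esub> a = \<one>\<^bsub>semidirect_product H N \<theta>\<^esub>"
      by (rule bexI [of _ "(inv\<^bsub>H\<^esub> h, inv\<^bsub>N\<^esub> (\<theta> (inv\<^bsub>H\<^esub> h) x))"])
         (use a in \<open>simp_all add: semidirect_product_def cl del: \<theta>.hom_inv\<close>)
  qed (auto simp: semidirect_product_def cl mult comp one H.m_assoc N.m_assoc
      simp del: \<theta>.hom_mult \<theta>.hom_one)
qed


section \<open>Algebras over a field\<close>

text \<open>A \<open>k\<close>-algebra is represented by a record of type \<^typ>\<open>('k, 'a) module\<close>, which has both the
  ring operations and the scalar multiplication.\<close>

definition algebra_autos :: "('k, 'a) module \<Rightarrow> ('a \<Rightarrow> 'a) set"
  where "algebra_autos A =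
    {f \<in> ring_iso A A \<inter> Bij (carrier A). \<forall>c. \<forall>x\<in>carrier A. f (c \<odot>\<^bsub>A\<^esub> x) = c \<odot>\<^bsub>A\<^esub> f x}"

definition algebra_Aut :: "('k, 'a) module \<Rightarrow> ('a \<Rightarrow> 'a) monoid"
  where "algebra_Aut A = BijGroup (carrier A) \<lparr>carrier := algebra_autos A\<rparr>"

definition quotient_algebra :: "('k, 'a) module \<Rightarrow> 'a set \<Rightarrow> ('k, 'a set) module"
  where "quotient_algebra A I =
    \<lparr>carrier = carrier (A Quot I), monoid.mult = monoid.mult (A Quot I), one = one (A Quot I),
     ring.zero = ring.zero (A Quot I), ring.add = ring.add (A Quot I),
     smult = (\<lambda>c K. \<Union>x\<in>K. I +>\<^bsub>A\<^esub> (c \<odot>\<^bsub>A\<^esub> x))\<rparr>"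

text \<open>An \<open>\<nat>\<close>-grading of \<open>C\<close> is given by the family \<open>gr\<close> of its homogeneous components (as a
  \<open>\<int>\<close>-grading, the components of negative degree vanish).\<close>

definition veronese :: "('k, 'a) module \<Rightarrow> (nat \<Rightarrow> 'a set) \<Rightarrow> nat \<Rightarrow> ('k, 'a) module"
  where "veronese C gr v =
    C \<lparr>carrier := {finsum C c {..<N} | c N. \<forall>i<N. c i \<in> gr (v * i)}\<rparr>"


section \<open>The free algebra\<close>

text \<open>Words form the free monoid, written additively in order to obtain the free algebra as a
  monoid algebra from the convolution product on \<^typ>\<open>'a \<Rightarrow>\<^sub>0 'b\<close>.\<close>

datatype word = Word (letters: "nat list")

instantiation word :: monoid_add
begin

definition zero_word :: word
  where "0 = Word []"

definition plus_word :: "word \<Rightarrow> word \<Rightarrow> word"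
  where "u + w = Word (letters u @ letters w)"

instance
  by standard (simp_all add: zero_word_def plus_word_def)

end

text \<open>The free algebra on the generators \<open>x\<^sub>1, \<dots>, x\<^sub>n\<close>.\<close>

definition free_algebra :: "nat \<Rightarrow> ('k::field, word \<Rightarrow>\<^sub>0 'k) module"
  where "free_algebra n =
    \<lparr>carrier = {f. \<forall>w\<in>Poly_Mapping.keys f. set (letters w) \<subseteq> {1..n}},
     monoid.mult = (*), one = 1, ring.zero = 0, ring.add = (+),
     smult = (\<lambda>c f. Poly_Mapping.single 0 c * f)\<rparr>"

definition gen :: "nat \<Rightarrow> word \<Rightarrow>\<^sub>0 'k::field"
  where "gen i = Poly_Mapping.single (Word [i]) 1"

lemma ring_free_algebra: "ring (free_algebra n :: ('k::field, word \<Rightarrow>\<^sub>0 'k) module)"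
proof -
  have mult: "f * g \<in> carrier (free_algebra n)"
    if "f \<in> carrier (free_algebra n)" "g \<in> carrier (free_algebra n)" for f g :: "word \<Rightarrow>\<^sub>0 'k"
    using that keys_mult [of f g] by (fastforce simp: free_algebra_def plus_word_def)
  have add: "f + g \<in> carrier (free_algebra n)"
    if "f \<in> carrier (free_algebra n)" "g \<in> carrier (free_algebra n)" for f g :: "word \<Rightarrow>\<^sub>0 'k"
    using that Poly_Mapping.keys_add [of f g] by (fastforce simp: free_algebra_def)
  have neg: "- f \<in> carrier (free_algebra n)"
    if "f \<in> carrier (free_algebra n)" for f :: "word \<Rightarrow>\<^sub>0 'k"
    using that by (simp add: free_algebra_def)
  have const: "0 \<in> carrier (free_algebra n :: ('k, word \<Rightarrow>\<^sub>0 'k) module)"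
    "1 \<in> carrier (free_algebra n :: ('k, word \<Rightarrow>\<^sub>0 'k) module)"
    by (simp_all add: free_algebra_def zero_word_def)
  have ops: "(\<otimes>\<^bsub>free_algebra n :: ('k, word \<Rightarrow>\<^sub>0 'k) module\<^esub>) = (*)"
    "(\<oplus>\<^bsub>free_algebra n :: ('k, word \<Rightarrow>\<^sub>0 'k) module\<^esub>) = (+)"
    "\<one>\<^bsub>free_algebra n :: ('k, word \<Rightarrow>\<^sub>0 'k) module\<^esub> = 1"
    "\<zero>\<^bsub>free_algebra n :: ('k, word \<Rightarrow>\<^sub>0 'k) module\<^esub> = 0"
    by (simp_all add: free_algebra_def)
  show ?thesis
  proof (rule ringI)
    show "abelian_group (free_algebra n :: ('k, word \<Rightarrow>\<^sub>0 'k) module)"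
    proof (rule abelian_groupI)
      fix f :: "word \<Rightarrow>\<^sub>0 'k"
      assume "f \<in> carrier (free_algebra n)"
      then show "\<exists>g\<in>carrier (free_algebra n). g \<oplus>\<^bsub>free_algebra n\<^esub> f = \<zero>\<^bsub>free_algebra n\<^esub>"
        by (intro bexI [of _ "- f"]) (simp_all add: ops neg)
    qed (simp_all add: ops add const ac_simps)
    show "monoid (free_algebra n :: ('k, word \<Rightarrow>\<^sub>0 'k) module)"
      by (rule monoidI) (simp_all add: ops mult const mult.assoc)
  qed (simp_all add: ops distrib_left distrib_right)
qed


section \<open>The quantum polynomial algebra\<close>

definition quantum_relations :: "nat \<Rightarrow> 'k::field \<Rightarrow> (word \<Rightarrow>\<^sub>0 'k) set"
  where "quantum_relations n q =
    {gen j * gen i - Poly_Mapping.single 0 q * (gen i * gen j) | i j. 1 \<le> i \<and> i < j \<and> j \<le> n}"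

lemma quantum_relations_subset:
  fixes q :: "'k::field"
  shows "quantum_relations n q \<subseteq> carrier (free_algebra n)"
proof
  fix r :: "word \<Rightarrow>\<^sub>0 'k"
  assume "r \<in> quantum_relations n q"
  then obtain i j where ij: "1 \<le> i" "i < j" "j \<le> n"
    and r: "r = gen j * gen i - Poly_Mapping.single 0 q * (gen i * gen j)"
    by (auto simp: quantum_relations_def)
  have "r = Poly_Mapping.single (Word [j, i]) 1 - Poly_Mapping.single (Word [i, j]) q"
    by (simp add: r gen_def mult_single plus_word_def zero_word_def)
  then have "Poly_Mapping.keys r \<subseteq> {Word [j, i], Word [i, j]}"
    by (auto simp: in_keys_iff lookup_minus lookup_single when_def split: if_splits)
  moreover have "set (letters w) \<subseteq> {1..n}" if "w \<in> {Word [j, i], Word [i, j]}" for w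
    using that ij by auto
  ultimately show "r \<in> carrier (free_algebra n)"
    unfolding free_algebra_def by auto
qed

definition quantum_ideal :: "nat \<Rightarrow> 'k::field \<Rightarrow> (word \<Rightarrow>\<^sub>0 'k) set"
  where "quantum_ideal n q = Idl\<^bsub>free_algebra n\<^esub> (quantum_relations n q)"

definition quantum_algebra :: "nat \<Rightarrow> 'k::field \<Rightarrow> ('k, (word \<Rightarrow>\<^sub>0 'k) set) module"
  where "quantum_algebra n q = quotient_algebra (free_algebra n) (quantum_ideal n q)"

definition quantum_component :: "nat \<Rightarrow> 'k::field \<Rightarrow> nat \<Rightarrow> (word \<Rightarrow>\<^sub>0 'k) set set"
  where "quantum_component n q d =
    {quantum_ideal n q +>\<^bsub>free_algebra n\<^esub> f | f.
      f \<in> carrier (free_algebra n) \<and> (\<forall>w\<in>Poly_Mapping.keys f. length (letters w) = d)}"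

end

theory Submission
  imports Defs
begin

text \<open>
  The ordered monomials \<open>x^a\<close> form a basis of the quantum polynomial algebra, with
  \<open>x^a x^b = q^(cross a b) x^(a + b)\<close>. The Veronese subring \<open>A\<close> is therefore a twisted monoid algebra
  on the monoid \<open>M\<close> of the exponent vectors whose degree is divisible by \<open>v\<close>. The heart of the
  matter is that every automorphism of \<open>A\<close> sends monomials to scalar multiples of monomials.

  For this, a principal ideal generated by a monomial is described in terms that every automorphism
  preserves. Let \<open>Lam\<close> be the set of exponents of central monomials. The hypothesis on \<open>n\<close>, \<open>m\<close> and \<open>v\<close>
  gives a common divisor greater than \<open>1\<close> of all entries of all vectors in \<open>Lam\<close> (\<open>Lam_dvd\<close>). So the
  \<open>i\<close>th entries of these vectors are multiples of a least positive one, \<open>t i\<close>, which is at least \<open>2\<close>.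
  The map that deletes all non-central monomials vanishes on commutators; this puts the
  fractions \<open>y / z\<close> with central \<open>z\<close> and \<open>y A \<subseteq> z A + [A, A]\<close> into the codifferent of \<open>A\<close> over its centre. Such
  a fraction is a combination of Laurent monomials whose exponents are at least \<open>1 - t i\<close> in each
  coordinate \<open>i\<close>, and these bounds are attained. Consequently the elements that carry the \<open>v\<close>th powers
  of all these fractions into \<open>A\<close> form the ideal generated by \<open>x^d\<close> with \<open>d i = v (t i - 1)\<close>
  (\<open>monomial_dvec_in_J\<close> and \<open>J_dvd\<close>); the exponent \<open>v\<close> is there to have \<open>d\<close> in \<open>M\<close>. An automorphism maps
  this ideal onto itself, so the image of \<open>x^d\<close> divides \<open>x^d\<close> and, as monomials have only monomial
  factors, is a monomial. All entries of \<open>d\<close> are positive, so each monomial divides a power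
  of \<open>x^d\<close>, and its image is again a monomial (\<open>iso_monomial\<close>).

  An automorphism thus induces an additive bijection of \<open>M\<close>. Such a bijection permutes the
  coordinates, and the commutation relations between monomials survive. How a permutation changes
  these relations is measured by its inversions, as a coboundary with values in the powers of \<open>q^2\<close>;
  since \<open>q^2\<close> differs from \<open>1\<close>, the permutation is a rotation, and a non-trivial rotation forces
  \<open>q^(2 v) = 1\<close> (\<open>com_preserving_permutation\<close>). The automorphisms that fix each monomial up to a scalar
  are the characters of the group generated by \<open>M\<close>, which is free of rank \<open>n\<close>; they form the
  torus. If \<open>\<epsilon> = q^v\<close> is \<open>1\<close> or \<open>-1\<close>, then the rotation of the coordinates by one place does lift to an
  automorphism, and its scalars can be chosen such that its \<open>n\<close>th power is the identity
  (\<open>Aut_semidirect\<close>). This splits the extension of the rotations by the torus.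
\<close>

section \<open>Finitely supported functions\<close>

abbreviation lookup :: "('a \<Rightarrow>\<^sub>0 'b::zero) \<Rightarrow> 'a \<Rightarrow> 'b"
  where "lookup \<equiv> Poly_Mapping.lookup"

abbreviation single :: "'a \<Rightarrow> 'b::zero \<Rightarrow> 'a \<Rightarrow>\<^sub>0 'b"
  where "single \<equiv> Poly_Mapping.single"

abbreviation keys :: "('a \<Rightarrow>\<^sub>0 'b::zero) \<Rightarrow> 'a set"
  where "keys \<equiv> Poly_Mapping.keys"

lemma keys_subset_induct [consumes 1, case_names zero add]:
  fixes p :: "'a \<Rightarrow>\<^sub>0 'b::comm_monoid_add"
  assumes "keys p \<subseteq> M"
    and "P 0"
    and step: "\<And>a c f. a \<in> M \<Longrightarrow> keys f \<subseteq> M \<Longrightarrow> P f \<Longrightarrow> P (single a c + f)"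
  shows "P p"
proof -
  have *: "P (\<Sum>a\<in>K. single a (lookup p a)) \<and>
      keys (\<Sum>a\<in>K. single a (lookup p a)) \<subseteq> M"
    if "finite K" "K \<subseteq> M" for K
    using that
  proof (induction K rule: finite_induct)
    case (insert a K)
    let ?s = "\<Sum>a\<in>K. single a (lookup p a)"
    have "keys (single a (lookup p a) + ?s) \<subseteq> M"
      using insert Poly_Mapping.keys_add [of "single a (lookup p a)" ?s]
      by (auto split: if_splits)
    with insert show ?case
      by (auto intro: step)
  qed (simp add: assms)
  have "(\<Sum>a\<in>keys p. single a (lookup p a)) = p"
    by (rule poly_mapping_eqI)
      (auto simp: lookup_sum lookup_single when_def in_keys_iff sum.delta')
  then show ?thesis
    using * [of "keys p"] assms(1) by simp
qed

lemma keys_add_subset: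
  "keys f \<subseteq> M \<Longrightarrow> keys g \<subseteq> M \<Longrightarrow> keys (f + g) \<subseteq> M"
  using Poly_Mapping.keys_add [of f g] by blast

definition restrict_keys :: "'a set \<Rightarrow> ('a \<Rightarrow>\<^sub>0 'b::comm_monoid_add) \<Rightarrow> 'a \<Rightarrow>\<^sub>0 'b"
  where "restrict_keys A p = (\<Sum>a\<in>keys p \<inter> A. single a (lookup p a))"

lemma lookup_restrict_keys: "lookup (restrict_keys A p) a = (if a \<in> A then lookup p a else 0)"
  by (auto simp: restrict_keys_def lookup_sum lookup_single when_def in_keys_iff sum.delta')

lemma keys_restrict_keys: "keys (restrict_keys A p) = keys p \<inter> A"
  by (auto simp: in_keys_iff lookup_restrict_keys split: if_splits)

lemma restrict_keys_add: "restrict_keys A (f + g) = restrict_keys A f + restrict_keys A g"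
  by (rule poly_mapping_eqI) (simp add: lookup_restrict_keys lookup_add)

lemma restrict_keys_zero [simp]: "restrict_keys A 0 = 0"
  by (simp add: restrict_keys_def)

lemma restrict_keys_minus: "restrict_keys A (- f) = - restrict_keys A (f :: 'a \<Rightarrow>\<^sub>0 'b::ab_group_add)"
  by (rule poly_mapping_eqI) (simp add: lookup_restrict_keys)

lemma restrict_keys_diff: "restrict_keys A (f - g) = restrict_keys A f - restrict_keys A (g :: 'a \<Rightarrow>\<^sub>0 'b::ab_group_add)"
  by (metis diff_conv_add_uminus restrict_keys_add restrict_keys_minus)

lemma restrict_keys_single: "restrict_keys A (single a c) = (if a \<in> A then single a c else 0)"
  by (rule poly_mapping_eqI) (auto simp: lookup_restrict_keys lookup_single when_def)

lemma sum_restrict_keys: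
  fixes p :: "'a \<Rightarrow>\<^sub>0 'b::comm_monoid_add"
  shows "p = (\<Sum>C\<in>h ` keys p. restrict_keys {a. h a = C} p)"
proof (rule poly_mapping_eqI)
  fix a
  have "(\<Sum>C\<in>h ` keys p. lookup (restrict_keys {a. h a = C} p) a)
      = (\<Sum>C\<in>h ` keys p. if C = h a then lookup p a else 0)"
    by (rule sum.cong) (auto simp: lookup_restrict_keys)
  also have "\<dots> = lookup p a"
    by (auto simp: in_keys_iff)
  finally show "lookup p a = lookup (\<Sum>C\<in>h ` keys p. restrict_keys {a. h a = C} p) a"
    by (simp add: lookup_sum)
qed

section \<open>Twisted monoid algebras\<close>

type_synonym exponent = "nat \<Rightarrow>\<^sub>0 nat"

type_synonym 'k qpoly = "exponent \<Rightarrow>\<^sub>0 'k"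

text \<open>The power of \<open>q\<close> that appears when the factors of \<open>x^a x^b\<close> are sorted: each letter of \<open>x^a\<close>
  passes the smaller letters of \<open>x^b\<close>.\<close>

definition cross :: "nat \<Rightarrow> exponent \<Rightarrow> exponent \<Rightarrow> nat"
  where "cross n a b = (\<Sum>j\<in>{1..n}. \<Sum>i\<in>{1..<j}. lookup a j * lookup b i)"

lemma cross_add_left: "cross n (a + a') b = cross n a b + cross n a' b"
  by (simp add: cross_def lookup_add algebra_simps sum.distrib)

lemma cross_add_right: "cross n a (b + b') = cross n a b + cross n a b'"
  by (simp add: cross_def lookup_add algebra_simps sum.distrib)

lemma cross_zero [simp]: "cross n 0 b = 0" "cross n a 0 = 0"
  by (simp_all add: cross_def)

lemma cross_single:
  assumes "x \<in> {1..n}" "y \<in> {1..n}"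
  shows "cross n (single x k) (single y l) = (if y < x then k * l else 0)"
proof -
  have *: "(\<Sum>i\<in>{1..<j}. lookup (single x k) j * lookup (single y l) i) =
      (if x = j then if y < x then k * l else 0 else 0)" for j
    using assms by (auto simp: lookup_single when_def if_distrib[of "(*) _"] sum.delta' cong: if_cong)
  show ?thesis
    unfolding cross_def * using assms by (subst sum.delta') auto
qed

definition tdeg :: "nat \<Rightarrow> exponent \<Rightarrow> nat"
  where "tdeg n a = (\<Sum>i\<in>{1..n}. lookup a i)"

lemma tdeg_add: "tdeg n (a + b) = tdeg n a + tdeg n b"
  by (simp add: tdeg_def lookup_add sum.distrib)

lemma tdeg_zero [simp]: "tdeg n 0 = 0"
  by (simp add: tdeg_def)

lemma tdeg_single: "x \<in> {1..n} \<Longrightarrow> tdeg n (single x k) = k"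
  by (simp add: tdeg_def lookup_single when_def sum.delta)

text \<open>The exponents of the Veronese subring; for \<open>v = 1\<close> these are all exponents in \<open>n\<close> variables.\<close>

definition mons :: "nat \<Rightarrow> nat \<Rightarrow> exponent set"
  where "mons n v = {a. keys a \<subseteq> {1..n} \<and> v dvd tdeg n a}"

lemma mons_zero [simp]: "0 \<in> mons n v"
  by (simp add: mons_def)

lemma mons_add: "a \<in> mons n v \<Longrightarrow> b \<in> mons n v \<Longrightarrow> a + b \<in> mons n v"
  using Poly_Mapping.keys_add [of a b] by (auto simp: mons_def tdeg_add)

definition qpolys :: "nat \<Rightarrow> nat \<Rightarrow> (('k::zero) qpoly) set"
  where "qpolys n v = {p. keys p \<subseteq> mons n v}"

definition star :: "nat \<Rightarrow> 'k::field \<Rightarrow> 'k qpoly \<Rightarrow> 'k qpoly \<Rightarrow> 'k qpoly"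
  where "star n q f g = (\<Sum>a\<in>keys f. \<Sum>b\<in>keys g.
    single (a + b) (q ^ cross n a b * lookup f a * lookup g b))"

lemma star_add_left: "star n q (f + f') g = star n q f g + star n q f' g"
  unfolding star_def
  by (rule setsum_keys_plus_distrib) (simp_all add: single_add [symmetric] sum.distrib [symmetric] algebra_simps)

lemma star_add_right: "star n q f (g + g') = star n q f g + star n q f g'"
  unfolding star_def sum.distrib [symmetric]
  by (rule sum.cong [OF refl], rule setsum_keys_plus_distrib) (simp_all add: single_add [symmetric] algebra_simps)

lemma star_zero [simp]: "star n q 0 g = 0" "star n q f 0 = 0"
  by (simp_all add: star_def)

lemma star_single:
  "star n q (single a c) (single b d) = single (a + b) (q ^ cross n a b * c * d)"
  by (cases "c = 0"; cases "d = 0") (simp_all add: star_def)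

lemma star_minus_right: "star n q f (- g) = - star n q f g"
  by (metis add.right_inverse add_eq_0_iff star_add_right star_zero(2))

lemma star_diff_right: "star n q f (g - g') = star n q f g - star n q f g'"
  by (metis diff_conv_add_uminus star_add_right star_minus_right)

lemma star_assoc: "star n q (star n q f g) h = star n q f (star n q g h)"
proof -
  have 1: "star n q (star n q (single a c) (single b d)) h
      = star n q (single a c) (star n q (single b d) h)" for a b c d
    by (rule keys_subset_induct [of h UNIV])
      (simp_all add: star_add_right star_single cross_add_left cross_add_right power_add add.assoc ac_simps)
  have 2: "star n q (star n q (single a c) g) h
      = star n q (single a c) (star n q g h)" for a c
    by (rule keys_subset_induct [of g UNIV]) (simp_all add: star_add_right star_add_left 1)
  show ?thesis
    by (rule keys_subset_induct [of f UNIV]) (simp_all add: star_add_left 2)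
qed

lemma star_one [simp]: "star n q 1 f = f" "star n q f 1 = f"
proof -
  show "star n q 1 f = f"
    by (rule keys_subset_induct [of f UNIV], simp_all add: star_add_right)
      (simp add: star_single flip: single_one)
  show "star n q f 1 = f"
    by (rule keys_subset_induct [of f UNIV], simp_all add: star_add_left)
      (simp add: star_single flip: single_one)
qed

lemma keys_star: "keys (star n q f g) \<subseteq> {a + b | a b. a \<in> keys f \<and> b \<in> keys g}"
proof -
  have "keys (star n q f g) \<subseteq> (\<Union>a\<in>keys f. \<Union>b\<in>keys g. {a + b})"
    unfolding star_def
    by (rule order.trans [OF keys_sum], intro UN_mono order.refl, rule order.trans [OF keys_sum], intro UN_mono order.refl) auto
  then show ?thesis
    by blast
qed

lemma qpolys_zero [simp]: "0 \<in> qpolys n v"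
  by (simp add: qpolys_def)

lemma qpolys_one [simp]: "1 \<in> qpolys n v"
  by (simp add: qpolys_def)

lemma qpolys_add: "f \<in> qpolys n v \<Longrightarrow> g \<in> qpolys n v \<Longrightarrow> f + g \<in> qpolys n v"
  by (auto simp: qpolys_def keys_add_subset)

lemma qpolys_uminus: "f \<in> qpolys n v \<Longrightarrow> - (f :: ('k::field) qpoly) \<in> qpolys n v"
  by (simp add: qpolys_def)

lemma qpolys_single: "a \<in> mons n v \<Longrightarrow> single a c \<in> qpolys n v"
  by (simp add: qpolys_def)

lemma qpolys_star: "f \<in> qpolys n v \<Longrightarrow> g \<in> qpolys n v \<Longrightarrow> star n q f g \<in> qpolys n v"
  using keys_star [of n q f g] mons_add by (fastforce simp: qpolys_def)

definition twisted_algebra :: "nat \<Rightarrow> 'k::field \<Rightarrow> nat \<Rightarrow> ('k, 'k qpoly) module"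
  where "twisted_algebra n q v =
    \<lparr>carrier = qpolys n v, monoid.mult = star n q, one = 1, ring.zero = 0, ring.add = (+),
     smult = (\<lambda>c. star n q (single 0 c))\<rparr>"

section \<open>Normal forms of words\<close>

definition content :: "nat list \<Rightarrow> exponent"
  where "content xs = (\<Sum>x\<leftarrow>xs. single x 1)"

text \<open>Sorting a word by the relations \<open>x_j x_i = q x_i x_j\<close> costs one factor \<open>q\<close> for every pair of
  letters in the wrong order.\<close>

fun inversions :: "nat list \<Rightarrow> nat"
  where "inversions [] = 0"
  | "inversions (x # xs) = length (filter (\<lambda>y. y < x) xs) + inversions xs"

lemma content_simps [simp]:
  "content [] = 0" "content (x # xs) = single x 1 + content xs"
  "content (xs @ ys) = content xs + content ys"
  by (simp_all add: content_def)

lemma cross_single_content: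
  assumes "x \<in> {1..n}" "set ys \<subseteq> {1..n}"
  shows "cross n (single x 1) (content ys) = length (filter (\<lambda>y. y < x) ys)"
  using assms(2) by (induction ys) (use assms(1) in \<open>auto simp: cross_add_right cross_single\<close>)

lemma inversions_append:
  assumes "set xs \<subseteq> {1..n}" "set ys \<subseteq> {1..n}"
  shows "inversions (xs @ ys) = inversions xs + inversions ys + cross n (content xs) (content ys)"
  using assms(1) by (induction xs) (use assms(2) in \<open>auto simp: cross_add_left cross_single_content simp del: One_nat_def\<close>)

lemma keys_content: "keys (content xs) = set xs"
proof (induction xs)
  case (Cons x xs)
  have "keys (single x (1::nat) + content xs) = insert x (keys (content xs))"
    by (auto simp: in_keys_iff lookup_add lookup_single when_def split: if_splits)
  then show ?case
    using Cons by simp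
qed simp

lemma tdeg_content: "set xs \<subseteq> {1..n} \<Longrightarrow> tdeg n (content xs) = length xs"
  by (induction xs) (auto simp: tdeg_add tdeg_single)

text \<open>The normal form of an element of the free algebra: each word is replaced by its sorted monomial.
  It is multiplicative (\<open>nf_mult\<close>) and its kernel is the ideal of the quantum relations
  (\<open>quantum_ideal_eq_kernel\<close>), which identifies the quantum polynomial algebra with a twisted
  monoid algebra.\<close>

definition nf :: "'k::field \<Rightarrow> (word \<Rightarrow>\<^sub>0 'k) \<Rightarrow> 'k qpoly"
  where "nf q f = (\<Sum>w\<in>keys f. single (content (letters w)) (q ^ inversions (letters w) * lookup f w))"

lemma nf_add: "nf q (f + g) = nf q f + nf q g"
  unfolding nf_def by (rule setsum_keys_plus_distrib) (simp_all add: single_add [symmetric] algebra_simps)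

lemma nf_zero [simp]: "nf q 0 = 0"
  by (simp add: nf_def)

lemma nf_single: "nf q (single w c) = single (content (letters w)) (q ^ inversions (letters w) * c)"
  by (cases "c = 0") (simp_all add: nf_def)

lemma nf_minus: "nf q (- f) = - nf q f"
  by (metis add.right_inverse add_eq_0_iff nf_add nf_zero)

lemma nf_diff: "nf q (f - g) = nf q f - nf q g"
  by (metis diff_conv_add_uminus nf_add nf_minus)

definition words :: "nat \<Rightarrow> word set"
  where "words n = {w. set (letters w) \<subseteq> {1..n}}"

lemma carrier_free_algebra: "carrier (free_algebra n) = {f. keys f \<subseteq> words n}"
  by (auto simp: free_algebra_def words_def)

lemma letters_add [simp]: "letters (u + w) = letters u @ letters w"
  by (simp add: plus_word_def)

lemma letters_zero [simp]: "letters 0 = []"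
  by (simp add: zero_word_def)

text \<open>Bilinearity reduces this to words, where it is the count of inversions in a concatenation.\<close>

lemma nf_mult:
  assumes f: "keys f \<subseteq> words n" and g: "keys g \<subseteq> words n"
  shows "nf q (f * g) = star n q (nf q f) (nf q g)"
proof -
  have 1: "nf q (single u c * g) = star n q (nf q (single u c)) (nf q g)" if u: "u \<in> words n" for u c
    using g
  proof (induction g rule: keys_subset_induct)
    case (add w d g)
    then show ?case
      using u by (simp add: distrib_left nf_add star_add_right mult_single nf_single star_single words_def inversions_append power_add ac_simps)
  qed simp
  show ?thesis
    using f by (induction f rule: keys_subset_induct) (simp_all add: distrib_right nf_add star_add_left 1)
qed

lemma nf_in_qpolys:
  assumes "keys f \<subseteq> words n"
    and "\<And>w. w \<in> keys f \<Longrightarrow> v dvd length (letters w)"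
  shows "nf q f \<in> qpolys n v"
proof -
  have "keys (nf q f) \<subseteq> (\<Union>w\<in>keys f. {content (letters w)})"
    unfolding nf_def by (rule order.trans [OF keys_sum]) auto
  also have "\<dots> \<subseteq> mons n v"
  proof clarify
    fix w
    assume w: "w \<in> keys f"
    with assms(1) have "set (letters w) \<subseteq> {1..n}"
      by (auto simp: words_def)
    with w show "content (letters w) \<in> mons n v"
      using assms(2) by (simp add: mons_def keys_content tdeg_content del: atLeastAtMost_iff One_nat_def)
  qed
  finally show ?thesis
    by (simp add: qpolys_def)
qed

section \<open>Automorphism groups of algebras\<close>

definition algebra_closed :: "('k, 'a) module \<Rightarrow> bool"
  where "algebra_closed P \<longleftrightarrow> \<one>\<^bsub>P\<^esub> \<in> carrier P \<and>
    (\<forall>x\<in>carrier P. \<forall>y\<in>carrier P. x \<otimes>\<^bsub>P\<^esub> y \<in> carrier P \<and> x \<oplus>\<^bsub>P\<^esub> y \<in> carrier P) \<and>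
    (\<forall>c. \<forall>x\<in>carrier P. c \<odot>\<^bsub>P\<^esub> x \<in> carrier P)"

text \<open>These maps need not be extensional, so that they compose as ordinary functions; the
  automorphisms of an algebra are the extensional ones (\<open>algebra_autos_eq\<close>).\<close>

definition algebra_isos :: "('k, 'a) module \<Rightarrow> ('k, 'b) module \<Rightarrow> ('a \<Rightarrow> 'b) set"
  where "algebra_isos P Q = {\<phi> \<in> ring_iso P Q. \<forall>c. \<forall>x\<in>carrier P. \<phi> (c \<odot>\<^bsub>P\<^esub> x) = c \<odot>\<^bsub>Q\<^esub> \<phi> x}"

lemma algebra_isos_iff:
  "\<phi> \<in> algebra_isos P Q \<longleftrightarrow> bij_betw \<phi> (carrier P) (carrier Q) \<and> \<phi> \<one>\<^bsub>P\<^esub> = \<one>\<^bsub>Q\<^esub> \<and>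
    (\<forall>x\<in>carrier P. \<forall>y\<in>carrier P. \<phi> (x \<otimes>\<^bsub>P\<^esub> y) = \<phi> x \<otimes>\<^bsub>Q\<^esub> \<phi> y \<and> \<phi> (x \<oplus>\<^bsub>P\<^esub> y) = \<phi> x \<oplus>\<^bsub>Q\<^esub> \<phi> y) \<and>
    (\<forall>c. \<forall>x\<in>carrier P. \<phi> (c \<odot>\<^bsub>P\<^esub> x) = c \<odot>\<^bsub>Q\<^esub> \<phi> x)"
  unfolding algebra_isos_def ring_iso_def ring_hom_def by (auto simp: bij_betw_apply)

lemma algebra_autos_eq: "algebra_autos P = algebra_isos P P \<inter> extensional (carrier P)"
  unfolding algebra_autos_def algebra_isos_def Bij_def ring_iso_def by auto

lemma algebra_isos_inv:
  assumes \<phi>: "\<phi> \<in> algebra_isos P Q" and P: "algebra_closed P"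
  shows "inv_into (carrier P) \<phi> \<in> algebra_isos Q P"
proof -
  let ?\<psi> = "inv_into (carrier P) \<phi>"
  have b: "bij_betw \<phi> (carrier P) (carrier Q)"
    using \<phi> by (simp add: algebra_isos_iff)
  have l: "?\<psi> (\<phi> x) = x" if "x \<in> carrier P" for x
    using b that by (simp add: bij_betw_inv_into_left)
  have r: "\<exists>x\<in>carrier P. y = \<phi> x" if "y \<in> carrier Q" for y
    using b that by (auto simp: bij_betw_def)
  have one: "?\<psi> \<one>\<^bsub>Q\<^esub> = \<one>\<^bsub>P\<^esub>"
    using l [of "\<one>\<^bsub>P\<^esub>"] \<phi> P by (simp add: algebra_isos_iff algebra_closed_def)
  have mult: "?\<psi> (x \<otimes>\<^bsub>Q\<^esub> y) = ?\<psi> x \<otimes>\<^bsub>P\<^esub> ?\<psi> y \<and> ?\<psi> (x \<oplus>\<^bsub>Q\<^esub> y) = ?\<psi> x \<oplus>\<^bsub>P\<^esub> ?\<psi> y"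
    if xy: "x \<in> carrier Q" "y \<in> carrier Q" for x y
  proof -
    obtain x' y' where *: "x' \<in> carrier P" "x = \<phi> x'" "y' \<in> carrier P" "y = \<phi> y'"
      using r xy by meson
    then have "x \<otimes>\<^bsub>Q\<^esub> y = \<phi> (x' \<otimes>\<^bsub>P\<^esub> y')" "x \<oplus>\<^bsub>Q\<^esub> y = \<phi> (x' \<oplus>\<^bsub>P\<^esub> y')"
      using \<phi> by (auto simp: algebra_isos_iff)
    then show ?thesis
      using * P by (simp add: l algebra_closed_def)
  qed
  have smult: "?\<psi> (c \<odot>\<^bsub>Q\<^esub> x) = c \<odot>\<^bsub>P\<^esub> ?\<psi> x" if x: "x \<in> carrier Q" for c x
  proof -
    obtain x' where *: "x' \<in> carrier P" "x = \<phi> x'"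
      using r x by meson
    then have "c \<odot>\<^bsub>Q\<^esub> x = \<phi> (c \<odot>\<^bsub>P\<^esub> x')"
      using \<phi> by (auto simp: algebra_isos_iff)
    then show ?thesis
      using * P by (simp add: l algebra_closed_def)
  qed
  show ?thesis
    unfolding algebra_isos_iff using bij_betw_inv_into [OF b] one mult smult by blast
qed

lemma algebra_isos_comp:
  assumes \<phi>: "\<phi> \<in> algebra_isos P Q" and \<psi>: "\<psi> \<in> algebra_isos Q R"
    and h: "\<And>x. x \<in> carrier P \<Longrightarrow> h x = \<psi> (\<phi> x)" and P: "algebra_closed P"
  shows "h \<in> algebra_isos P R"
proof -
  have "bij_betw h (carrier P) (carrier R)"
    using bij_betw_trans [of \<phi> "carrier P" "carrier Q" \<psi> "carrier R"] \<phi> \<psi>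
    by (subst bij_betw_cong [of _ _ "\<psi> \<circ> \<phi>"]) (auto simp: h algebra_isos_iff)
  moreover have "\<phi> x \<in> carrier Q" if "x \<in> carrier P" for x
    using \<phi> that by (auto simp: algebra_isos_iff bij_betw_apply)
  ultimately show ?thesis
    using \<phi> \<psi> P unfolding algebra_isos_iff algebra_closed_def by (simp add: h)
qed

lemma algebra_autos_Bij: "f \<in> algebra_autos P \<Longrightarrow> f \<in> Bij (carrier P)"
  by (simp add: algebra_autos_def)

lemma algebra_autos_closed: "f \<in> algebra_autos P \<Longrightarrow> x \<in> carrier P \<Longrightarrow> f x \<in> carrier P"
  by (auto simp: algebra_autos_eq algebra_isos_iff bij_betw_apply)

lemma algebra_Aut_simps:
  "carrier (algebra_Aut P) = algebra_autos P"
  "f \<in> algebra_autos P \<Longrightarrow> g \<in> algebra_autos P \<Longrightarrow> f \<otimes>\<^bsub>algebra_Aut P\<^esub> g = compose (carrier P) f g"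
  "\<one>\<^bsub>algebra_Aut P\<^esub> = (\<lambda>x\<in>carrier P. x)"
  by (simp_all add: algebra_Aut_def BijGroup_def algebra_autos_Bij)

lemma group_algebra_Aut:
  assumes "algebra_closed P"
  shows "group (algebra_Aut P)"
proof -
  interpret B: group "BijGroup (carrier P)"
    by (rule group_BijGroup)
  have comp: "compose (carrier P) f g \<in> algebra_autos P" if "f \<in> algebra_autos P" "g \<in> algebra_autos P" for f g
    using that algebra_isos_comp [of g P P f P "compose (carrier P) f g"] assms
    by (simp add: algebra_autos_eq compose_def)
  have one: "(\<lambda>x\<in>carrier P. x) \<in> algebra_autos P"
    using assms by (simp add: algebra_autos_eq algebra_isos_iff algebra_closed_def bij_betw_def inj_on_def)
  have inv: "(\<lambda>x\<in>carrier P. inv_into (carrier P) f x) \<in> algebra_autos P" if f: "f \<in> algebra_autos P" for f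
  proof -
    have f': "f \<in> algebra_isos P P"
      using f by (simp add: algebra_autos_eq)
    have id: "(\<lambda>x. x) \<in> algebra_isos P P"
      by (simp add: algebra_isos_iff bij_betw_def inj_on_def)
    have "(\<lambda>x\<in>carrier P. inv_into (carrier P) f x) \<in> algebra_isos P P"
      by (rule algebra_isos_comp [OF algebra_isos_inv [OF f' assms] id _ assms]) simp
    then show ?thesis
      by (simp add: algebra_autos_eq)
  qed
  have "subgroup (algebra_autos P) (BijGroup (carrier P))"
  proof
    show "algebra_autos P \<subseteq> carrier (BijGroup (carrier P))"
      by (auto simp: BijGroup_def algebra_autos_Bij)
  next
    fix f g
    assume "f \<in> algebra_autos P" "g \<in> algebra_autos P"
    then show "f \<otimes>\<^bsub>BijGroup (carrier P)\<^esub> g \<in> algebra_autos P"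
      by (simp add: BijGroup_def algebra_autos_Bij comp)
  next
    show "\<one>\<^bsub>BijGroup (carrier P)\<^esub> \<in> algebra_autos P"
      by (simp add: BijGroup_def one)
  next
    fix f
    assume "f \<in> algebra_autos P"
    then show "inv\<^bsub>BijGroup (carrier P)\<^esub> f \<in> algebra_autos P"
      by (simp add: inv_BijGroup algebra_autos_Bij inv)
  qed
  then show ?thesis
    unfolding algebra_Aut_def by (rule B.subgroup_imp_group)
qed

text \<open>Conjugation by an isomorphism. It allows all computations to take place in the twisted monoid
  algebra.\<close>

lemma algebra_Aut_cong:
  assumes \<phi>: "\<phi> \<in> algebra_isos P Q" and P: "algebra_closed P" and Q: "algebra_closed Q"
  shows "algebra_Aut Q \<cong> algebra_Aut P"
proof -
  let ?\<psi> = "inv_into (carrier P) \<phi>"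
  define C where "C f = (\<lambda>x\<in>carrier P. ?\<psi> (f (\<phi> x)))" for f
  define D where "D f = (\<lambda>y\<in>carrier Q. \<phi> (f (?\<psi> y)))" for f
  have \<psi>: "?\<psi> \<in> algebra_isos Q P"
    by (rule algebra_isos_inv [OF \<phi> P])
  have mem: "\<phi> x \<in> carrier Q" "?\<psi> (\<phi> x) = x" if "x \<in> carrier P" for x
    using \<phi> that by (auto simp: algebra_isos_iff bij_betw_apply bij_betw_inv_into_left)
  have mem': "?\<psi> y \<in> carrier P" "\<phi> (?\<psi> y) = y" if "y \<in> carrier Q" for y
    using \<phi> \<psi> that by (auto simp: algebra_isos_iff bij_betw_apply intro: bij_betw_inv_into_right)
  have C: "C f \<in> algebra_autos P" if f: "f \<in> algebra_autos Q" for f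
  proof -
    have "f \<in> algebra_isos Q Q"
      using f by (simp add: algebra_autos_eq)
    then have "(\<lambda>x. f (\<phi> x)) \<in> algebra_isos P Q"
      by (rule algebra_isos_comp [OF \<phi> _ refl P])
    then have "C f \<in> algebra_isos P P"
      by (rule algebra_isos_comp [OF _ \<psi> _ P]) (simp add: C_def)
    then show ?thesis
      by (simp add: algebra_autos_eq C_def)
  qed
  have D: "D f \<in> algebra_autos Q" if f: "f \<in> algebra_autos P" for f
  proof -
    have "f \<in> algebra_isos P P"
      using f by (simp add: algebra_autos_eq)
    then have "(\<lambda>x. f (?\<psi> x)) \<in> algebra_isos Q P"
      by (rule algebra_isos_comp [OF \<psi> _ refl Q])
    then have "D f \<in> algebra_isos Q Q"
      by (rule algebra_isos_comp [OF _ \<phi> _ Q]) (simp add: D_def)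
    then show ?thesis
      by (simp add: algebra_autos_eq D_def)
  qed
  have CD: "C (D f) = f" if "f \<in> algebra_autos P" for f
    using that algebra_autos_closed [OF that] by (auto simp: fun_eq_iff C_def D_def mem mem' algebra_autos_eq extensional_def)
  have DC: "D (C f) = f" if "f \<in> algebra_autos Q" for f
    using that algebra_autos_closed [OF that] by (auto simp: fun_eq_iff C_def D_def mem mem' algebra_autos_eq extensional_def)
  have "C \<in> iso (algebra_Aut Q) (algebra_Aut P)"
  proof (rule isoI)
    show "C \<in> hom (algebra_Aut Q) (algebra_Aut P)"
    proof (rule homI)
      fix f g
      assume fg: "f \<in> carrier (algebra_Aut Q)" "g \<in> carrier (algebra_Aut Q)"
      then have *: "f \<in> algebra_autos Q" "g \<in> algebra_autos Q"
        by (simp_all add: algebra_Aut_simps)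
      show "C (f \<otimes>\<^bsub>algebra_Aut Q\<^esub> g) = C f \<otimes>\<^bsub>algebra_Aut P\<^esub> C g"
        unfolding algebra_Aut_simps(2) [OF C [OF *(1)] C [OF *(2)]]
        using * algebra_autos_closed [OF *(2)] by (auto simp: algebra_Aut_simps C fun_eq_iff C_def compose_def mem mem')
    qed (simp add: algebra_Aut_simps C)
    show "bij_betw C (carrier (algebra_Aut Q)) (carrier (algebra_Aut P))"
      by (rule bij_betw_byWitness [where f' = D]) (auto simp: algebra_Aut_simps C D CD DC)
  qed
  then show ?thesis
    by (rule is_isoI)
qed

section \<open>Cyclic extensions that split\<close>

text \<open>An extension of a cyclic group by \<open>N\<close> splits as soon as a generator lifts to an element \<open>\<tau>\<close>
  whose \<open>n\<close>th power is trivial; the action is conjugation by \<open>\<tau>\<close>. The quotient is given only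
  through the powers \<open>\<tau>^h\<close> with \<open>h < n\<close>, which represent the cosets of the image of \<open>N\<close>, and
  \<open>\<tau>^(n - h)\<close> serves as the inverse of \<open>\<tau>^h\<close>.\<close>

lemma (in group) cyclic_semidirect_product:
  fixes N :: "('c, 'd) monoid_scheme" and n :: nat
  assumes N: "group N" and D: "D \<in> hom N G" and inj: "inj_on D (carrier N)"
    and \<tau>: "\<tau> \<in> carrier G" and n: "0 < n" and \<tau>n: "\<tau> [^] n = \<one>"
    and conj: "\<And>h x. h < n \<Longrightarrow> x \<in> carrier N \<Longrightarrow> \<tau> [^] h \<otimes> D x \<otimes> \<tau> [^] (n - h) \<in> D ` carrier N"
    and decomp: "\<And>g. g \<in> carrier G \<Longrightarrow> \<exists>h<n. \<exists>x\<in>carrier N. g = D x \<otimes> \<tau> [^] h"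
    and uniq: "\<And>h. h < n \<Longrightarrow> \<tau> [^] h \<in> D ` carrier N \<Longrightarrow> h = 0"
  shows "\<exists>\<theta>\<in>hom (integer_mod_group n) (AutoGroup N). G \<cong> semidirect_product (integer_mod_group n) N \<theta>"
proof -
  interpret N: group N by (rule N)
  interpret D: group_hom N G D
    by unfold_locales (rule D)
  define t where "t h = \<tau> [^] (nat h)" for h :: int
  define t' where "t' h = \<tau> [^] (n - nat h)" for h :: int
  let ?Z = "integer_mod_group n"
  have Z: "h \<in> carrier ?Z \<longleftrightarrow> 0 \<le> h \<and> h < int n" for h
    using n by (auto simp: carrier_integer_mod_group)
  interpret Z: comm_group ?Z
    by (rule abelian_integer_mod_group)
  have pow_mod: "\<tau> [^] (k mod n) = \<tau> [^] k" for k :: nat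
  proof -
    have "\<tau> [^] k = \<tau> [^] (n * (k div n) + k mod n)"
      by (simp only: mult_div_mod_eq)
    also have "\<dots> = (\<tau> [^] n) [^] (k div n) \<otimes> \<tau> [^] (k mod n)"
      using \<tau> by (simp add: nat_pow_mult nat_pow_pow)
    finally show ?thesis
      using \<tau> by (simp add: \<tau>n)
  qed
  have tG: "t h \<in> carrier G" "t' h \<in> carrier G" for h
    using \<tau> by (simp_all add: t_def t'_def)
  have DG: "D x \<in> carrier G" if "x \<in> carrier N" for x
    using that by simp
  have t_mult: "t (h \<otimes>\<^bsub>?Z\<^esub> k) = t h \<otimes> t k" if "h \<in> carrier ?Z" "k \<in> carrier ?Z" for h k
  proof -
    have "nat ((h + k) mod int n) = (nat h + nat k) mod n"
      using that by (simp add: Z nat_mod_distrib nat_add_distrib)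
    then show ?thesis
      using \<tau> by (simp add: t_def pow_mod nat_pow_mult)
  qed
  have tt': "t h \<otimes> t' h = \<one>" "t' h \<otimes> t h = \<one>" if "h \<in> carrier ?Z" for h
  proof -
    have "nat h + (n - nat h) = n" "(n - nat h) + nat h = n"
      using that by (auto simp: Z)
    then show "t h \<otimes> t' h = \<one>" "t' h \<otimes> t h = \<one>"
      by (simp_all only: t_def t'_def nat_pow_mult [OF \<tau>] \<tau>n)
  qed
  define \<theta> where "\<theta> h = (\<lambda>x\<in>carrier N. inv_into (carrier N) D (t h \<otimes> D x \<otimes> t' h))" for h
  have \<theta>: "\<theta> h x \<in> carrier N" "D (\<theta> h x) = t h \<otimes> D x \<otimes> t' h" if h: "h \<in> carrier ?Z" and x: "x \<in> carrier N" for h x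
  proof -
    have "nat h < n"
      using h by (simp add: Z nat_less_iff)
    then have "t h \<otimes> D x \<otimes> t' h \<in> D ` carrier N"
      unfolding t_def t'_def using x by (rule conj)
    then show "\<theta> h x \<in> carrier N" "D (\<theta> h x) = t h \<otimes> D x \<otimes> t' h"
      using x by (simp_all add: \<theta>_def inv_into_into f_inv_into_f)
  qed
  have swap: "t h \<otimes> D x = D (\<theta> h x) \<otimes> t h" if h: "h \<in> carrier ?Z" and x: "x \<in> carrier N" for h x
    using \<theta>(2) [OF h x] tt'(2) [OF h] tG DG [OF x] by (simp add: m_assoc)
  have D_inj: "x = y" if "x \<in> carrier N" "y \<in> carrier N" "D x = D y" for x y
    using inj that by (auto simp: inj_on_def)
  have \<theta>_mult: "\<theta> h (x \<otimes>\<^bsub>N\<^esub> y) = \<theta> h x \<otimes>\<^bsub>N\<^esub> \<theta> h y"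
    if h: "h \<in> carrier ?Z" and x: "x \<in> carrier N" and y: "y \<in> carrier N" for h x y
  proof (rule D_inj)
    have "D (\<theta> h (x \<otimes>\<^bsub>N\<^esub> y)) \<otimes> t h = t h \<otimes> D x \<otimes> D y"
      using swap [OF h, of "x \<otimes>\<^bsub>N\<^esub> y"] x y tG DG by (simp add: m_assoc)
    also have "\<dots> = D (\<theta> h x) \<otimes> (t h \<otimes> D y)"
      using swap [OF h x] \<theta>(1) [OF h x] x y tG DG by (simp add: m_assoc)
    also have "\<dots> = D (\<theta> h x \<otimes>\<^bsub>N\<^esub> \<theta> h y) \<otimes> t h"
      using swap [OF h y] \<theta>(1) [OF h x] \<theta>(1) [OF h y] tG DG by (simp add: m_assoc)
    finally show "D (\<theta> h (x \<otimes>\<^bsub>N\<^esub> y)) = D (\<theta> h x \<otimes>\<^bsub>N\<^esub> \<theta> h y)"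
      using \<theta>(1) h x y tG DG by (meson N.m_closed r_cancel)
  qed (use \<theta>(1) h x y in auto)
  have \<theta>_comp: "\<theta> (h \<otimes>\<^bsub>?Z\<^esub> k) x = \<theta> h (\<theta> k x)"
    if h: "h \<in> carrier ?Z" and k: "k \<in> carrier ?Z" and x: "x \<in> carrier N" for h k x
  proof (rule D_inj)
    have hk: "h \<otimes>\<^bsub>?Z\<^esub> k \<in> carrier ?Z"
      using h k by (rule Z.m_closed)
    have kx: "\<theta> k x \<in> carrier N" and hkx: "\<theta> h (\<theta> k x) \<in> carrier N" "\<theta> (h \<otimes>\<^bsub>?Z\<^esub> k) x \<in> carrier N"
      using \<theta>(1) h k x hk by auto
    have "D (\<theta> (h \<otimes>\<^bsub>?Z\<^esub> k) x) \<otimes> t (h \<otimes>\<^bsub>?Z\<^esub> k) = t h \<otimes> (t k \<otimes> D x)"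
      using swap [OF hk x] x tG DG by (simp only: t_mult [OF h k] m_assoc)
    also have "\<dots> = (t h \<otimes> D (\<theta> k x)) \<otimes> t k"
      using swap [OF k x] tG DG [OF kx] by (simp only: m_assoc)
    also have "\<dots> = D (\<theta> h (\<theta> k x)) \<otimes> t (h \<otimes>\<^bsub>?Z\<^esub> k)"
      using swap [OF h kx] tG DG [OF hkx(1)] by (simp only: t_mult [OF h k] m_assoc)
    finally show "D (\<theta> (h \<otimes>\<^bsub>?Z\<^esub> k) x) = D (\<theta> h (\<theta> k x))"
      using hkx tG DG by (meson r_cancel)
    show "\<theta> (h \<otimes>\<^bsub>?Z\<^esub> k) x \<in> carrier N" "\<theta> h (\<theta> k x) \<in> carrier N"
      by (rule hkx)+
  qed
  have \<theta>_0: "\<theta> \<one>\<^bsub>?Z\<^esub> x = x" if x: "x \<in> carrier N" for x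
  proof (rule D_inj)
    have "t \<one>\<^bsub>?Z\<^esub> = \<one>" "t' \<one>\<^bsub>?Z\<^esub> = \<one>"
      by (simp_all add: t_def t'_def \<tau>n)
    then show "D (\<theta> \<one>\<^bsub>?Z\<^esub> x) = D x"
      using \<theta>(2) [OF Z.one_closed x] DG [OF x] by (simp only: l_one r_one)
    show "\<theta> \<one>\<^bsub>?Z\<^esub> x \<in> carrier N"
      by (rule \<theta>(1) [OF Z.one_closed x])
  qed (rule x)
  have \<theta>_auto: "\<theta> h \<in> auto N" if h: "h \<in> carrier ?Z" for h
  proof -
    let ?h = "inv\<^bsub>?Z\<^esub> h"
    have h': "?h \<in> carrier ?Z"
      using h by (rule Z.inv_closed)
    have "\<theta> ?h (\<theta> h x) = x" "\<theta> h (\<theta> ?h x) = x" if "x \<in> carrier N" for x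
      using \<theta>_comp [OF h h' that] \<theta>_comp [OF h' h that] \<theta>_0 [OF that] Z.l_inv [OF h] Z.r_inv [OF h] by metis+
    then have "bij_betw (\<theta> h) (carrier N) (carrier N)"
      using \<theta>(1) [OF h] \<theta>(1) [OF h'] by (intro bij_betw_byWitness [where f' = "\<theta> ?h"]) auto
    moreover have "\<theta> h \<in> extensional (carrier N)"
      by (simp add: \<theta>_def)
    ultimately show ?thesis
      using \<theta>(1) [OF h] \<theta>_mult [OF h] by (simp add: auto_def Bij_def hom_def)
  qed
  have \<theta>_hom: "\<theta> \<in> hom ?Z (AutoGroup N)"
  proof (rule homI)
    show "\<theta> h \<in> carrier (AutoGroup N)" if "h \<in> carrier ?Z" for h
      using \<theta>_auto [OF that] by (simp add: AutoGroup_def)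
    show "\<theta> (h \<otimes>\<^bsub>?Z\<^esub> k) = \<theta> h \<otimes>\<^bsub>AutoGroup N\<^esub> \<theta> k" if h: "h \<in> carrier ?Z" and k: "k \<in> carrier ?Z" for h k
    proof -
      have "\<theta> h \<in> Bij (carrier N)" "\<theta> k \<in> Bij (carrier N)"
        using \<theta>_auto [OF h] \<theta>_auto [OF k] by (simp_all add: auto_def)
      then have "\<theta> h \<otimes>\<^bsub>AutoGroup N\<^esub> \<theta> k = compose (carrier N) (\<theta> h) (\<theta> k)"
        by (simp add: AutoGroup_def BijGroup_def)
      moreover have "\<theta> (h \<otimes>\<^bsub>?Z\<^esub> k) = compose (carrier N) (\<theta> h) (\<theta> k)"
      proof
        fix x
        show "\<theta> (h \<otimes>\<^bsub>?Z\<^esub> k) x = compose (carrier N) (\<theta> h) (\<theta> k) x"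
        proof (cases "x \<in> carrier N")
          case True
          then show ?thesis
            by (simp only: compose_eq \<theta>_comp [OF h k])
        next
          case False
          then show ?thesis
            by (simp add: \<theta>_def compose_def)
        qed
      qed
      ultimately show ?thesis
        by simp
    qed
  qed
  let ?P = "semidirect_product ?Z N \<theta>"
  define \<Phi> where "\<Phi> = (\<lambda>(h, x). D x \<otimes> t h)"
  have carrier_P: "carrier ?P = carrier ?Z \<times> carrier N"
    by (simp add: semidirect_product_def)
  have "\<Phi> \<in> iso ?P G"
  proof (rule isoI)
    show "\<Phi> \<in> hom ?P G"
    proof (rule homI)
      show "\<Phi> a \<in> carrier G" if "a \<in> carrier ?P" for a
        using that tG DG by (auto simp: carrier_P \<Phi>_def)
      fix a b assume "a \<in> carrier ?P" "b \<in> carrier ?P"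
      then obtain h x k y where ab: "a = (h, x)" "b = (k, y)"
        and h: "h \<in> carrier ?Z" and x: "x \<in> carrier N" and k: "k \<in> carrier ?Z" and y: "y \<in> carrier N"
        by (auto simp: carrier_P)
      have hy: "\<theta> h y \<in> carrier N"
        by (rule \<theta>(1) [OF h y])
      have "\<Phi> (a \<otimes>\<^bsub>?P\<^esub> b) = D (x \<otimes>\<^bsub>N\<^esub> \<theta> h y) \<otimes> t (h \<otimes>\<^bsub>?Z\<^esub> k)"
        by (simp add: ab \<Phi>_def semidirect_product_def)
      also have "\<dots> = D x \<otimes> (D (\<theta> h y) \<otimes> t h) \<otimes> t k"
        using tG DG [OF x] DG [OF hy] by (simp only: D.hom_mult [OF x hy] t_mult [OF h k] m_assoc m_closed)
      also have "\<dots> = (D x \<otimes> t h) \<otimes> (D y \<otimes> t k)"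
        using tG DG [OF x] DG [OF y] by (simp only: swap [OF h y, symmetric] m_assoc m_closed)
      finally show "\<Phi> (a \<otimes>\<^bsub>?P\<^esub> b) = \<Phi> a \<otimes> \<Phi> b"
        by (simp add: ab \<Phi>_def)
    qed
    show "bij_betw \<Phi> (carrier ?P) (carrier G)"
      unfolding bij_betw_def
    proof (intro conjI equalityI subsetI inj_onI)
      fix a b assume *: "a \<in> carrier ?P" "b \<in> carrier ?P" "\<Phi> a = \<Phi> b"
      then obtain h x k y where ab: "a = (h, x)" "b = (k, y)"
        and h: "h \<in> carrier ?Z" and x: "x \<in> carrier N" and k: "k \<in> carrier ?Z" and y: "y \<in> carrier N"
        by (auto simp: carrier_P)
      have eq: "D x \<otimes> t h = D y \<otimes> t k"
        using * by (simp add: ab \<Phi>_def)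
      have "D (inv\<^bsub>N\<^esub> x \<otimes>\<^bsub>N\<^esub> y) = inv (D x) \<otimes> (D y \<otimes> t k) \<otimes> t' k"
        using x y tG DG tt'(1) [OF k] by (simp add: m_assoc)
      also have "\<dots> = t h \<otimes> t' k"
        unfolding eq [symmetric] using x tG DG by (simp add: m_assoc [symmetric])
      also have "\<dots> = \<tau> [^] ((nat h + (n - nat k)) mod n)"
        using \<tau> by (simp add: t_def t'_def nat_pow_mult pow_mod)
      finally have "(nat h + (n - nat k)) mod n = 0"
        using x y n by (intro uniq) (auto intro!: image_eqI [of _ D "inv\<^bsub>N\<^esub> x \<otimes>\<^bsub>N\<^esub> y"])
      moreover have "nat h < n" "nat k < n"
        using h k by (simp_all add: Z nat_less_iff)
      ultimately have "nat h = nat k"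
        by (cases "nat h + (n - nat k) < n") (auto simp: mod_if split: if_splits)
      then have hk: "h = k"
        using h k by (simp add: Z eq_nat_nat_iff)
      with eq have "D x = D y"
        using x y tG DG by simp
      then show "a = b"
        using hk ab D_inj x y by simp
    next
      fix g assume "g \<in> \<Phi> ` carrier ?P"
      then show "g \<in> carrier G"
        using tG DG by (auto simp: carrier_P \<Phi>_def)
    next
      fix g assume "g \<in> carrier G"
      then obtain h x where "h < n" "x \<in> carrier N" "g = D x \<otimes> \<tau> [^] h"
        using decomp by blast
      then show "g \<in> \<Phi> ` carrier ?P"
        by (intro image_eqI [of _ _ "(int h, x)"]) (auto simp: carrier_P Z \<Phi>_def t_def)
    qed
  qed
  then have "?P \<cong> G"
    by (rule is_isoI)
  then have "G \<cong> ?P"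
    by (rule group.iso_sym [OF group_semidirect_product [OF Z.is_group N \<theta>_hom]])
  then show ?thesis
    using \<theta>_hom by (rule bexI)
qed

section \<open>The quantum polynomial algebra in normal form\<close>

lemma free_algebra_simps:
  "(\<otimes>\<^bsub>free_algebra n\<^esub>) = (*)" "(\<oplus>\<^bsub>free_algebra n\<^esub>) = (+)" "\<one>\<^bsub>free_algebra n\<^esub> = 1" "\<zero>\<^bsub>free_algebra n\<^esub> = 0"
  "c \<odot>\<^bsub>free_algebra n\<^esub> f = single 0 c * f"
  by (simp_all add: free_algebra_def)

lemma a_inv_free_algebra:
  assumes f: "f \<in> carrier (free_algebra n)"
  shows "\<ominus>\<^bsub>free_algebra n\<^esub> f = - f"
proof -
  interpret R: ring "free_algebra n :: ('a, word \<Rightarrow>\<^sub>0 'a) module"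
    by (rule ring_free_algebra)
  have "- f \<in> carrier (free_algebra n)"
    using f by (simp add: carrier_free_algebra)
  then show ?thesis
    using f by (intro R.minus_equality) (simp_all add: free_algebra_simps)
qed

lemma ideal_nf_kernel:
  fixes q :: "'a::field"
  shows "ideal {f \<in> carrier (free_algebra n). nf q f = 0} (free_algebra n)"
proof -
  let ?I = "{f \<in> carrier (free_algebra n). nf q f = 0}"
  interpret R: ring "free_algebra n :: ('a, word \<Rightarrow>\<^sub>0 'a) module"
    by (rule ring_free_algebra)
  show ?thesis
  proof (rule idealI)
    show "ring (free_algebra n :: ('a, word \<Rightarrow>\<^sub>0 'a) module)"
      by (rule ring_free_algebra)
    show "subgroup ?I (add_monoid (free_algebra n))"
    proof
      fix f g assume "f \<in> ?I" "g \<in> ?I"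
      then show "f \<otimes>\<^bsub>add_monoid (free_algebra n)\<^esub> g \<in> ?I"
        using R.add.m_closed [of f g] by (simp add: free_algebra_simps nf_add)
    next
      fix f assume f: "f \<in> ?I"
      have "inv\<^bsub>add_monoid (free_algebra n)\<^esub> f = - f"
        using a_inv_free_algebra [of f n] f by (simp add: a_inv_def)
      with f show "inv\<^bsub>add_monoid (free_algebra n)\<^esub> f \<in> ?I"
        by (simp add: nf_minus carrier_free_algebra)
    qed (use R.zero_closed in \<open>auto simp: free_algebra_simps\<close>)
  next
    fix f g :: "word \<Rightarrow>\<^sub>0 'a"
    assume fg: "f \<in> ?I" "g \<in> carrier (free_algebra n)"
    show "g \<otimes>\<^bsub>free_algebra n\<^esub> f \<in> ?I" "f \<otimes>\<^bsub>free_algebra n\<^esub> g \<in> ?I"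
      using fg R.m_closed [of f g] R.m_closed [of g f]
      by (simp_all add: free_algebra_simps carrier_free_algebra nf_mult [of _ n])
  qed
qed

lemma mult_single_Word:
  "single (Word xs) c * single (Word ys) d = single (Word (xs @ ys)) (c * (d :: 'k::field))"
  by (simp add: mult_single plus_word_def)

lemma quantum_relation_eq:
  "gen j * gen i - single 0 q * (gen i * gen j)
    = single (Word [j, i]) 1 - single (Word [i, j]) (q :: 'k::field)"
  by (simp add: gen_def mult_single_Word zero_word_def)

lemma quantum_ideal_subset_kernel:
  "quantum_ideal n q \<subseteq> {f \<in> carrier (free_algebra n). nf q f = 0}"
proof -
  interpret R: ring "free_algebra n :: ('a, word \<Rightarrow>\<^sub>0 'a) module"
    by (rule ring_free_algebra)
  have "nf q r = 0" if "r \<in> quantum_relations n q" for r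
    using that by (auto simp: quantum_relations_def quantum_relation_eq nf_diff nf_single add.commute)
  then show ?thesis
    unfolding quantum_ideal_def using quantum_relations_subset
    by (intro R.genideal_minimal ideal_nf_kernel) blast
qed

lemma quantum_ideal:
  shows "ideal (quantum_ideal n q) (free_algebra n)"
    and "f \<in> quantum_ideal n q \<Longrightarrow> g \<in> quantum_ideal n q \<Longrightarrow> f + g \<in> quantum_ideal n q"
    and "f \<in> quantum_ideal n q \<Longrightarrow> h \<in> carrier (free_algebra n) \<Longrightarrow> h * f \<in> quantum_ideal n q"
    and "f \<in> quantum_ideal n q \<Longrightarrow> h \<in> carrier (free_algebra n) \<Longrightarrow> f * h \<in> quantum_ideal n q"
    and "0 \<in> quantum_ideal n q"
    and "quantum_relations n q \<subseteq> quantum_ideal n q"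
proof -
  interpret R: ring "free_algebra n :: ('a, word \<Rightarrow>\<^sub>0 'a) module"
    by (rule ring_free_algebra)
  show I: "ideal (quantum_ideal n q) (free_algebra n)"
    unfolding quantum_ideal_def by (rule R.genideal_ideal [OF quantum_relations_subset])
  interpret I: ideal "quantum_ideal n q" "free_algebra n"
    by (rule I)
  show "f \<in> quantum_ideal n q \<Longrightarrow> g \<in> quantum_ideal n q \<Longrightarrow> f + g \<in> quantum_ideal n q"
    using I.a_closed [of f g] by (simp add: free_algebra_simps)
  show "f \<in> quantum_ideal n q \<Longrightarrow> h \<in> carrier (free_algebra n) \<Longrightarrow> h * f \<in> quantum_ideal n q"
    using I.I_l_closed [of f h] by (simp add: free_algebra_simps)
  show "f \<in> quantum_ideal n q \<Longrightarrow> h \<in> carrier (free_algebra n) \<Longrightarrow> f * h \<in> quantum_ideal n q"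
    using I.I_r_closed [of f h] by (simp add: free_algebra_simps)
  show "0 \<in> quantum_ideal n q"
    using I.zero_closed by (simp add: free_algebra_simps)
  show "quantum_relations n q \<subseteq> quantum_ideal n q"
    unfolding quantum_ideal_def by (rule R.genideal_self [OF quantum_relations_subset])
qed

lemma single_Word_in_carrier:
  "set xs \<subseteq> {1..n} \<Longrightarrow> single (Word xs) c \<in> carrier (free_algebra n)"
  by (auto simp: carrier_free_algebra words_def)

text \<open>Inserting a letter into a sorted word means commuting it past the smaller letters, one quantum
  relation each.\<close>

lemma insort_mod_quantum_ideal:
  assumes x: "x \<in> {1..n}" and "set ys \<subseteq> {1..n}" "sorted ys"
  shows "single (Word (x # ys)) c -
    single (Word (insort x ys)) (q ^ length (filter (\<lambda>y. y < x) ys) * c) \<in> quantum_ideal n q"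
  using assms(2,3)
proof (induction ys arbitrary: c)
  case Nil
  then show ?case
    by (simp add: quantum_ideal)
next
  case (Cons y ys)
  show ?case
  proof (cases "x \<le> y")
    case True
    then have "filter (\<lambda>z. z < x) (y # ys) = []"
      using Cons.prems by (auto simp: filter_empty_conv)
    then show ?thesis
      using True by (simp add: quantum_ideal)
  next
    case False
    let ?k = "length (filter (\<lambda>z. z < x) ys)"
    have xy: "1 \<le> y" "y < x" "x \<le> n"
      using x Cons.prems False by auto
    have rel: "single (Word [x, y]) 1 - single (Word [y, x]) q \<in> quantum_ideal n q"
      unfolding quantum_relation_eq [symmetric]
      by (rule subsetD [OF quantum_ideal(6)]) (use xy in \<open>unfold quantum_relations_def, blast\<close>)
    have "single (Word (x # y # ys)) c - single (Word (y # insort x ys)) (q ^ Suc ?k * c)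
      = (single (Word [x, y]) 1 - single (Word [y, x]) q) * single (Word ys) c
        + single (Word [y]) 1 * (single (Word (x # ys)) (q * c)
          - single (Word (insort x ys)) (q ^ ?k * (q * c)))"
      by (simp add: left_diff_distrib right_diff_distrib mult_single_Word ac_simps)
    moreover have "\<dots> \<in> quantum_ideal n q"
      using x Cons rel by (intro quantum_ideal single_Word_in_carrier Cons.IH) auto
    ultimately show ?thesis
      using False by simp
  qed
qed

lemma sort_mod_quantum_ideal:
  assumes "set xs \<subseteq> {1..n}"
  shows "single (Word xs) c -
    single (Word (sort xs)) (q ^ inversions xs * c) \<in> quantum_ideal n q"
  using assms
proof (induction xs)
  case Nil
  then show ?case
    by (simp add: quantum_ideal)
next
  case (Cons x xs)
  let ?k = "length (filter (\<lambda>y. y < x) xs)"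
  have k: "length (filter (\<lambda>y. y < x) (sort xs)) = ?k"
    by (metis mset_filter mset_sort size_mset)
  have "single (Word (x # xs)) c - single (Word (insort x (sort xs))) (q ^ (?k + inversions xs) * c)
    = single (Word [x]) 1 * (single (Word xs) c - single (Word (sort xs)) (q ^ inversions xs * c))
      + (single (Word (x # sort xs)) (q ^ inversions xs * c)
        - single (Word (insort x (sort xs))) (q ^ length (filter (\<lambda>y. y < x) (sort xs)) * (q ^ inversions xs * c)))"
    by (simp add: right_diff_distrib mult_single_Word k power_add ac_simps)
  also have "\<dots> \<in> quantum_ideal n q"
    using Cons by (intro quantum_ideal(2) quantum_ideal(3) single_Word_in_carrier insort_mod_quantum_ideal) auto
  finally show ?case
    by simp
qed

lemma ex_content: "\<exists>xs. content xs = a"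
proof -
  have *: "content (replicate k x) = single x k" for k x
    by (induction k) (simp_all add: single_add [symmetric])
  have "\<exists>xs. content xs = a"
  proof (rule keys_subset_induct [of a UNIV])
    show "\<exists>xs. content xs = 0"
      by (rule exI [of _ "[]"]) simp
    show "\<exists>xs. content xs = single k c + f" if "\<exists>xs. content xs = f" for k c f
      using that by (metis * content_simps(3))
  qed simp
  then show ?thesis .
qed

lemma content_eq_iff: "content xs = content ys \<longleftrightarrow> sort xs = sort ys"
proof -
  have c: "lookup (content xs) = count (mset xs)" for xs
    by (induction xs) (auto simp: fun_eq_iff lookup_add lookup_single when_def)
  have "content xs = content ys \<longleftrightarrow> mset xs = mset ys"
    by (simp add: poly_mapping_eq_iff c multiset_eq_iff fun_eq_iff)
  also have "\<dots> \<longleftrightarrow> sort xs = sort ys"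
    by (metis mset_sort sorted_list_of_multiset_mset)
  finally show ?thesis .
qed

definition ordered_word :: "exponent \<Rightarrow> nat list"
  where "ordered_word a = sort (SOME xs. content xs = a)"

lemma content_sort [simp]: "content (sort xs) = content xs"
  by (simp add: content_eq_iff sorted_sort_id)

lemma content_ordered_word [simp]: "content (ordered_word a) = a"
  unfolding ordered_word_def content_sort by (rule someI_ex [OF ex_content])

lemma ordered_word_content: "ordered_word (content xs) = sort xs"
  using content_ordered_word [of "content xs"] content_eq_iff [of "ordered_word (content xs)" xs]
  by (simp add: ordered_word_def sorted_sort_id)

lemma inversions_sorted: "sorted xs \<Longrightarrow> inversions xs = 0"
proof (induction xs)
  case (Cons x xs)
  then have "filter (\<lambda>y. y < x) xs = []"
    by (auto simp: filter_empty_conv)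
  with Cons show ?case by simp
qed simp

text \<open>A linear section of the normal form map, with a sorted word for each monomial.\<close>

definition from_nf :: "(('k::field) qpoly) \<Rightarrow> word \<Rightarrow>\<^sub>0 'k"
  where "from_nf p = (\<Sum>a\<in>keys p. single (Word (ordered_word a)) (lookup p a))"

lemma from_nf_add: "from_nf (f + g) = from_nf f + from_nf g"
  unfolding from_nf_def by (rule setsum_keys_plus_distrib) (simp_all add: single_add)

lemma from_nf_zero [simp]: "from_nf 0 = 0"
  by (simp add: from_nf_def)

lemma from_nf_single: "from_nf (single a c) = single (Word (ordered_word a)) c"
  by (cases "c = 0") (simp_all add: from_nf_def)

lemma nf_from_nf: "nf q (from_nf p) = p"
proof -
  have *: "inversions (ordered_word a) = 0" for a
    by (simp add: inversions_sorted ordered_word_def)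
  show ?thesis
    by (rule keys_subset_induct [of p UNIV]) (simp_all add: * from_nf_add nf_add from_nf_single nf_single)
qed

lemma keys_from_nf: "keys (from_nf p) \<subseteq> (\<lambda>a. Word (ordered_word a)) ` keys p"
  unfolding from_nf_def by (rule order.trans [OF keys_sum]) auto

lemma set_ordered_word: "set (ordered_word a) = keys a"
  using keys_content [of "ordered_word a"] by simp

lemma from_nf_in_carrier: "p \<in> qpolys n v \<Longrightarrow> from_nf p \<in> carrier (free_algebra n)"
  using keys_from_nf [of p] by (fastforce simp: carrier_free_algebra qpolys_def mons_def words_def set_ordered_word)

lemma minus_from_nf_in_quantum_ideal:
  assumes "f \<in> carrier (free_algebra n)"
  shows "f - from_nf (nf q f) \<in> quantum_ideal n q"
proof -
  have "keys f \<subseteq> words n"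
    using assms by (simp add: carrier_free_algebra)
  then show ?thesis
  proof (induction f rule: keys_subset_induct)
    case zero
    then show ?case
      by (simp add: quantum_ideal)
  next
    case (add w c f)
    have "single w c - from_nf (nf q (single w c)) \<in> quantum_ideal n q"
      using sort_mod_quantum_ideal [of "letters w" n c q] add.hyps(1)
      by (simp add: words_def nf_single from_nf_single ordered_word_content)
    from quantum_ideal(2) [OF this add.IH] show ?case
      by (simp add: nf_add from_nf_add add_diff_add)
  qed
qed

text \<open>Every element is congruent to its normal form modulo the ideal, so an element with normal form
  \<open>0\<close> lies in it.\<close>

lemma quantum_ideal_eq_kernel: "quantum_ideal n q = {f \<in> carrier (free_algebra n). nf q f = 0}"
  using quantum_ideal_subset_kernel [of n q] minus_from_nf_in_quantum_ideal [of _ n q] by fastforce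

text \<open>The coset of the quantum ideal that corresponds to a normal form.\<close>

definition nf_fibre :: "nat \<Rightarrow> 'k::field \<Rightarrow> 'k qpoly \<Rightarrow> (word \<Rightarrow>\<^sub>0 'k) set"
  where "nf_fibre n q p = {f \<in> carrier (free_algebra n). nf q f = p}"

lemma quantum_coset:
  assumes f: "f \<in> carrier (free_algebra n)"
  shows "quantum_ideal n q +>\<^bsub>free_algebra n\<^esub> f = nf_fibre n q (nf q f)"
proof -
  have cl: "g + f \<in> carrier (free_algebra n)" "g - f \<in> carrier (free_algebra n)" if "g \<in> carrier (free_algebra n)" for g
    using that f keys_add_subset [of g _ f] keys_add_subset [of g _ "- f"]
    by (auto simp: carrier_free_algebra)
  show ?thesis
  proof (intro equalityI subsetI)
    fix g
    assume "g \<in> quantum_ideal n q +>\<^bsub>free_algebra n\<^esub> f"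
    then show "g \<in> nf_fibre n q (nf q f)"
      using cl by (auto simp: a_r_coset_def' quantum_ideal_eq_kernel nf_fibre_def free_algebra_simps nf_add)
  next
    fix g
    assume g: "g \<in> nf_fibre n q (nf q f)"
    then have "g - f \<in> quantum_ideal n q"
      using cl by (simp add: quantum_ideal_eq_kernel nf_fibre_def nf_diff)
    then show "g \<in> quantum_ideal n q +>\<^bsub>free_algebra n\<^esub> f"
      by (auto simp: a_r_coset_def' free_algebra_simps intro!: bexI [of _ "g - f"])
  qed
qed

lemma nf_carrier: "f \<in> carrier (free_algebra n) \<Longrightarrow> nf q f \<in> qpolys n 1"
  by (rule nf_in_qpolys) (simp_all add: carrier_free_algebra)

lemma nf_fibre_eq_coset: "p \<in> qpolys n v \<Longrightarrow> nf_fibre n q p = quantum_ideal n q +>\<^bsub>free_algebra n\<^esub> from_nf p"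
  by (simp add: quantum_coset from_nf_in_carrier nf_from_nf)

lemma nf_fibre_inj: "p \<in> qpolys n v \<Longrightarrow> nf_fibre n q p = nf_fibre n q r \<Longrightarrow> p = r"
  using from_nf_in_carrier [of p n v] nf_from_nf [of q p] by (auto simp: nf_fibre_def)

text \<open>The quotient algebra in terms of normal forms: cosets are added and multiplied as the elements
  of the twisted monoid algebra.\<close>

lemma quantum_algebra_simps:
  shows "carrier (quantum_algebra n q) = nf_fibre n q ` qpolys n 1"
    and "p \<in> qpolys n v \<Longrightarrow> r \<in> qpolys n v \<Longrightarrow>
      nf_fibre n q p \<otimes>\<^bsub>quantum_algebra n q\<^esub> nf_fibre n q r = nf_fibre n q (star n q p r)"
    and "p \<in> qpolys n v \<Longrightarrow> r \<in> qpolys n v \<Longrightarrow>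
      nf_fibre n q p \<oplus>\<^bsub>quantum_algebra n q\<^esub> nf_fibre n q r = nf_fibre n q (p + r)"
    and "p \<in> qpolys n v \<Longrightarrow>
      c \<odot>\<^bsub>quantum_algebra n q\<^esub> nf_fibre n q p = nf_fibre n q (star n q (single 0 c) p)"
    and "\<one>\<^bsub>quantum_algebra n q\<^esub> = nf_fibre n q 1"
    and "\<zero>\<^bsub>quantum_algebra n q\<^esub> = nf_fibre n q 0"
proof -
  interpret R: ring "free_algebra n :: ('a, word \<Rightarrow>\<^sub>0 'a) module"
    by (rule ring_free_algebra)
  interpret I: ideal "quantum_ideal n q" "free_algebra n"
    by (rule quantum_ideal)
  show "carrier (quantum_algebra n q) = nf_fibre n q ` qpolys n 1"
  proof -
    have "carrier (quantum_algebra n q) = (\<lambda>f. quantum_ideal n q +>\<^bsub>free_algebra n\<^esub> f) ` carrier (free_algebra n)"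
      by (auto simp: quantum_algebra_def quotient_algebra_def FactRing_simps A_RCOSETS_def')
    also have "\<dots> = nf_fibre n q ` qpolys n 1"
    proof (intro equalityI subsetI)
      fix K
      assume "K \<in> (\<lambda>f. quantum_ideal n q +>\<^bsub>free_algebra n\<^esub> f) ` carrier (free_algebra n)"
      then show "K \<in> nf_fibre n q ` qpolys n 1"
        using nf_carrier quantum_coset by blast
    next
      fix K
      assume "K \<in> nf_fibre n q ` qpolys n 1"
      then show "K \<in> (\<lambda>f. quantum_ideal n q +>\<^bsub>free_algebra n\<^esub> f) ` carrier (free_algebra n)"
        using nf_fibre_eq_coset from_nf_in_carrier by blast
    qed
    finally show ?thesis .
  qed
  show "nf_fibre n q p \<otimes>\<^bsub>quantum_algebra n q\<^esub> nf_fibre n q r = nf_fibre n q (star n q p r)"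
    if "p \<in> qpolys n v" "r \<in> qpolys n v"
  proof -
    have c: "from_nf p \<in> carrier (free_algebra n)" "from_nf r \<in> carrier (free_algebra n)"
      using that by (simp_all add: from_nf_in_carrier)
    then have "nf_fibre n q p \<otimes>\<^bsub>quantum_algebra n q\<^esub> nf_fibre n q r = quantum_ideal n q +>\<^bsub>free_algebra n\<^esub> (from_nf p * from_nf r)"
      using that I.rcoset_mult_add [of "from_nf p" "from_nf r"]
      by (simp add: quantum_algebra_def quotient_algebra_def FactRing_simps nf_fibre_eq_coset free_algebra_simps)
    also have "\<dots> = nf_fibre n q (star n q p r)"
      using R.m_closed [OF c] c by (simp add: free_algebra_simps quantum_coset nf_mult [of _ n] carrier_free_algebra nf_from_nf)
    finally show ?thesis .
  qed
  show "nf_fibre n q p \<oplus>\<^bsub>quantum_algebra n q\<^esub> nf_fibre n q r = nf_fibre n q (p + r)"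
    if "p \<in> qpolys n v" "r \<in> qpolys n v"
  proof -
    have c: "from_nf p \<in> carrier (free_algebra n)" "from_nf r \<in> carrier (free_algebra n)"
      using that by (simp_all add: from_nf_in_carrier)
    then have "nf_fibre n q p \<oplus>\<^bsub>quantum_algebra n q\<^esub> nf_fibre n q r = quantum_ideal n q +>\<^bsub>free_algebra n\<^esub> (from_nf p + from_nf r)"
      using that I.a_rcos_sum [of "from_nf p" "from_nf r"]
      by (simp add: quantum_algebra_def quotient_algebra_def FactRing_simps nf_fibre_eq_coset free_algebra_simps)
    also have "\<dots> = nf_fibre n q (p + r)"
      by (simp add: from_nf_add [symmetric] nf_fibre_eq_coset [OF qpolys_add [OF that]])
    finally show ?thesis .
  qed
  show "c \<odot>\<^bsub>quantum_algebra n q\<^esub> nf_fibre n q p = nf_fibre n q (star n q (single 0 c) p)"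
    if p: "p \<in> qpolys n v"
  proof -
    have s: "single 0 c \<in> carrier (free_algebra n)"
      by (simp add: carrier_free_algebra words_def)
    have "quantum_ideal n q +>\<^bsub>free_algebra n\<^esub> (single 0 c * f) = nf_fibre n q (star n q (single 0 c) p)"
      if "f \<in> nf_fibre n q p" for f
      using that s R.m_closed [OF s, of f]
      by (auto simp: nf_fibre_def free_algebra_simps quantum_coset nf_mult [of _ n] carrier_free_algebra nf_single)
    moreover have "from_nf p \<in> nf_fibre n q p"
      using p by (simp add: nf_fibre_def nf_from_nf from_nf_in_carrier)
    ultimately show ?thesis
      by (auto simp: quantum_algebra_def quotient_algebra_def free_algebra_simps)
  qed
  show "\<one>\<^bsub>quantum_algebra n q\<^esub> = nf_fibre n q 1"
  proof -
    have "nf q (1 :: word \<Rightarrow>\<^sub>0 'a) = 1"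
      using nf_single [of q 0 1] by simp
    then show ?thesis
      using quantum_coset [of 1 n q] R.one_closed
      by (simp add: quantum_algebra_def quotient_algebra_def FactRing_simps free_algebra_simps)
  qed
  show "\<zero>\<^bsub>quantum_algebra n q\<^esub> = nf_fibre n q 0"
  proof -
    have "\<zero>\<^bsub>quantum_algebra n q\<^esub> = quantum_ideal n q"
      by (simp add: quantum_algebra_def quotient_algebra_def FactRing_def)
    then show ?thesis
      unfolding nf_fibre_def quantum_ideal_eq_kernel .
  qed
qed

lemma abelian_monoid_quantum_algebra: "abelian_monoid (quantum_algebra n q)"
  by (rule abelian_monoidI)
    (auto simp: quantum_algebra_simps(1) quantum_algebra_simps(3) [of _ n 1] quantum_algebra_simps(6)
      qpolys_add ac_simps simp del: One_nat_def)

lemma quantum_component_eq: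
  "quantum_component n q d = nf_fibre n q ` {p \<in> qpolys n 1. \<forall>a\<in>keys p. tdeg n a = d}"
proof (intro equalityI subsetI)
  fix K
  assume "K \<in> quantum_component n q d"
  then obtain f where f: "f \<in> carrier (free_algebra n)" "\<And>w. w \<in> keys f \<Longrightarrow> length (letters w) = d"
    and K: "K = nf_fibre n q (nf q f)"
    by (auto simp: quantum_component_def quantum_coset)
  have "keys (nf q f) \<subseteq> (\<Union>w\<in>keys f. {content (letters w)})"
    unfolding nf_def by (rule order.trans [OF keys_sum]) auto
  moreover have "tdeg n (content (letters w)) = d" if "w \<in> keys f" for w
    using f that by (subst tdeg_content) (auto simp: carrier_free_algebra words_def)
  ultimately show "K \<in> nf_fibre n q ` {p \<in> qpolys n 1. \<forall>a\<in>keys p. tdeg n a = d}"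
    using K nf_carrier [OF f(1)] by blast
next
  fix K
  assume "K \<in> nf_fibre n q ` {p \<in> qpolys n 1. \<forall>a\<in>keys p. tdeg n a = d}"
  then obtain p where p: "p \<in> qpolys n 1" "\<And>a. a \<in> keys p \<Longrightarrow> tdeg n a = d" and K: "K = nf_fibre n q p"
    by auto
  have "length (letters w) = d" if w: "w \<in> keys (from_nf p)" for w
  proof -
    obtain a where a: "a \<in> keys p" "w = Word (ordered_word a)"
      using w keys_from_nf [of p] by blast
    then have "set (ordered_word a) \<subseteq> {1..n}"
      using p(1) by (auto simp: set_ordered_word qpolys_def mons_def)
    then show ?thesis
      using tdeg_content [of "ordered_word a" n] a p(2) by simp
  qed
  then show "K \<in> quantum_component n q d"
    unfolding quantum_component_def K nf_fibre_eq_coset [OF p(1)] using from_nf_in_carrier [OF p(1)] by blast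
qed

lemma finsum_nf_fibre:
  fixes N :: nat
  assumes "\<And>i. i < N \<Longrightarrow> p i \<in> qpolys n 1" "\<And>i. i < N \<Longrightarrow> c i = nf_fibre n q (p i)"
  shows "finsum (quantum_algebra n q) c {..<N} = nf_fibre n q (\<Sum>i<N. p i) \<and> (\<Sum>i<N. p i) \<in> qpolys n 1"
  using assms
proof (induction N)
  interpret abelian_monoid "quantum_algebra n q"
    by (rule abelian_monoid_quantum_algebra)
  case 0
  show ?case
    by (simp add: quantum_algebra_simps(6))
next
  interpret abelian_monoid "quantum_algebra n q"
    by (rule abelian_monoid_quantum_algebra)
  case (Suc N)
  have c: "c i \<in> carrier (quantum_algebra n q)" if "i < Suc N" for i
    using Suc.prems that by (auto simp: quantum_algebra_simps(1) simp del: One_nat_def)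
  have "finsum (quantum_algebra n q) c {..<Suc N} = c N \<oplus>\<^bsub>quantum_algebra n q\<^esub> finsum (quantum_algebra n q) c {..<N}"
    unfolding lessThan_Suc using c by (subst finsum_insert) auto
  then show ?case
    using Suc by (simp add: quantum_algebra_simps(3) [of _ n 1] qpolys_add add.commute del: One_nat_def)
qed

text \<open>An element of the twisted monoid algebra is the sum of its homogeneous parts, so the sums of
  components of degree divisible by \<open>v\<close> are the elements supported on \<open>mons n v\<close>.\<close>

lemma carrier_veronese:
  assumes v: "v > 0"
  shows "carrier (veronese (quantum_algebra n q) (quantum_component n q) v) = nf_fibre n q ` qpolys n v"
proof (intro equalityI subsetI)
  fix K
  assume "K \<in> carrier (veronese (quantum_algebra n q) (quantum_component n q) v)"
  then obtain c N where K: "K = finsum (quantum_algebra n q) c {..<N}"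
    and "\<forall>i<N. c i \<in> quantum_component n q (v * i)"
    by (auto simp: veronese_def)
  then have "\<forall>i. \<exists>p. i < N \<longrightarrow> p \<in> qpolys n 1 \<and> (\<forall>a\<in>keys p. tdeg n a = v * i) \<and> c i = nf_fibre n q p"
    unfolding quantum_component_eq by blast
  then obtain p where p: "\<And>i. i < N \<Longrightarrow> p i \<in> qpolys n 1" "\<And>i a. i < N \<Longrightarrow> a \<in> keys (p i) \<Longrightarrow> tdeg n a = v * i"
    "\<And>i. i < N \<Longrightarrow> c i = nf_fibre n q (p i)"
    by metis
  have "p i \<in> qpolys n v" if "i < N" for i
    using p(1,2) [OF that] by (auto simp: qpolys_def mons_def)
  then have "(\<Sum>i<N. p i) \<in> qpolys n v"
    by (induction N) (auto simp: qpolys_add)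
  then show "K \<in> nf_fibre n q ` qpolys n v"
    using finsum_nf_fibre [of N p n c q] p K by blast
next
  fix K
  assume "K \<in> nf_fibre n q ` qpolys n v"
  then obtain p where p: "p \<in> qpolys n v" and K: "K = nf_fibre n q p"
    by blast
  define r where "r i = restrict_keys {a. tdeg n a = v * i} p" for i
  define N where "N = Suc (Max (insert 0 (tdeg n ` keys p)))"
  have "(\<Sum>i<N. r i) = p"
  proof (rule poly_mapping_eqI)
    fix a
    show "lookup (\<Sum>i<N. r i) a = lookup p a"
    proof (cases "a \<in> keys p")
      case True
      then obtain i where i: "tdeg n a = v * i"
        using p by (auto simp: qpolys_def mons_def dvd_def)
      have "tdeg n a < N"
        using True by (simp add: N_def le_imp_less_Suc)
      have "i \<le> v * i"
        using v by (cases v) auto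
      then have "i < N"
        using \<open>tdeg n a < N\<close> unfolding i by (rule le_less_trans)
      have "lookup (\<Sum>i<N. r i) a = (\<Sum>j<N. if j = i then lookup p a else 0)"
        unfolding lookup_sum by (rule sum.cong) (use v i in \<open>auto simp: r_def lookup_restrict_keys\<close>)
      then show ?thesis
        using \<open>i < N\<close> by simp
    next
      case False
      then show ?thesis
        by (auto simp: lookup_sum r_def lookup_restrict_keys in_keys_iff intro!: sum.neutral)
    qed
  qed
  moreover have "r i \<in> qpolys n 1" for i
    using p by (auto simp: r_def qpolys_def mons_def keys_restrict_keys)
  ultimately have "K = finsum (quantum_algebra n q) (\<lambda>i. nf_fibre n q (r i)) {..<N}"
    using finsum_nf_fibre [of N r n "\<lambda>i. nf_fibre n q (r i)" q] K by simp
  moreover have "nf_fibre n q (r i) \<in> quantum_component n q (v * i)" for i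
    unfolding quantum_component_eq using \<open>r i \<in> qpolys n 1\<close> by (auto simp: r_def keys_restrict_keys)
  ultimately show "K \<in> carrier (veronese (quantum_algebra n q) (quantum_component n q) v)"
    by (auto simp: veronese_def)
qed

lemma algebra_closed_twisted_algebra: "algebra_closed (twisted_algebra n q v)"
  by (auto simp: algebra_closed_def twisted_algebra_def qpolys_add qpolys_star qpolys_single)

lemma nf_fibre_algebra_iso:
  assumes "v > 0"
  shows "nf_fibre n q \<in> algebra_isos (twisted_algebra n q v) (veronese (quantum_algebra n q) (quantum_component n q) v)"
  using assms by (auto simp: algebra_isos_iff twisted_algebra_def carrier_veronese bij_betw_def inj_on_def
      intro: nf_fibre_inj)
    (auto simp: veronese_def quantum_algebra_simps)

lemma algebra_closed_veronese:
  assumes v: "v > 0"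
  shows "algebra_closed (veronese (quantum_algebra n q) (quantum_component n q) v)"
proof -
  let ?V = "veronese (quantum_algebra n q) (quantum_component n q) v"
  have "\<one>\<^bsub>?V\<^esub> = nf_fibre n q 1" "(\<otimes>\<^bsub>?V\<^esub>) = (\<otimes>\<^bsub>quantum_algebra n q\<^esub>)"
    "(\<oplus>\<^bsub>?V\<^esub>) = (\<oplus>\<^bsub>quantum_algebra n q\<^esub>)" "(\<odot>\<^bsub>?V\<^esub>) = (\<odot>\<^bsub>quantum_algebra n q\<^esub>)"
    by (simp_all add: veronese_def quantum_algebra_simps)
  then show ?thesis
    by (auto simp: algebra_closed_def carrier_veronese [OF v] quantum_algebra_simps qpolys_add qpolys_star qpolys_single)
qed

lemma algebra_Aut_veronese:
  assumes "v > 0"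
  shows "algebra_Aut (veronese (quantum_algebra n q) (quantum_component n q) v) \<cong> algebra_Aut (twisted_algebra n q v)"
  using assms by (intro algebra_Aut_cong [OF nf_fibre_algebra_iso algebra_closed_twisted_algebra algebra_closed_veronese])

section \<open>Exponent vectors\<close>

lemma lookup_of_nat_mult: "lookup (of_nat k * a) i = k * lookup (a :: exponent) i"
  by (induction k) (simp_all add: distrib_right lookup_add)

lemma cross_of_nat_mult: "cross n (of_nat k * a) b = k * cross n a b" "cross n a (of_nat k * b) = k * cross n a b"
  by (induction k) (simp_all add: distrib_right cross_add_left cross_add_right)

lemma mons_of_nat_mult: "a \<in> mons n v \<Longrightarrow> of_nat k * a \<in> mons n v"
  by (induction k) (simp_all add: distrib_right mons_add)

definition vec :: "nat \<Rightarrow> (nat \<Rightarrow> nat) \<Rightarrow> exponent"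
  where "vec n f = (\<Sum>i\<in>{1..n}. single i (f i))"

lemma lookup_vec: "lookup (vec n f) i = (if i \<in> {1..n} then f i else 0)"
  by (auto simp: vec_def lookup_sum lookup_single when_def sum.delta')

lemma lookup_vec_in [simp]: "i \<in> {1..n} \<Longrightarrow> lookup (vec n f) i = f i"
  by (simp add: lookup_vec)

lemma tdeg_vec: "tdeg n (vec n f) = sum f {1..n}"
  by (simp add: tdeg_def)

lemma vec_in_mons: "v dvd sum f {1..n} \<Longrightarrow> vec n f \<in> mons n v"
  by (auto simp: mons_def tdeg_vec in_keys_iff lookup_vec split: if_splits)

lemma mons_dvd: "a \<in> mons n v \<Longrightarrow> v dvd tdeg n a"
  by (simp add: mons_def)

lemma mons_lookup_outside: "a \<in> mons n v \<Longrightarrow> i \<notin> {1..n} \<Longrightarrow> lookup a i = 0"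
  unfolding mons_def by (metis (no_types, lifting) in_keys_iff mem_Collect_eq subsetD)

lemma mons_eqI:
  assumes "a \<in> mons n v" "b \<in> mons n v'" "\<And>i. i \<in> {1..n} \<Longrightarrow> lookup a i = lookup b i"
  shows "a = b"
proof (rule poly_mapping_eqI)
  fix i
  show "lookup a i = lookup b i"
    using assms mons_lookup_outside [of a n v i] mons_lookup_outside [of b n v' i] by (cases "i \<in> {1..n}") simp_all
qed

lemma mons_diff:
  assumes a: "a \<in> mons n v" and b: "b \<in> mons n v"
    and le: "\<And>i. i \<in> {1..n} \<Longrightarrow> lookup b i \<le> lookup a i"
  obtains c where "c \<in> mons n v" "a = b + c"
proof
  let ?c = "vec n (\<lambda>i. lookup a i - lookup b i)"
  have "tdeg n ?c = tdeg n a - tdeg n b"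
    unfolding tdeg_vec unfolding tdeg_def using le by (intro sum_subtractf_nat) simp
  then show c: "?c \<in> mons n v"
    using mons_dvd [OF a] mons_dvd [OF b] by (intro vec_in_mons) (simp add: tdeg_vec)
  show "a = b + ?c"
    by (rule mons_eqI [OF a mons_add [OF b c]]) (simp add: lookup_add le del: atLeastAtMost_iff)
qed

section \<open>Leading exponents and valuations\<close>

lemma lookup_star_single_right: "lookup (star n q f (single b d)) (a + b) = q ^ cross n a b * lookup f a * d"
proof (rule keys_subset_induct [of f UNIV])
  show "lookup (star n q (single a' c + f) (single b d)) (a + b)
      = q ^ cross n a b * lookup (single a' c + f) a * d"
    if "lookup (star n q f (single b d)) (a + b) = q ^ cross n a b * lookup f a * d"
    for a' c f
    using that by (cases "a' = a") (auto simp: star_add_left lookup_add star_single lookup_single when_def algebra_simps)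
qed simp_all

lemma lookup_star_single_left: "lookup (star n q (single b d) f) (b + a) = q ^ cross n b a * lookup f a * d"
proof (rule keys_subset_induct [of f UNIV])
  show "lookup (star n q (single b d) (single a' c + f)) (b + a)
      = q ^ cross n b a * lookup (single a' c + f) a * d"
    if "lookup (star n q (single b d) f) (b + a) = q ^ cross n b a * lookup f a * d"
    for a' c f
    using that by (cases "a' = a") (auto simp: star_add_right lookup_add star_single lookup_single when_def algebra_simps)
qed simp_all

text \<open>A coefficient of a product is a single term if its exponent is a sum of exponents of the factors
  in one way only. Leading terms for a monomial order have this property.\<close>

lemma lookup_star_unique:
  assumes a: "a \<in> keys f" and b: "b \<in> keys g"
    and uniq: "\<And>a' b'. a' \<in> keys f \<Longrightarrow> b' \<in> keys g \<Longrightarrow> a' + b' = a + b \<Longrightarrow> a' = a \<and> b' = b"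
  shows "lookup (star n q f g) (a + b) = q ^ cross n a b * lookup f a * lookup g b"
proof -
  let ?h = "\<lambda>(a', b'). lookup (single (a' + b') (q ^ cross n a' b' * lookup f a' * lookup g b')) (a + b)"
  have "lookup (star n q f g) (a + b) = sum ?h (keys f \<times> keys g)"
    by (simp add: star_def lookup_sum sum.cartesian_product case_prod_unfold)
  also have "\<dots> = sum ?h {(a, b)}"
  proof (rule sum.mono_neutral_right)
    show "\<forall>x\<in>keys f \<times> keys g - {(a, b)}. ?h x = 0"
    proof
      fix x
      assume "x \<in> keys f \<times> keys g - {(a, b)}"
      then obtain a' b' where x: "x = (a', b')"
        and *: "a' \<in> keys f" "b' \<in> keys g" "\<not> (a' = a \<and> b' = b)"
        by auto
      with uniq [OF *(1,2)] have "a' + b' \<noteq> a + b"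
        by blast
      then show "?h x = 0"
        by (simp add: x lookup_single_not_eq)
    qed
  qed (use a b in auto)
  finally show ?thesis
    by simp
qed

text \<open>The order of vanishing along \<open>x_i\<close>. On \<open>0\<close> the value is arbitrary.\<close>

definition val :: "nat \<Rightarrow> (('k::zero) qpoly) \<Rightarrow> nat"
  where "val i f = Min ((\<lambda>a. lookup a i) ` keys f)"

lemma val_le: "a \<in> keys f \<Longrightarrow> val i f \<le> lookup a i"
  by (simp add: val_def)

lemma val_attained:
  assumes "f \<noteq> 0"
  obtains a where "a \<in> keys f" "lookup a i = val i f"
proof -
  have "keys f \<noteq> {}"
    using assms by (metis all_not_in_conv in_keys_iff lookup_zero poly_mapping_eqI)
  then have "val i f \<in> (\<lambda>a. lookup a i) ` keys f"
    unfolding val_def by (intro Min_in) auto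
  then show thesis
    using that by auto
qed

text \<open>Among the exponents with least \<open>i\<close>th entry take the lexicographically least one in each factor.
  Their sum has a unique decomposition, so the twisted monoid algebra is a domain and the order of
  vanishing is additive.\<close>

lemma val_star:
  fixes q :: "'k::field"
  assumes q: "q \<noteq> 0" and f: "f \<noteq> 0" and g: "g \<noteq> 0"
  shows "star n q f g \<noteq> 0" and "val i (star n q f g) = val i f + val i g"
proof -
  define F where "F = {a \<in> keys f. lookup a i = val i f}"
  define G where "G = {a \<in> keys g. lookup a i = val i g}"
  obtain a0 b0 where "a0 \<in> F" "b0 \<in> G"
    unfolding F_def G_def using val_attained [OF f, of i] val_attained [OF g, of i] by (metis (mono_tags, lifting) mem_Collect_eq)
  moreover have "finite F" "finite G"
    by (simp_all add: F_def G_def)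
  ultimately have "finite F" "F \<noteq> {}" "finite G" "G \<noteq> {}"
    by auto
  then have a: "Min F \<in> F" and b: "Min G \<in> G" and minF: "\<And>x. x \<in> F \<Longrightarrow> Min F \<le> x" and minG: "\<And>x. x \<in> G \<Longrightarrow> Min G \<le> x"
    by auto
  have "lookup (star n q f g) (Min F + Min G)
      = q ^ cross n (Min F) (Min G) * lookup f (Min F) * lookup g (Min G)"
  proof (rule lookup_star_unique)
    fix a' b'
    assume *: "a' \<in> keys f" "b' \<in> keys g" and eq: "a' + b' = Min F + Min G"
    have "lookup a' i + lookup b' i = val i f + val i g"
      using arg_cong [OF eq, of "\<lambda>x. lookup x i"] a b by (simp add: lookup_add F_def G_def)
    then have "a' \<in> F" "b' \<in> G"
      using val_le [OF *(1), of i] val_le [OF *(2), of i] * by (auto simp: F_def G_def)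
    then have le: "Min F \<le> a'" "Min G \<le> b'"
      by (auto intro: minF minG)
    show "a' = Min F \<and> b' = Min G"
    proof (rule ccontr)
      assume "\<not> (a' = Min F \<and> b' = Min G)"
      with le have "Min F + Min G < a' + b'"
        by (metis add_le_less_mono add_less_le_mono le_neq_trans)
      with eq show False
        by simp
    qed
  qed (use a b in \<open>auto simp: F_def G_def\<close>)
  then have k: "Min F + Min G \<in> keys (star n q f g)"
    using q a b by (auto simp: in_keys_iff F_def G_def)
  then show nz: "star n q f g \<noteq> 0"
    by auto
  show "val i (star n q f g) = val i f + val i g"
  proof (rule antisym)
    show "val i (star n q f g) \<le> val i f + val i g"
      using val_le [OF k, of i] a b by (simp add: lookup_add F_def G_def)
    obtain c where c: "c \<in> keys (star n q f g)" "lookup c i = val i (star n q f g)"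
      using val_attained [OF nz] .
    then obtain a' b' where "a' \<in> keys f" "b' \<in> keys g" "c = a' + b'"
      using keys_star [of n q f g] by blast
    then show "val i f + val i g \<le> val i (star n q f g)"
      using c(2) by (simp add: lookup_add add_mono val_le flip: c(2))
  qed
qed

lemma star_cancel_left:
  fixes q :: "'k::field"
  assumes "q \<noteq> 0" "f \<noteq> 0" "star n q f g = star n q f h"
  shows "g = h"
proof (rule ccontr)
  assume "g \<noteq> h"
  then have "star n q f (g - h) \<noteq> 0"
    using assms(1,2) by (intro val_star(1)) simp_all
  then show False
    using assms(3) by (simp add: star_diff_right)
qed

lemma single_eq_0_iff: "single c d = 0 \<longleftrightarrow> d = 0"
  by (metis lookup_single_eq lookup_zero single_zero)

text \<open>The lexicographically least and greatest exponents of a product are the sums of those of the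
  factors. If the product is a monomial, they coincide, so they coincide in each factor.\<close>

lemma star_eq_single_imp_single:
  fixes q :: "'k::field"
  assumes q: "q \<noteq> 0" and eq: "star n q f g = single c d" and d: "d \<noteq> 0"
  obtains a x where "a \<in> keys f" "x \<noteq> 0" "f = single a x"
proof -
  have "single c d \<noteq> 0"
    using d by (simp add: single_eq_0_iff)
  then have nz: "f \<noteq> 0" "g \<noteq> 0"
    unfolding eq [symmetric] by auto
  let ?F = "keys f" and ?G = "keys g"
  have ne: "finite ?F" "?F \<noteq> {}" "finite ?G" "?G \<noteq> {}"
    using nz by simp_all
  have extremal: "s + t = c"
    if st: "s \<in> ?F" "t \<in> ?G"
      and uniq: "\<And>a' b'. a' \<in> ?F \<Longrightarrow> b' \<in> ?G \<Longrightarrow> \<not> (a' = s \<and> b' = t) \<Longrightarrow> a' + b' \<noteq> s + t" for s t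
  proof -
    have "lookup (star n q f g) (s + t) = q ^ cross n s t * lookup f s * lookup g t"
      using uniq by (intro lookup_star_unique st) blast
    then show ?thesis
      using q d st by (auto simp: eq in_keys_iff lookup_single when_def split: if_splits)
  qed
  have 1: "Min ?F + Min ?G = c"
  proof (rule extremal)
    fix a' b'
    assume *: "a' \<in> ?F" "b' \<in> ?G" "\<not> (a' = Min ?F \<and> b' = Min ?G)"
    then have "Min ?F \<le> a'" "Min ?G \<le> b'"
      by auto
    with * have "Min ?F + Min ?G < a' + b'"
      by (metis add_le_less_mono add_less_le_mono le_neq_trans)
    then show "a' + b' \<noteq> Min ?F + Min ?G"
      by simp
  qed (use ne in auto)
  have 2: "Max ?F + Max ?G = c"
  proof (rule extremal)
    fix a' b'
    assume *: "a' \<in> ?F" "b' \<in> ?G" "\<not> (a' = Max ?F \<and> b' = Max ?G)"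
    then have "a' \<le> Max ?F" "b' \<le> Max ?G"
      by auto
    with * have "a' + b' < Max ?F + Max ?G"
      by (metis add_le_less_mono add_less_le_mono le_neq_trans)
    then show "a' + b' \<noteq> Max ?F + Max ?G"
      by simp
  qed (use ne in auto)
  have le: "Min ?F \<le> Max ?F" "Min ?G \<le> Max ?G"
    using ne by auto
  have "Min ?F = Max ?F"
  proof (rule ccontr)
    assume "Min ?F \<noteq> Max ?F"
    with le have "Min ?F + Min ?G < Max ?F + Max ?G"
      by (intro add_less_le_mono) auto
    then show False
      using 1 2 by simp
  qed
  then have F: "a = Min ?F" if "a \<in> ?F" for a
    using that ne by (metis Max_ge Min_le antisym)
  have "f = single (Min ?F) (lookup f (Min ?F))"
    by (rule poly_mapping_eqI) (metis F in_keys_iff lookup_single_eq lookup_single_not_eq)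
  moreover have "Min ?F \<in> ?F"
    using ne by simp
  ultimately show thesis
    using that by (metis in_keys_iff)
qed

section \<open>Increasing self-maps and rotations\<close>

lemma strict_mono_interval_self_map:
  fixes g :: "nat \<Rightarrow> nat"
  assumes range: "\<And>i. i \<in> {1..n} \<Longrightarrow> g i \<in> {1..n}"
    and mono: "\<And>i j. i \<in> {1..n} \<Longrightarrow> j \<in> {1..n} \<Longrightarrow> i < j \<Longrightarrow> g i < g j"
    and i: "i \<in> {1..n}"
  shows "g i = i"
proof (rule antisym)
  have "1 \<le> i" "i \<le> n"
    using i by auto
  then show "i \<le> g i"
  proof (induction i rule: dec_induct)
    case base
    then show ?case
      using range [of 1] by auto
  next
    case (step k)
    then have "g k < g (Suc k)"
      by (intro mono) auto
    then show ?case
      using step by auto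
  qed
  show "g i \<le> i"
    using \<open>i \<le> n\<close>
  proof (induction i rule: inc_induct)
    case base
    then show ?case
      using range [of n] i by auto
  next
    case (step k)
    then have "g k < g (Suc k)"
      using \<open>1 \<le> i\<close> by (intro mono) auto
    then show ?case
      using step by auto
  qed
qed

text \<open>Rotation of \<open>{1..n}\<close> by \<open>r\<close> places, for \<open>r \<le> n\<close>.\<close>

definition rotn :: "nat \<Rightarrow> nat \<Rightarrow> nat \<Rightarrow> nat"
  where "rotn n r i = (if i + r \<le> n then i + r else i + r - n)"

text \<open>The hypotheses say that an inversion of a pair is the sum of the inversions on either side of an
  intermediate index. Comparing all indices with the first one, the values from \<open>\<sigma> 1\<close> upwards are
  taken first and in increasing order, then the smaller values, also in increasing order. Rotating
  the values such that \<open>\<sigma> 1\<close> becomes \<open>1\<close> gives an increasing self-map of \<open>{1..n}\<close>, which is the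
  identity.\<close>

lemma permutation_is_rotation:
  fixes \<sigma> :: "nat \<Rightarrow> nat"
  assumes \<sigma>: "bij_betw \<sigma> {1..n} {1..n}" and n: "1 \<le> n"
    and no_double: "\<And>i k j. 1 \<le> i \<Longrightarrow> i < k \<Longrightarrow> k < j \<Longrightarrow> j \<le> n \<Longrightarrow> \<not> (\<sigma> j < \<sigma> k \<and> \<sigma> k < \<sigma> i)"
    and left: "\<And>i k j. 1 \<le> i \<Longrightarrow> i < k \<Longrightarrow> k < j \<Longrightarrow> j \<le> n \<Longrightarrow> \<sigma> k < \<sigma> i \<Longrightarrow> \<sigma> j < \<sigma> i"
    and right: "\<And>i k j. 1 \<le> i \<Longrightarrow> i < k \<Longrightarrow> k < j \<Longrightarrow> j \<le> n \<Longrightarrow> \<sigma> j < \<sigma> k \<Longrightarrow> \<sigma> j < \<sigma> i"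
    and i: "i \<in> {1..n}"
  shows "\<sigma> i = rotn n (\<sigma> 1 - 1) i"
proof -
  have \<sigma>_in: "1 \<le> \<sigma> k" "\<sigma> k \<le> n" if "1 \<le> k" "k \<le> n" for k
    using bij_betw_apply [OF \<sigma>, of k] that by auto
  have \<sigma>_ne: "\<sigma> k \<noteq> \<sigma> j" if "1 \<le> k" "k \<le> n" "1 \<le> j" "j \<le> n" "k \<noteq> j" for k j
    using inj_onD [OF bij_betw_imp_inj_on [OF \<sigma>], of k j] that by auto
  have \<sigma>1: "1 \<le> \<sigma> 1" "\<sigma> 1 \<le> n"
    using \<sigma>_in [of 1] n by simp_all
  \<comment> \<open>the values rotated such that \<open>\<sigma> 1\<close> becomes \<open>1\<close>\<close>
  define g where "g k = (if \<sigma> 1 \<le> \<sigma> k then \<sigma> k - (\<sigma> 1 - 1) else \<sigma> k + (n - (\<sigma> 1 - 1)))" for k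
  have "g i = i"
  proof (rule strict_mono_interval_self_map [of n g i, OF _ _ i])
    fix k assume "k \<in> {1..n}"
    then show "g k \<in> {1..n}"
      using \<sigma>_in [of k] \<sigma>1 by (auto simp: g_def)
  next
    fix k j assume kj: "k \<in> {1..n}" "j \<in> {1..n}" "k < j"
    have bounds: "1 \<le> \<sigma> k" "\<sigma> k \<le> n" "1 \<le> \<sigma> j" "\<sigma> j \<le> n"
      using \<sigma>_in [of k] \<sigma>_in [of j] kj by simp_all
    have ne: "\<sigma> k \<noteq> \<sigma> j"
      using \<sigma>_ne [of k j] kj by simp
    show "g k < g j"
    proof (cases "k = 1")
      case True
      then show ?thesis
        using bounds ne \<sigma>1 by (auto simp: g_def)
    next
      case False
      then have k: "1 < k" "k < j" "j \<le> n"
        using kj by auto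
      show ?thesis
      proof (cases "\<sigma> k < \<sigma> 1")
        case True
        then have "\<sigma> j < \<sigma> 1" "\<not> \<sigma> j < \<sigma> k"
          using left [of 1 k j] no_double [of 1 k j] k by auto
        then show ?thesis
          using True bounds ne by (auto simp: g_def)
      next
        case A: False
        show ?thesis
        proof (cases "\<sigma> j < \<sigma> 1")
          case True
          then show ?thesis
            using A bounds \<sigma>1 by (auto simp: g_def)
        next
          case False
          then have "\<not> \<sigma> j < \<sigma> k"
            using right [of 1 k j] k by auto
          then show ?thesis
            using A False ne \<sigma>1 by (auto simp: g_def)
        qed
      qed
    qed
  qed
  moreover have "1 \<le> \<sigma> i" "\<sigma> i \<le> n"
    using \<sigma>_in [of i] i by simp_all
  ultimately show ?thesis
    using \<sigma>1 i by (auto simp: g_def rotn_def split: if_splits)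
qed

section \<open>The lattice of central exponents\<close>

lemma dvd_pairs_sum:
  fixes f :: "nat \<Rightarrow> nat"
  assumes "\<And>i. l \<le> i \<Longrightarrow> Suc i < l + 2 * k \<Longrightarrow> d dvd f i + f (Suc i)"
  shows "d dvd (\<Sum>j\<in>{l..<l + 2 * k}. f j)"
  using assms
proof (induction k)
  case (Suc k)
  have "d dvd f (l + 2 * k) + f (Suc (l + 2 * k))"
    by (rule Suc.prems) auto
  then show ?case
    using Suc by (simp add: add.assoc)
qed simp

lemma dvd_mult_div_gcd:
  fixes d k x :: nat
  assumes "d dvd k * x" "d > 0"
  shows "d div gcd d k dvd x"
proof -
  let ?g = "gcd d k"
  have "?g * (d div ?g) dvd ?g * (k div ?g * x)"
    using assms(1) by (metis dvd_mult_div_cancel gcd_dvd1 gcd_dvd2 mult.assoc)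
  moreover have "?g > 0"
    using assms(2) by simp
  ultimately have "d div ?g dvd k div ?g * x"
    using nat_mult_dvd_cancel1 by blast
  moreover have "coprime (d div ?g) (k div ?g)"
    using assms(2) by (intro div_gcd_coprime) auto
  ultimately show ?thesis
    by (simp add: coprime_dvd_mult_right_iff)
qed

locale quantum_veronese =
  fixes n v m :: nat and q :: "'k::field"
  assumes n: "2 \<le> n" and v: "0 < v" and q: "q \<noteq> 0" and ord: "\<And>k. q ^ k = 1 \<longleftrightarrow> m dvd k" and m: "2 < m"
    and parity: "(even n \<and> \<not> m dvd v) \<or> (odd n \<and> gcd m v \<noteq> 1)"
begin

abbreviation M :: "exponent set"
  where "M \<equiv> mons n v"

abbreviation S :: "'k qpoly set"
  where "S \<equiv> qpolys n v"

abbreviation times (infixl "\<star>" 70)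
  where "f \<star> g \<equiv> star n q f g"

text \<open>The commutation factor of monomials: \<open>x^a x^b = com a b x^b x^a\<close>. It is an alternating
  bicharacter.\<close>

definition com :: "exponent \<Rightarrow> exponent \<Rightarrow> 'k"
  where "com a b = q ^ cross n a b / q ^ cross n b a"

lemma com_add: "com (a + a') b = com a b * com a' b" "com a (b + b') = com a b * com a b'"
  by (simp_all add: com_def cross_add_left cross_add_right power_add)

lemma com_nz [simp]: "com a b \<noteq> 0"
  using q by (simp add: com_def)

lemma com_swap: "com a b = inverse (com b a)"
  by (simp add: com_def)

lemma com_self [simp]: "com a a = 1"
  using q by (simp add: com_def)

lemma com_zero [simp]: "com 0 b = 1" "com a 0 = 1"
  by (simp_all add: com_def)

lemma com_eq_1_iff: "com a b = 1 \<longleftrightarrow> q ^ cross n a b = q ^ cross n b a"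
  using q by (simp add: com_def)

lemma com_of_nat_mult: "com (of_nat k * a) b = com a b ^ k" "com a (of_nat k * b) = com a b ^ k"
  by (simp_all add: com_def cross_of_nat_mult power_divide mult.commute [of k] flip: power_mult)

lemma q_m: "q ^ m = 1"
  using ord by simp

lemma com_m: "com a b ^ m = 1"
proof -
  have "(q ^ k) ^ m = 1" for k
    by (metis mult.commute power_mult power_one q_m)
  then show ?thesis
    by (simp add: com_def power_divide)
qed

text \<open>The exponents of the central monomials.\<close>

definition Lam :: "exponent set"
  where "Lam = {a \<in> M. \<forall>b\<in>M. com a b = 1}"

lemma Lam_M: "a \<in> Lam \<Longrightarrow> a \<in> M"
  by (simp add: Lam_def)

lemma Lam_com: "a \<in> Lam \<Longrightarrow> b \<in> M \<Longrightarrow> com a b = 1" "a \<in> Lam \<Longrightarrow> b \<in> M \<Longrightarrow> com b a = 1"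
  by (simp_all add: Lam_def com_swap [of b a])

lemma Lam_zero [simp]: "0 \<in> Lam"
  by (simp add: Lam_def)

lemma Lam_add: "a \<in> Lam \<Longrightarrow> b \<in> Lam \<Longrightarrow> a + b \<in> Lam"
  by (simp add: Lam_def mons_add com_add)

lemma Lam_add_iff: "a \<in> Lam \<Longrightarrow> b \<in> M \<Longrightarrow> a + b \<in> Lam \<longleftrightarrow> b \<in> Lam"
  by (auto simp: Lam_def mons_add com_add)

lemma Lam_of_nat_mult: "a \<in> Lam \<Longrightarrow> of_nat k * a \<in> Lam"
  by (simp add: Lam_def com_of_nat_mult mons_of_nat_mult)

lemma Lam_m: "a \<in> M \<Longrightarrow> of_nat m * a \<in> Lam"
  by (simp add: Lam_def com_of_nat_mult mons_of_nat_mult com_m)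

text \<open>The exponents of the generators \<open>x_i^v\<close> of the extremal rays of \<open>M\<close>.\<close>

definition e :: "nat \<Rightarrow> exponent"
  where "e i = single i v"

lemma e_M: "i \<in> {1..n} \<Longrightarrow> e i \<in> M"
  by (simp add: e_def mons_def tdeg_single)

lemma lookup_e: "lookup (e i) j = (if j = i then v else 0)"
  by (simp add: e_def lookup_single when_def)

text \<open>The letter \<open>x_i\<close> picks up a factor \<open>q\<close> from every larger letter and a factor \<open>1 / q\<close> from every
  smaller one.\<close>

lemma com_single:
  assumes i: "i \<in> {1..n}"
  shows "com a (single i k) = (q ^ (\<Sum>j\<in>{i<..n}. lookup a j) / q ^ (\<Sum>j\<in>{1..<i}. lookup a j)) ^ k"
proof -
  have "cross n a (single i k) = (\<Sum>j\<in>{1..n}. if i < j then lookup a j * k else 0)"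
    unfolding cross_def
  proof (rule sum.cong [OF refl])
    fix j
    show "(\<Sum>l\<in>{1..<j}. lookup a j * lookup (single i k) l) = (if i < j then lookup a j * k else 0)"
      using i by (auto simp: lookup_single when_def if_distrib[of "(*) _"] sum.delta cong: if_cong)
  qed
  also have "\<dots> = (\<Sum>j\<in>{i<..n}. lookup a j * k)"
    using i by (intro sum.mono_neutral_cong_right) auto
  finally have 1: "cross n a (single i k) = k * (\<Sum>j\<in>{i<..n}. lookup a j)"
    by (simp add: sum_distrib_left mult.commute)
  have "cross n (single i k) a = (\<Sum>j\<in>{1..n}. if j = i then \<Sum>l\<in>{1..<i}. k * lookup a l else 0)"
    unfolding cross_def by (rule sum.cong) (auto simp: lookup_single when_def)
  also have "\<dots> = k * (\<Sum>j\<in>{1..<i}. lookup a j)"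
    using i by (simp add: sum_distrib_left)
  finally show ?thesis
    by (simp add: com_def 1 power_divide mult.commute [of k] flip: power_mult)
qed

text \<open>A central monomial commutes in the same way with \<open>x_i^v\<close> and with \<open>x_i^(v - 1) x_(i + 1)\<close>, hence
  with \<open>x_i\<close> and \<open>x_(i + 1)\<close>. The two factors differ by \<open>q\<close> to the power in question.\<close>

lemma Lam_neighbours:
  assumes a: "a \<in> Lam" and i: "1 \<le> i" "i < n"
  shows "m dvd lookup a i + lookup a (Suc i)"
proof -
  let ?L = "\<Sum>j\<in>{1..<i}. lookup a j" and ?R = "\<Sum>j\<in>{Suc i<..n}. lookup a j"
  let ?b = "single i (v - 1) + single (Suc i) 1"
  have "?b \<in> M"
    using i v Poly_Mapping.keys_add [of "single i (v - 1)" "single (Suc i) 1"]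
    by (auto simp: mons_def tdeg_add tdeg_single split: if_splits)
  then have "com a ?b = 1" "com a (e i) = 1"
    using Lam_com(1) [OF a] e_M i by auto
  moreover have "e i = single i (v - 1) + single i 1"
    using v by (simp add: e_def flip: single_add)
  ultimately have "com a (single i 1) = com a (single (Suc i) 1)"
    by (metis com_add(2) com_nz mult_cancel_left)

  moreover have "{i<..n} = insert (Suc i) {Suc i<..n}" "{1..<Suc i} = insert i {1..<i}"
    using i by auto
  then have "com a (single i 1) = q ^ (lookup a (Suc i) + ?R) / q ^ ?L"
    "com a (single (Suc i) 1) = q ^ ?R / q ^ (lookup a i + ?L)"
    using i by (simp_all add: com_single)
  ultimately have eq: "q ^ (lookup a (Suc i) + ?R) / q ^ ?L = q ^ ?R / q ^ (lookup a i + ?L)"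
    by metis
  have "q ^ (lookup a (Suc i) + ?R) * q ^ (lookup a i + ?L) = q ^ ?R * q ^ ?L"
    by (rule frac_eq_eq [THEN iffD1, OF _ _ eq]) (use q in simp_all)
  then have "q ^ (lookup a i + lookup a (Suc i)) * (q ^ ?R * q ^ ?L) = 1 * (q ^ ?R * q ^ ?L)"
    by (simp add: power_add ac_simps)
  then have "q ^ (lookup a i + lookup a (Suc i)) = 1"
    using q by simp
  then show ?thesis
    by (simp add: ord)
qed

text \<open>Commutation with \<open>x_1^v\<close>.\<close>

lemma Lam_first:
  assumes a: "a \<in> Lam"
  shows "m dvd v * (\<Sum>j\<in>{2..n}. lookup a j)"
proof -
  have "com a (e 1) = 1"
    using n a by (intro Lam_com e_M) auto
  moreover have "{1<..n} = {2..n}"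
    by auto
  ultimately have "q ^ (v * (\<Sum>j\<in>{2..n}. lookup a j)) = 1"
    using n by (simp add: e_def com_single mult.commute [of v] power_mult)
  then show ?thesis
    by (simp add: ord)
qed

text \<open>Modulo \<open>m\<close> the entries of a central exponent are \<open>\<alpha>, -\<alpha>, \<alpha>, \<dots>\<close> by \<open>Lam_neighbours\<close>. For even \<open>n\<close>
  the degree vanishes modulo \<open>m\<close>, so \<open>Lam_first\<close> gives \<open>m dvd v \<alpha>\<close>, and the common divisor is
  \<open>m / gcd m v\<close>. For odd \<open>n\<close> the degree is \<open>\<alpha>\<close> modulo \<open>m\<close> and \<open>0\<close> modulo \<open>v\<close>, and the common
  divisor is \<open>gcd m v\<close>.\<close>

lemma Lam_dvd: "\<exists>g\<ge>2. \<forall>a\<in>Lam. \<forall>i\<in>{1..n}. g dvd lookup a i"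
proof -
  define g where "g = (if even n then m div gcd m v else gcd m v)"
  have "g \<noteq> 0"
    using m by (auto simp: g_def div_greater_zero_iff gcd_le1_nat)
  moreover have "g \<noteq> 1"
  proof (cases "even n")
    case True
    then have "\<not> m dvd v"
      using parity by auto
    then show ?thesis
      using True m by (metis dvd_div_mult_self g_def gcd_dvd1 gcd_dvd2 mult_1)
  qed (use parity in \<open>simp add: g_def\<close>)
  ultimately have g2: "2 \<le> g"
    by linarith
  have gm: "g dvd m"
    by (auto simp: g_def intro: dvd_triv_right dvdI [of _ _ "gcd m v"])
  have "g dvd lookup a i" if a: "a \<in> Lam" and i: "1 \<le> i" "i \<le> n" for a i
    using i
  proof (induction i rule: dec_induct)
    case base
    let ?s = "\<Sum>j\<in>{2..n}. lookup a j" and ?x = "lookup a 1"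
    have s: "tdeg n a = ?x + ?s"
      using n by (simp add: tdeg_def sum.atLeast_Suc_atMost numeral_2_eq_2)
    show ?case
    proof (cases "even n")
      case True
      have "m dvd ?x + ?s"
        unfolding s [symmetric] tdeg_def
        using dvd_pairs_sum [of 1 "n div 2" m "lookup a"] Lam_neighbours [OF a] True
        by (simp add: atLeastLessThanSuc_atLeastAtMost)
      then have "m dvd v * ?x + v * ?s"
        by (metis distrib_left dvd_mult)
      then have "m dvd v * ?x"
        using Lam_first [OF a] by (simp add: dvd_add_left_iff)
      then have "m div gcd m v dvd ?x"
        using m by (intro dvd_mult_div_gcd) auto
      then show ?thesis
        using True by (simp add: g_def)
    next
      case False
      then have "Suc (2 * ((n - 1) div 2)) = n"
        using n by presburger
      then have "{2..<2 + 2 * ((n - 1) div 2)} = {2..n}"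
        by (metis add_2_eq_Suc atLeastLessThanSuc_atLeastAtMost)
      then have "m dvd ?s"
        using dvd_pairs_sum [of 2 "(n - 1) div 2" m "lookup a"] Lam_neighbours [OF a] by simp
      then have "g dvd ?s"
        using gm by (rule dvd_trans [rotated])
      moreover have "g dvd tdeg n a"
        using False mons_dvd [OF Lam_M [OF a]] by (simp add: g_def) (metis dvd_trans gcd_dvd2)
      ultimately show ?thesis
        by (simp add: s dvd_add_left_iff)
    qed
  next
    case (step k)
    then show ?case
      using Lam_neighbours [OF a, of k] gm by (metis Suc_leD Suc_le_lessD dvd_add_right_iff dvd_trans)
  qed
  then show ?thesis
    using g2 by auto
qed

text \<open>The positive generator of the group of \<open>i\<close>th entries of central exponents (\<open>t_attained\<close>,
  \<open>t_dvd\<close>).\<close>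

definition t :: "nat \<Rightarrow> nat"
  where "t i = (LEAST s. 0 < s \<and> (\<exists>a\<in>Lam. lookup a i = s))"

lemma t_least: "a \<in> Lam \<Longrightarrow> 0 < lookup a i \<Longrightarrow> t i \<le> lookup a i"
  unfolding t_def by (rule Least_le) auto

lemma Lam_cancel_e:
  assumes a: "a \<in> Lam" and i: "i \<in> {1..n}" and le: "k * (m * v) \<le> lookup a i"
  obtains b where "b \<in> Lam" "a = of_nat (k * m) * e i + b"
proof -
  have c: "of_nat (k * m) * e i \<in> Lam"
    using Lam_of_nat_mult [OF Lam_m [OF e_M [OF i]], of k] by (simp add: mult.assoc)
  obtain b where "b \<in> M" "a = of_nat (k * m) * e i + b"
  proof (rule mons_diff [OF Lam_M [OF a] Lam_M [OF c]])
    show "lookup (of_nat (k * m) * e i) j \<le> lookup a j" for j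
      using le unfolding lookup_of_nat_mult by (simp add: lookup_e mult.assoc)
  qed
  then show thesis
    using that a c Lam_add_iff by metis
qed

lemma t_attained:
  assumes i: "i \<in> {1..n}"
  shows "0 < t i" "\<exists>a\<in>Lam. lookup a i = t i"
proof -
  have "of_nat m * e i \<in> Lam" "lookup (of_nat m * e i) i = m * v"
    by (rule Lam_m [OF e_M [OF i]]) (simp add: lookup_of_nat_mult lookup_e)
  then have "\<exists>s. 0 < s \<and> (\<exists>a\<in>Lam. lookup a i = s)"
    using m v by (intro exI [of _ "m * v"]) auto
  from LeastI_ex [OF this] show "0 < t i" "\<exists>a\<in>Lam. lookup a i = t i"
    by (simp_all add: t_def)
qed

text \<open>The remainder of an \<open>i\<close>th entry modulo \<open>t i\<close> is again an \<open>i\<close>th entry of a central exponent. As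
  exponents cannot be negative, subtracting a multiple of \<open>t i\<close> is done by adding a multiple that
  is congruent modulo \<open>m v\<close> and then removing copies of \<open>x_i^(m v)\<close>, which is central.\<close>

lemma t_dvd:
  assumes i: "i \<in> {1..n}" and a: "a \<in> Lam"
  shows "t i dvd lookup a i"
proof (rule ccontr)
  assume "\<not> t i dvd lookup a i"
  then have pos: "0 < lookup a i mod t i"
    by (simp add: dvd_eq_mod_eq_0)
  obtain b where b: "b \<in> Lam" "lookup b i = t i"
    using t_attained [OF i] by blast
  let ?k = "lookup a i div t i"
  let ?c = "a + of_nat ((m * v - 1) * ?k) * b"
  have c: "?c \<in> Lam"
    using a b by (intro Lam_add Lam_of_nat_mult)
  have "lookup ?c i = lookup a i mod t i + ?k * t i + (m * v - 1) * ?k * t i"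
    unfolding lookup_add lookup_of_nat_mult by (simp add: b mod_div_mult_eq)
  also have "\<dots> = lookup a i mod t i + (1 + (m * v - 1)) * (?k * t i)"
    by (simp only: distrib_right mult.assoc add.assoc mult_1)
  also have "1 + (m * v - 1) = m * v"
    using m v by simp
  finally have ci: "lookup ?c i = lookup a i mod t i + (?k * t i) * (m * v)"
    by (simp add: ac_simps)
  obtain d where d: "d \<in> Lam" "?c = of_nat (?k * t i * m) * e i + d"
    using Lam_cancel_e [OF c i, of "?k * t i"] ci by auto
  have "lookup ?c i = ?k * t i * m * v + lookup d i"
    unfolding d(2) lookup_add lookup_of_nat_mult by (simp add: lookup_e)
  then have "lookup d i = lookup a i mod t i"
    using ci by (simp add: mult.assoc)
  then have "t i \<le> lookup a i mod t i"
    using t_least [OF d(1), of i] pos by simp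
  then show False
    using mod_less_divisor [OF t_attained(1) [OF i], of "lookup a i"] by linarith
qed

lemma t_ge_2:
  assumes i: "i \<in> {1..n}"
  shows "2 \<le> t i"
proof -
  obtain g where g: "2 \<le> g" "\<forall>a\<in>Lam. \<forall>i\<in>{1..n}. g dvd lookup a i"
    using Lam_dvd by blast
  moreover obtain a where "a \<in> Lam" "lookup a i = t i"
    using t_attained(2) [OF i] by blast
  ultimately have "g dvd t i"
    using i by metis
  with g(1) t_attained(1) [OF i] show ?thesis
    by (auto dest: dvd_imp_le)
qed

lemma t_le: "i \<in> {1..n} \<Longrightarrow> t i \<le> m * v"
proof -
  assume i: "i \<in> {1..n}"
  have "t i dvd lookup (of_nat m * e i) i"
    by (intro t_dvd i Lam_m e_M)
  then show ?thesis
    using m v by (intro dvd_imp_le) (simp_all add: lookup_of_nat_mult lookup_e)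
qed

text \<open>Every monomial becomes central after multiplication with a suitable one, and the order in \<open>x_i\<close>
  needs to be raised only to the next multiple of \<open>t i\<close>. The other entries are made large by a
  central monomial.\<close>

lemma central_completion:
  assumes b: "b \<in> M" and i: "i \<in> {1..n}"
  obtains c where "c \<in> M" "b + c \<in> Lam" "lookup c i \<le> t i - 1"
proof -
  let ?x = "lookup b i"
  obtain a where a: "a \<in> Lam" "lookup a i = t i"
    using t_attained [OF i] by blast
  \<comment> \<open>the least \<open>k\<close> with \<open>k * t i \<ge> b i\<close>\<close>
  define k where "k = (?x + (t i - 1)) div t i"
  have t: "0 < t i"
    using t_attained [OF i] by simp
  have k: "?x \<le> k * t i" "k * t i \<le> ?x + (t i - 1)"
  proof -
    show "k * t i \<le> ?x + (t i - 1)"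
      by (simp add: k_def)
    have "?x + (t i - 1) = k * t i + (?x + (t i - 1)) mod t i"
      unfolding k_def by (simp only: div_mult_mod_eq)
    moreover have "(?x + (t i - 1)) mod t i < t i"
      by (rule mod_less_divisor [OF t])
    ultimately show "?x \<le> k * t i"
      using t by arith
  qed
  define big where "big = of_nat m * vec n (\<lambda>j. if j = i then 0 else v * lookup b j)"
  have big: "big \<in> Lam"
    unfolding big_def by (intro Lam_m vec_in_mons dvd_sum) auto
  have lam: "of_nat k * a + big \<in> Lam"
    using a big by (intro Lam_add Lam_of_nat_mult)
  obtain c where c: "c \<in> M" "of_nat k * a + big = b + c"
  proof (rule mons_diff [OF Lam_M [OF lam] b])
    fix j assume j: "j \<in> {1..n}"
    have l: "lookup (of_nat k * a + big) j
        = k * lookup a j + m * (if j = i then 0 else v * lookup b j)"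
      unfolding big_def lookup_add lookup_of_nat_mult using j by simp
    show "lookup b j \<le> lookup (of_nat k * a + big) j"
    proof (cases "j = i")
      case True
      then show ?thesis
        unfolding l using k(1) a(2) by simp
    next
      case False
      have "0 < m * v"
        using m v by simp
      then have "lookup b j \<le> (m * v) * lookup b j"
        by (cases "m * v") simp_all
      then show ?thesis
        unfolding l using False by (simp only: if_False mult.assoc trans_le_add2)
    qed
  qed
  have "lookup (of_nat k * a + big) i = k * t i"
    unfolding big_def lookup_add lookup_of_nat_mult using i a by simp
  then have "lookup c i \<le> t i - 1"
    using k by (simp add: c lookup_add)
  then show thesis
    using that c lam by simp
qed

section \<open>Central elements and commutators\<close>

definition central :: "'k qpoly \<Rightarrow> bool"
  where "central z \<longleftrightarrow> z \<in> S \<and> (\<forall>u\<in>S. z \<star> u = u \<star> z)"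

lemma single_comm: "com a b = 1 \<Longrightarrow> single a c \<star> single b d = single b d \<star> single a c"
  by (simp add: star_single com_eq_1_iff ac_simps)

lemma central_keys: "central z \<Longrightarrow> keys z \<subseteq> Lam"
proof
  fix a
  assume z: "central z" and a: "a \<in> keys z"
  then have aM: "a \<in> M"
    by (auto simp: central_def qpolys_def)
  have "com a b = 1" if b: "b \<in> M" for b
  proof -
    have "lookup (z \<star> single b 1) (a + b) = lookup (single b 1 \<star> z) (b + a)"
      using z qpolys_single [OF b, of "1 :: 'k"] by (simp add: central_def add.commute)
    then show ?thesis
      using a by (simp add: lookup_star_single_left lookup_star_single_right com_eq_1_iff in_keys_iff)
  qed
  with aM show "a \<in> Lam"
    by (simp add: Lam_def)
qed

lemma S_induct [consumes 1, case_names zero add]: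
  assumes "p \<in> S" "P 0"
    and "\<And>a c f. a \<in> M \<Longrightarrow> f \<in> S \<Longrightarrow> P f \<Longrightarrow> P (single a c + f)"
  shows "P p"
  by (rule keys_subset_induct [of p M]) (use assms in \<open>auto simp: qpolys_def\<close>)

lemma central_single: "a \<in> Lam \<Longrightarrow> central (single a c)"
proof -
  assume a: "a \<in> Lam"
  have "single a c \<star> u = u \<star> single a c" if "u \<in> S" for u
    using that
  proof (induction u rule: S_induct)
    case (add b d f)
    then show ?case
      using single_comm [OF Lam_com(1) [OF a add(1)]] by (simp add: star_add_left star_add_right)
  qed simp
  then show ?thesis
    using a by (simp add: central_def qpolys_single Lam_M)
qed

lemma central_commute: "central z \<Longrightarrow> u \<in> S \<Longrightarrow> u \<star> z = z \<star> u"
  by (simp add: central_def)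

lemma central_star: "central y \<Longrightarrow> central z \<Longrightarrow> central (y \<star> z)"
  unfolding central_def by (metis qpolys_star star_assoc)

lemma central_one: "central 1"
  by (simp add: central_def)

text \<open>Restriction to \<open>Lam\<close> is the projection of the algebra onto its centre; it is linear over the
  centre.\<close>

lemma restrict_Lam_star:
  assumes z: "keys z \<subseteq> Lam" and w: "w \<in> S"
  shows "restrict_keys Lam (z \<star> w) = z \<star> restrict_keys Lam w"
  using z
proof (induction z rule: keys_subset_induct)
  case (add a c f)
  have "restrict_keys Lam (single a c \<star> w) = single a c \<star> restrict_keys Lam w"
    using w
  proof (induction w rule: S_induct)
    case (add b d g)
    then show ?case
      using Lam_add_iff [OF \<open>a \<in> Lam\<close> add(1)]
      by (simp add: star_add_right restrict_keys_add star_single restrict_keys_single)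
  qed simp
  with add show ?case
    by (simp add: star_add_left restrict_keys_add)
qed simp

text \<open>The additive span of the commutators; it absorbs scalars because \<open>S\<close> does.\<close>

inductive_set Comm :: "'k qpoly set"
  where
    zero: "0 \<in> Comm"
  | add: "y \<in> S \<Longrightarrow> w \<in> S \<Longrightarrow> c \<in> Comm \<Longrightarrow> (y \<star> w - w \<star> y) + c \<in> Comm"

lemma Comm_add: "c \<in> Comm \<Longrightarrow> d \<in> Comm \<Longrightarrow> c + d \<in> Comm"
  by (induction c rule: Comm.induct) (auto simp: add.assoc intro: Comm.add)

text \<open>If \<open>a + b\<close> is central, then \<open>com a b = com (a + b) b = 1\<close>. So a central monomial occurs in no
  commutator of monomials.\<close>

lemma restrict_Lam_commutator:
  assumes y: "y \<in> S" and w: "w \<in> S"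
  shows "restrict_keys Lam (y \<star> w) = restrict_keys Lam (w \<star> y)"
  using y
proof (induction y rule: S_induct)
  case (add a c f)
  have "restrict_keys Lam (single a c \<star> w) = restrict_keys Lam (w \<star> single a c)"
    using w
  proof (induction w rule: S_induct)
    case (add b d g)
    have "com a b = 1" if "a + b \<in> Lam"
      using Lam_com(1) [OF that add(1)] by (simp add: com_add)
    then have "restrict_keys Lam (single a c \<star> single b d) = restrict_keys Lam (single b d \<star> single a c)"
      using single_comm [of a b c d] by (cases "a + b \<in> Lam") (simp_all add: star_single restrict_keys_single add.commute)
    with add show ?case
      by (simp add: star_add_right star_add_left restrict_keys_add)
  qed simp
  with add show ?case
    by (simp add: star_add_left star_add_right restrict_keys_add)
qed simp

lemma restrict_Lam_Comm: "c \<in> Comm \<Longrightarrow> restrict_keys Lam c = 0"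
  by (induction c rule: Comm.induct) (simp_all add: restrict_keys_add restrict_keys_diff restrict_Lam_commutator)

section \<open>Dual pairs\<close>

text \<open>A condition under which the fraction \<open>y / z\<close> lies in the codifferent over the centre, which
  means that the projection onto the centre of \<open>y u / z\<close> has no denominator, for each \<open>u\<close>. It is
  phrased in terms of the centre and the commutators and is therefore preserved by automorphisms.\<close>

definition dual :: "'k qpoly \<Rightarrow> 'k qpoly \<Rightarrow> bool"
  where "dual y z \<longleftrightarrow> y \<in> S \<and> central z \<and> z \<noteq> 0 \<and> (\<forall>u\<in>S. \<exists>w\<in>S. \<exists>c\<in>Comm. y \<star> u = z \<star> w + c)"

lemma restrict_keys_S: "f \<in> S \<Longrightarrow> restrict_keys A f \<in> S"
  by (auto simp: qpolys_def keys_restrict_keys)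

lemma dual_restrict_Lam:
  assumes yz: "dual y z" and u: "u \<in> S"
  shows "\<exists>w\<in>S. restrict_keys Lam (y \<star> u) = z \<star> w"
proof -
  obtain w c where w: "w \<in> S" "c \<in> Comm" "y \<star> u = z \<star> w + c"
    using yz u by (auto simp: dual_def)
  have "keys z \<subseteq> Lam"
    using yz by (simp add: dual_def central_keys)
  then have "restrict_keys Lam (y \<star> u) = z \<star> restrict_keys Lam w"
    by (simp add: w restrict_keys_add restrict_Lam_Comm restrict_Lam_star)
  then show ?thesis
    using restrict_keys_S w by blast
qed

text \<open>Multiply \<open>y\<close> with a monomial that makes its term of least order in \<open>x_i\<close> central and raises this
  order by at most \<open>t i - 1\<close>. The projection of the product onto the centre is divisible by \<open>z\<close>.\<close>

lemma dual_val:
  assumes yz: "dual y z" and y: "y \<noteq> 0" and i: "i \<in> {1..n}"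
  shows "val i z \<le> val i y + (t i - 1)"
proof -
  obtain b where b: "b \<in> keys y" "lookup b i = val i y"
    using val_attained [OF y] .
  then have "b \<in> M"
    using yz by (auto simp: dual_def qpolys_def)
  then obtain c where c: "c \<in> M" "b + c \<in> Lam" "lookup c i \<le> t i - 1"
    using central_completion i by blast
  let ?p = "restrict_keys Lam (y \<star> single c 1)"
  obtain w where w: "?p = z \<star> w"
    using dual_restrict_Lam [OF yz qpolys_single [OF c(1)]] by blast
  have k: "b + c \<in> keys ?p"
    using b c q by (simp add: in_keys_iff lookup_restrict_keys lookup_star_single_right)
  then have "w \<noteq> 0"
    unfolding w by auto
  then have "val i z \<le> val i ?p"
    using val_star(2) [OF q, of z w i] yz w by (simp add: dual_def)
  also have "\<dots> \<le> lookup (b + c) i"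
    by (rule val_le [OF k])
  finally show ?thesis
    using b c by (simp add: lookup_add)
qed

text \<open>The projections onto the centre of the products \<open>y x^c\<close> recover the parts of \<open>y\<close> in the cosets
  of the central exponents, up to monomials. So \<open>z\<close> divides each of these parts, and their sum
  \<open>y\<close>, after multiplication with a central monomial.\<close>

lemma dual_dvd_up_to_monomial:
  assumes yz: "dual y z"
  shows "\<exists>a\<in>Lam. \<exists>d. d \<noteq> 0 \<and> (\<exists>w\<in>S. single a d \<star> y = z \<star> w)"
proof -
  define good where "good f \<longleftrightarrow> (\<exists>a\<in>Lam. \<exists>d. d \<noteq> 0 \<and> (\<exists>w\<in>S. single a d \<star> f = z \<star> w))" for f
  have z: "central z"
    using yz by (simp add: dual_def)
  have good_add: "good (f + g)" if f: "good f" and g: "good g" for f g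
  proof -
    obtain a d w where a: "a \<in> Lam" "d \<noteq> 0" "w \<in> S" "single a d \<star> f = z \<star> w"
      using f by (auto simp: good_def)
    obtain a' d' w' where a': "a' \<in> Lam" "d' \<noteq> 0" "w' \<in> S" "single a' d' \<star> g = z \<star> w'"
      using g by (auto simp: good_def)
    let ?x = "single a d" and ?y = "single a' d'"
    have S: "?x \<in> S" "?y \<in> S"
      using a a' by (simp_all add: qpolys_single Lam_M)
    have xy: "?x \<star> ?y = ?y \<star> ?x"
      by (rule central_commute [OF central_single [OF a'(1)] S(1)])
    have "(?x \<star> ?y) \<star> (f + g) = (?y \<star> ?x) \<star> f + (?x \<star> ?y) \<star> g"
      by (simp only: star_add_right xy)
    also have "\<dots> = (?y \<star> z) \<star> w + (?x \<star> z) \<star> w'"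
      by (simp only: star_assoc a(4) a'(4))
    also have "\<dots> = z \<star> (?y \<star> w + ?x \<star> w')"
      by (simp only: central_commute [OF z S(1)] central_commute [OF z S(2)] star_assoc star_add_right)
    finally have "(?x \<star> ?y) \<star> (f + g) = z \<star> (?y \<star> w + ?x \<star> w')" .
    moreover have "?y \<star> w + ?x \<star> w' \<in> S"
      using S a a' by (simp add: qpolys_add qpolys_star)
    ultimately show ?thesis
      unfolding good_def using a a' q
      by (intro bexI [of _ "a + a'"] exI [of _ "q ^ cross n a a' * d * d'"] conjI bexI [of _ "?y \<star> w + ?x \<star> w'"])
        (simp_all add: star_single Lam_add)
  qed
  \<comment> \<open>exponents have the same value of \<open>h\<close> if they are congruent modulo the central exponents\<close>
  define h where "h b = (\<lambda>c. if c \<in> M then com b c else 1)" for b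
  have y: "y \<in> S"
    using yz by (simp add: dual_def)
  have "good (restrict_keys {b'. h b' = C} y)" if CC: "C \<in> h ` keys y" for C
  proof -
    obtain b where C: "C = h b" and b: "b \<in> keys y"
      using CC by blast
    have bM: "b \<in> M"
      using b y by (auto simp: qpolys_def)
    \<comment> \<open>as \<open>m b\<close> is central, \<open>(m - 1) b\<close> represents the class of \<open>-b\<close>\<close>
    let ?c = "of_nat (m - 1) * b" and ?r = "restrict_keys {b'. h b' = C} y"
    have cM: "?c \<in> M"
      using bM by (rule mons_of_nat_mult)
    have cb: "?c + b = of_nat m * b"
    proof (rule poly_mapping_eqI)
      have "(m - 1) * k + k = m * k" for k
        using m by (cases m) simp_all
      then show "lookup (?c + b) i = lookup (of_nat m * b) i" for i
        by (simp only: lookup_add lookup_of_nat_mult)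
    qed
    have iff: "b' + ?c \<in> Lam \<longleftrightarrow> h b' = h b" if b': "b' \<in> M" for b'
    proof -
      have com_c: "com b x * com ?c x = 1" if "x \<in> M" for x
        using Lam_com(1) [OF Lam_m [OF bM] that] unfolding cb [symmetric] com_add by (simp only: mult.commute)
      have "com b' x * com ?c x = 1 \<longleftrightarrow> com b' x = com b x" if "x \<in> M" for x
        using com_c [OF that] by (metis com_nz mult_cancel_right)
      then have "b' + ?c \<in> Lam \<longleftrightarrow> (\<forall>x\<in>M. com b' x = com b x)"
        using b' cM by (simp add: Lam_def mons_add com_add)
      also have "\<dots> \<longleftrightarrow> h b' = h b"
        unfolding h_def fun_eq_iff by auto
      finally show ?thesis .
    qed
    have res: "restrict_keys Lam (y \<star> single ?c 1) = ?r \<star> single ?c 1"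
      using y
    proof (induction y rule: S_induct)
      case (add b' d f)
      then show ?case
        using iff [OF add(1)] by (simp add: star_add_left restrict_keys_add restrict_keys_single star_single C)
    qed simp
    obtain w where w: "w \<in> S" "?r \<star> single ?c 1 = z \<star> w"
      using dual_restrict_Lam [OF yz qpolys_single [OF cM]] res by metis
    have "single ?c 1 \<star> single b 1 = single (of_nat m * b) (q ^ cross n ?c b)"
      by (simp add: star_single flip: cb)
    then have "?r \<star> single (of_nat m * b) (q ^ cross n ?c b) = z \<star> (w \<star> single b 1)"
      using w by (metis star_assoc)
    moreover have "?r \<star> single (of_nat m * b) (q ^ cross n ?c b) = single (of_nat m * b) (q ^ cross n ?c b) \<star> ?r"
      by (intro central_commute central_single Lam_m bM restrict_keys_S y)
    ultimately show ?thesis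
      unfolding good_def using q w(1)
      by (intro bexI [of _ "of_nat m * b"] exI [of _ "q ^ cross n ?c b"] conjI bexI [of _ "w \<star> single b 1"]
        Lam_m bM qpolys_star qpolys_single) simp_all
  qed
  moreover have "good (\<Sum>C\<in>K. restrict_keys {b'. h b' = C} y)"
    if "finite K" "\<And>C. C \<in> K \<Longrightarrow> good (restrict_keys {b'. h b' = C} y)" for K
    using that
  proof (induction K rule: finite_induct)
    case empty
    have "good 0"
      unfolding good_def by (rule bexI [of _ 0], rule exI [of _ 1]) (auto intro: bexI [of _ 0])
    then show ?case
      by simp
  qed (auto intro: good_add)
  ultimately have "good (\<Sum>C\<in>h ` keys y. restrict_keys {b'. h b' = C} y)"
    by simp
  then have "good y"
    by (rule ssubst [OF sum_restrict_keys [of y h], of good])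
  then show ?thesis
    by (simp add: good_def)
qed


section \<open>An invariant principal ideal\<close>

primrec pw :: "'k qpoly \<Rightarrow> nat \<Rightarrow> 'k qpoly"
  where "pw y 0 = 1"
  | "pw y (Suc k) = y \<star> pw y k"

lemma pw_S: "y \<in> S \<Longrightarrow> pw y k \<in> S"
  by (induction k) (simp_all add: qpolys_star)

lemma pw_central: "central y \<Longrightarrow> central (pw y k)"
  by (induction k) (simp_all add: central_star central_one)

lemma pw_nonzero: "y \<noteq> 0 \<Longrightarrow> pw y k \<noteq> 0"
  by (induction k) (simp_all add: val_star(1) [OF q])

lemma val_single: "d \<noteq> 0 \<Longrightarrow> val i (single a (d :: 'k)) = lookup a i"
  by (simp add: val_def)

lemma val_pw: "y \<noteq> 0 \<Longrightarrow> val i (pw y k) = k * val i y"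
proof (induction k)
  case 0
  have "val i (1 :: 'k qpoly) = 0"
    by (simp add: val_def)
  then show ?case
    by simp
qed (simp add: val_star(2) [OF q] pw_nonzero)

lemma pw_zero: "0 < k \<Longrightarrow> pw 0 k = 0"
  by (cases k) simp_all

lemma pw_star:
  assumes z: "central z" and y: "y \<in> S"
  shows "pw (z \<star> y) k = pw z k \<star> pw y k"
proof (induction k)
  case (Suc k)
  have "y \<star> pw z k = pw z k \<star> y"
    by (rule central_commute [OF pw_central [OF z] y])
  then have "z \<star> (y \<star> (pw z k \<star> pw y k)) = (z \<star> pw z k) \<star> (y \<star> pw y k)"
    by (metis star_assoc)
  then show ?case
    by (simp add: Suc star_assoc)
qed simp

lemma pw_single:
  assumes d: "d \<noteq> 0"
  shows "\<exists>d'. d' \<noteq> 0 \<and> pw (single a d) k = single (of_nat k * a) d'"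
proof (induction k)
  case 0
  show ?case
    by (rule exI [of _ 1]) simp
next
  case (Suc k)
  then obtain d' where "d' \<noteq> 0" "pw (single a d) k = single (of_nat k * a) d'"
    by blast
  then show ?case
    using d q by (intro exI [of _ "q ^ cross n a (of_nat k * a) * d * d'"]) (simp add: star_single distrib_right)
qed

lemma monomial_dvd:
  assumes a: "a \<in> M" and d: "d \<noteq> 0" and f: "f \<in> S"
    and le: "\<And>b i. b \<in> keys f \<Longrightarrow> i \<in> {1..n} \<Longrightarrow> lookup a i \<le> lookup b i"
  shows "\<exists>w\<in>S. f = single a d \<star> w"
proof -
  have "keys f \<subseteq> {b \<in> M. \<forall>i\<in>{1..n}. lookup a i \<le> lookup b i}"
    using f le by (auto simp: qpolys_def)
  then show ?thesis
  proof (induction f rule: keys_subset_induct)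
    case zero
    show ?case
      by (rule bexI [of _ 0]) simp_all
  next
    case (add b x f)
    obtain w where w: "w \<in> S" "f = single a d \<star> w"
      using add.IH by blast
    have "b \<in> M" and le: "\<And>i. i \<in> {1..n} \<Longrightarrow> lookup a i \<le> lookup b i"
      using add.hyps(1) by simp_all
    then obtain c where c: "c \<in> M" "b = a + c"
      using mons_diff [OF _ a] by blast
    let ?y = "single c (x / (q ^ cross n a c * d))"
    have "single a d \<star> ?y = single b x"
      using q d by (simp add: star_single c)
    then have "single b x + f = single a d \<star> (?y + w)"
      by (simp add: star_add_right w)
    moreover have "?y + w \<in> S"
      using c w by (simp add: qpolys_add qpolys_single)
    ultimately show ?case
      by blast
  qed
qed

text \<open>The elements that carry the \<open>v\<close>th powers of the fractions \<open>y / z\<close> given by dual pairs into the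
  algebra.\<close>

definition J :: "'k qpoly set"
  where "J = {c \<in> S. \<forall>y z. dual y z \<longrightarrow> (\<exists>w\<in>S. c \<star> pw y v = pw z v \<star> w)}"

definition dvec :: "exponent"
  where "dvec = vec n (\<lambda>i. v * (t i - 1))"

lemma dvec_M: "dvec \<in> M"
  unfolding dvec_def by (intro vec_in_mons dvd_sum) simp

lemma lookup_dvec: "i \<in> {1..n} \<Longrightarrow> lookup dvec i = v * (t i - 1)"
  unfolding dvec_def by (rule lookup_vec_in)

lemma dvec_pos: "i \<in> {1..n} \<Longrightarrow> 0 < lookup dvec i"
  using t_ge_2 [of i] v by (simp add: lookup_dvec)

text \<open>By \<open>dual_dvd_up_to_monomial\<close> the quotient of \<open>x^d y^v\<close> by \<open>z^v\<close> has at most a monomial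
  denominator, and by \<open>dual_val\<close> it has non-negative order along each \<open>x_i\<close>.\<close>

lemma monomial_dvec_in_J: "single dvec 1 \<in> J"
proof -
  let ?D = "single dvec (1 :: 'k)"
  have D: "?D \<in> S"
    by (rule qpolys_single [OF dvec_M])
  have "\<exists>w\<in>S. ?D \<star> pw y v = pw z v \<star> w" if yz: "dual y z" for y z
  proof (cases "y = 0")
    case True
    then show ?thesis
      using v by (intro bexI [of _ 0]) (simp_all add: pw_zero)
  next
    case y0: False
    have y: "y \<in> S" and z: "central z" and z0: "z \<noteq> 0"
      using yz by (simp_all add: dual_def)
    obtain a d w where a: "a \<in> Lam" and d: "d \<noteq> 0" and w: "w \<in> S"
      and eq: "single a d \<star> y = z \<star> w"
      using dual_dvd_up_to_monomial [OF yz] by blast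
    obtain d' where d': "d' \<noteq> 0" and pa: "pw (single a d) v = single (of_nat v * a) d'"
      using pw_single [OF d] by blast
    let ?a = "of_nat v * a" and ?X = "single (of_nat v * a) d'"
    have aL: "?a \<in> Lam"
      by (rule Lam_of_nat_mult [OF a])
    let ?W = "?D \<star> pw w v"
    have WS: "?W \<in> S"
      by (intro qpolys_star D pw_S w)
    have "?X \<star> pw y v = pw z v \<star> pw w v"
      using pw_star [OF central_single [OF a] y, of d v] pw_star [OF z w, of v] eq pa by simp
    moreover have "?D \<star> ?X = ?X \<star> ?D" "?D \<star> pw z v = pw z v \<star> ?D"
      by (rule central_commute [OF central_single [OF aL] D], rule central_commute [OF pw_central [OF z] D])
    ultimately have eq2: "?X \<star> (?D \<star> pw y v) = pw z v \<star> ?W"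
      by (metis star_assoc)
    have nz: "?D \<star> pw y v \<noteq> 0" "?X \<noteq> 0" "pw z v \<noteq> 0" "?D \<noteq> 0" "pw y v \<noteq> 0"
      using y0 z0 d' by (simp_all add: val_star(1) [OF q] pw_nonzero single_eq_0_iff)
    then have "?X \<star> (?D \<star> pw y v) \<noteq> 0"
      by (intro val_star(1) q)
    then have W0: "?W \<noteq> 0"
      using eq2 by auto
    have ge: "lookup ?a i \<le> val i ?W" if i: "i \<in> {1..n}" for i
    proof -
      have "lookup ?a i + (v * (t i - 1) + v * val i y) = v * val i z + val i ?W"
        using arg_cong [OF eq2, of "val i"] nz W0 d' y0 z0 i
        by (simp add: val_star(2) [OF q] val_pw val_single lookup_dvec)
      moreover have "v * val i z \<le> v * (val i y + (t i - 1))"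
        by (intro mult_le_mono2 dual_val yz y0 i)
      ultimately show ?thesis
        by (simp add: distrib_left)
    qed
    obtain w' where w': "w' \<in> S" "?W = ?X \<star> w'"
    proof -
      have "\<exists>w\<in>S. ?W = ?X \<star> w"
      proof (rule monomial_dvd [OF Lam_M [OF aL] d' WS])
        fix b i
        assume "b \<in> keys ?W" "i \<in> {1..n}"
        then show "lookup ?a i \<le> lookup b i"
          using ge val_le order_trans by blast
      qed
      then show thesis
        using that by blast
    qed
    have "?X \<star> (?D \<star> pw y v) = ?X \<star> (pw z v \<star> w')"
    proof -
      have "?X \<in> S"
        by (rule qpolys_single [OF Lam_M [OF aL]])
      then have "pw z v \<star> ?X = ?X \<star> pw z v"
        using pw_central [OF z, of v] by (simp add: central_def)
      then show ?thesis
        by (metis eq2 w'(2) star_assoc)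
    qed
    then have "?D \<star> pw y v = pw z v \<star> w'"
      by (rule star_cancel_left [OF q nz(2)])
    then show ?thesis
      using w'(1) by blast
  qed
  then show ?thesis
    using D by (simp add: J_def)
qed

text \<open>If \<open>x^u\<close> does not commute with \<open>x^r\<close>, then neither does \<open>x^(u - r)\<close>, and \<open>x^u\<close> is a multiple of
  their commutator. The entries of \<open>r\<close> may be reduced modulo \<open>m v\<close>, so that \<open>u - r\<close> is an
  exponent.\<close>

lemma noncentral_monomial_in_Comm:
  assumes u: "u \<in> M" "u \<notin> Lam" and big: "\<And>i. i \<in> {1..n} \<Longrightarrow> m * v \<le> lookup u i"
  shows "single u x \<in> Comm"
proof -
  obtain b where b: "b \<in> M" "com u b \<noteq> 1"
    using u by (auto simp: Lam_def)
  let ?r = "vec n (\<lambda>i. lookup b i mod (m * v))" and ?s = "vec n (\<lambda>i. v * (lookup b i div (m * v)))"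
  have s: "?s \<in> M"
    by (intro vec_in_mons dvd_sum) simp
  have split: "lookup b i mod (m * v) + m * (v * (lookup b i div (m * v))) = lookup b i" for i
    unfolding mult.assoc [symmetric] by (rule mod_mult_div_eq)
  have "tdeg n b = (\<Sum>i\<in>{1..n}. lookup b i mod (m * v)) + (\<Sum>i\<in>{1..n}. m * (v * (lookup b i div (m * v))))"
    unfolding tdeg_def sum.distrib [symmetric] split ..
  moreover have "v dvd (\<Sum>i\<in>{1..n}. m * (v * (lookup b i div (m * v))))"
    by (intro dvd_sum) simp
  ultimately have r: "?r \<in> M"
    using mons_dvd [OF b(1)] by (intro vec_in_mons) (metis dvd_add_left_iff)
  have beq: "b = ?r + of_nat m * ?s"
  proof (rule mons_eqI [OF b(1) mons_add [OF r mons_of_nat_mult [OF s]]])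
    fix i assume i: "i \<in> {1..n}"
    show "lookup b i = lookup (?r + of_nat m * ?s) i"
      unfolding lookup_add lookup_of_nat_mult lookup_vec_in [OF i] split ..
  qed
  have "com u (?r + of_nat m * ?s) = com u ?r"
    by (simp add: com_add com_of_nat_mult com_m)
  then have "com u b = com u ?r"
    by (simp only: beq [symmetric])
  with b have ur: "com u ?r \<noteq> 1"
    by simp
  have mv: "0 < m * v"
    using m v by simp
  obtain g where g: "g \<in> M" "u = ?r + g"
  proof (rule mons_diff [OF u(1) r])
    fix i assume i: "i \<in> {1..n}"
    have "lookup b i mod (m * v) < m * v"
      by (rule mod_less_divisor [OF mv])
    then show "lookup ?r i \<le> lookup u i"
      unfolding lookup_vec_in [OF i] using big [OF i] by linarith
  qed
  have "com g ?r \<noteq> 1"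
    using ur by (simp add: g(2) com_add)
  then have ne: "q ^ cross n g ?r - q ^ cross n ?r g \<noteq> 0"
    by (simp add: com_eq_1_iff)
  let ?y = "single g (x / (q ^ cross n g ?r - q ^ cross n ?r g))" and ?w = "single ?r (1 :: 'k)"
  have "?y \<star> ?w - ?w \<star> ?y = single u x"
  proof -
    have "q ^ cross n g ?r * (x / (q ^ cross n g ?r - q ^ cross n ?r g)) - q ^ cross n ?r g * (x / (q ^ cross n g ?r - q ^ cross n ?r g)) = x"
      unfolding left_diff_distrib [symmetric] using ne by simp
    then show ?thesis
      unfolding star_single g(2) add.commute [of g] mult_1_right mult.assoc mult_1_left single_diff [symmetric] by simp
  qed
  moreover have "(?y \<star> ?w - ?w \<star> ?y) + 0 \<in> Comm"
    using g r by (intro Comm.intros qpolys_single)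
  ultimately show ?thesis
    by simp
qed

text \<open>These pairs attain the bound of \<open>dual_val\<close> in one coordinate \<open>i\<close>. A central exponent \<open>b + a\<close> has
  an \<open>i\<close>th entry divisible by \<open>t i\<close>, so if it exceeds \<open>l i - t i\<close>, it is at least \<open>l i\<close>. The other
  exponents \<open>b + a\<close> give commutators.\<close>

lemma dual_monomials:
  assumes l: "l \<in> Lam" and b: "b \<in> M" and i: "i \<in> {1..n}"
    and bi: "lookup l i \<le> lookup b i + (t i - 1)"
    and bj: "\<And>j. j \<in> {1..n} \<Longrightarrow> j \<noteq> i \<Longrightarrow> lookup l j \<le> lookup b j"
    and big: "\<And>j. j \<in> {1..n} \<Longrightarrow> m * v \<le> lookup b j"
  shows "dual (single b 1) (single l 1)"
proof -
  let ?y = "single b (1 :: 'k)" and ?z = "single l (1 :: 'k)"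
  have mono: "\<exists>w\<in>S. \<exists>c\<in>Comm. ?y \<star> single a x = ?z \<star> w + c" if a: "a \<in> M" for a x
  proof (cases "b + a \<in> Lam")
    case True
    have "lookup l i \<le> lookup (b + a) i"
    proof (rule ccontr)
      assume "\<not> lookup l i \<le> lookup (b + a) i"
      then have pos: "0 < lookup l i - lookup (b + a) i"
        by simp
      have "t i dvd lookup l i - lookup (b + a) i"
        by (intro dvd_diff_nat t_dvd i l True)
      then have "t i \<le> lookup l i - lookup (b + a) i"
        using pos by (rule dvd_imp_le)
      then show False
        using bi t_attained(1) [OF i] by (simp add: lookup_add)
    qed
    then have "lookup l j \<le> lookup (b + a) j" if "j \<in> {1..n}" for j
      using bj [OF that] by (cases "j = i") (auto simp: lookup_add)
    then obtain c where c: "c \<in> M" "b + a = l + c"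
      using mons_diff [OF Lam_M [OF True] Lam_M [OF l]] by blast
    have "?y \<star> single a x = ?z \<star> single c (q ^ cross n b a * x / q ^ cross n l c) + 0"
      using q by (simp add: star_single c)
    then show ?thesis
      using qpolys_single [OF c(1)] Comm.zero by blast
  next
    case False
    have "m * v \<le> lookup (b + a) j" if "j \<in> {1..n}" for j
      using big [OF that] by (simp add: lookup_add)
    then have "single (b + a) (q ^ cross n b a * x) \<in> Comm"
      by (intro noncentral_monomial_in_Comm mons_add b a False)
    then show ?thesis
      by (intro bexI [of _ 0] bexI [of _ "single (b + a) (q ^ cross n b a * x)"]) (simp_all add: star_single)
  qed
  have "\<exists>w\<in>S. \<exists>c\<in>Comm. ?y \<star> u = ?z \<star> w + c" if "u \<in> S" for u
    using that
  proof (induction u rule: S_induct)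
    case zero
    show ?case
      using Comm.zero by (intro bexI [of _ 0]) simp_all
  next
    case (add a x f)
    obtain w c where w: "w \<in> S" "c \<in> Comm" "?y \<star> f = ?z \<star> w + c"
      using add.IH by blast
    obtain w' c' where w': "w' \<in> S" "c' \<in> Comm" "?y \<star> single a x = ?z \<star> w' + c'"
      using mono [OF add.hyps(1)] by blast
    have "?y \<star> (single a x + f) = ?z \<star> (w' + w) + (c' + c)"
      by (simp add: star_add_right w w' ac_simps)
    then show ?case
      using w w' qpolys_add Comm_add by blast
  qed
  then show ?thesis
    using central_single [OF l] qpolys_single [OF b] by (simp add: dual_def single_eq_0_iff)
qed

text \<open>Testing with the dual pairs of monomials from \<open>dual_monomials\<close> bounds the order along each \<open>x_i\<close>
  from below.\<close>

lemma J_dvd: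
  assumes c: "c \<in> J"
  shows "\<exists>w\<in>S. c = single dvec 1 \<star> w"
proof (cases "c = 0")
  case True
  then show ?thesis
    by (intro bexI [of _ 0]) simp_all
next
  case c0: False
  have cS: "c \<in> S"
    using c by (simp add: J_def)
  have "v * (t i - 1) \<le> val i c" if i: "i \<in> {1..n}" for i
  proof -
    define j where "j = (if i = 1 then 2 else 1 :: nat)"
    have j: "j \<in> {1..n}" "j \<noteq> i"
      using n by (auto simp: j_def)
    define l where "l = of_nat m * vec n (\<lambda>_. 2 * v)"
    \<comment> \<open>lowering the \<open>i\<close>th entry is compensated in another one, to keep the degree divisible by \<open>v\<close>;
      entries above \<open>m * v\<close> are needed for \<open>dual_monomials\<close>\<close>
    define b where "b = vec n (\<lambda>k. if k = i then 2 * (m * v) - (t i - 1) else if k = j then 2 * (m * v) + (t i - 1) else 2 * (m * v))"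
    have l: "l \<in> Lam"
      unfolding l_def by (intro Lam_m vec_in_mons dvd_sum) simp
    have ll: "lookup l k = 2 * (m * v)" if "k \<in> {1..n}" for k
      unfolding l_def lookup_of_nat_mult lookup_vec_in [OF that] by simp
    have ti: "t i \<le> m * v"
      by (rule t_le [OF i])
    have b: "b \<in> M"
      unfolding b_def
    proof (rule vec_in_mons)
      let ?f = "\<lambda>k. if k = i then 2 * (m * v) - (t i - 1) else if k = j then 2 * (m * v) + (t i - 1) else 2 * (m * v)"
      have "sum ?f {1..n} + (\<Sum>k\<in>{1..n}. if k = i then t i - 1 else 0) = (\<Sum>k\<in>{1..n}. 2 * (m * v)) + (\<Sum>k\<in>{1..n}. if k = j then t i - 1 else 0)"
        unfolding sum.distrib [symmetric] by (rule sum.cong) (use ti j in auto)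
      then have "sum ?f {1..n} = (\<Sum>k\<in>{1..n}. 2 * (m * v))"
        using i j by simp
      then show "v dvd sum ?f {1..n}"
        by simp
    qed
    have bk: "lookup b k = (if k = i then 2 * (m * v) - (t i - 1) else if k = j then 2 * (m * v) + (t i - 1) else 2 * (m * v))" if "k \<in> {1..n}" for k
      unfolding b_def by (rule lookup_vec_in [OF that])
    have "dual (single b 1) (single l 1)"
      by (rule dual_monomials [OF l b i]) (use i ti in \<open>auto simp: bk ll\<close>)
    then obtain w where w: "w \<in> S" "c \<star> pw (single b 1) v = pw (single l 1) v \<star> w"
      using c by (auto simp: J_def)
    have nz: "pw (single b (1 :: 'k)) v \<noteq> 0" "pw (single l (1 :: 'k)) v \<noteq> 0"
      by (simp_all add: pw_nonzero single_eq_0_iff)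
    have "w \<noteq> 0"
      using val_star(1) [OF q c0 nz(1)] w(2) by auto
    then have "val i c + v * lookup b i = v * lookup l i + val i w"
      using arg_cong [OF w(2), of "val i"] nz c0
      by (simp add: val_star(2) [OF q] val_pw val_single single_eq_0_iff)
    moreover have "lookup l i = lookup b i + (t i - 1)"
      using ti i by (simp add: ll bk)
    ultimately show ?thesis
      by (simp add: distrib_left)
  qed
  then show ?thesis
    by (intro monomial_dvd dvec_M cS) (use val_le order_trans in \<open>fastforce simp: lookup_dvec\<close>)+
qed

section \<open>Automorphisms permute the monomials up to scalars\<close>

abbreviation isos :: "('k qpoly \<Rightarrow> 'k qpoly) set"
  where "isos \<equiv> algebra_isos (twisted_algebra n q v) (twisted_algebra n q v)"

lemma isos_iff:
  "f \<in> isos \<longleftrightarrow> bij_betw f S S \<and> f 1 = 1 \<and> (\<forall>x\<in>S. \<forall>y\<in>S. f (x \<star> y) = f x \<star> f y \<and> f (x + y) = f x + f y) \<and>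
    (\<forall>c. \<forall>x\<in>S. f (single 0 c \<star> x) = single 0 c \<star> f x)"
  by (simp add: algebra_isos_iff twisted_algebra_def)

context
  fixes f
  assumes f: "f \<in> isos"
begin

lemma iso_S: "x \<in> S \<Longrightarrow> f x \<in> S"
  using f by (auto simp: isos_iff bij_betw_apply)

lemma iso_star: "x \<in> S \<Longrightarrow> y \<in> S \<Longrightarrow> f (x \<star> y) = f x \<star> f y"
  and iso_add: "x \<in> S \<Longrightarrow> y \<in> S \<Longrightarrow> f (x + y) = f x + f y"
  and iso_one: "f 1 = 1"
  using f by (auto simp: isos_iff)

lemma iso_zero: "f 0 = 0"
  using iso_add [of 0 0] by (metis add_cancel_right_right add_0 qpolys_zero)

lemma iso_diff: "x \<in> S \<Longrightarrow> y \<in> S \<Longrightarrow> f (x - y) = f x - f y"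
  using iso_add [of "x - y" y] qpolys_add [of x n v "- y"] qpolys_uminus [of y n v] by simp

lemma iso_surj: "x \<in> S \<Longrightarrow> \<exists>y\<in>S. x = f y"
  using f by (auto simp: isos_iff bij_betw_def)

lemma iso_inj: "x \<in> S \<Longrightarrow> y \<in> S \<Longrightarrow> f x = f y \<Longrightarrow> x = y"
  using f by (auto simp: isos_iff bij_betw_def inj_on_def)

lemma iso_single: "a \<in> M \<Longrightarrow> f (single a c) = single 0 c \<star> f (single a 1)"
proof -
  assume a: "a \<in> M"
  have "single a c = single 0 c \<star> single a 1"
    by (simp add: star_single)
  then show ?thesis
    using f qpolys_single [OF a, of "1 :: 'k"] by (simp add: isos_iff)
qed

lemma iso_pw: "x \<in> S \<Longrightarrow> f (pw x k) = pw (f x) k"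
  by (induction k) (simp_all add: iso_one iso_star pw_S)

lemma iso_central: "central z \<Longrightarrow> central (f z)"
  unfolding central_def by (metis iso_S iso_star iso_surj)

lemma iso_Comm: "c \<in> Comm \<Longrightarrow> c \<in> S \<and> f c \<in> Comm"
proof (induction c rule: Comm.induct)
  case zero
  then show ?case
    by (simp add: iso_zero Comm.zero)
next
  case (add y w c)
  have "y \<star> w - w \<star> y \<in> S"
    using add qpolys_add [of "y \<star> w" n v "- (w \<star> y)"] by (simp add: qpolys_star qpolys_uminus)
  then show ?case
    using add by (auto simp: qpolys_add iso_add iso_diff qpolys_star iso_star iso_S intro: Comm.add)
qed

lemma iso_dual:
  assumes yz: "dual y z"
  shows "dual (f y) (f z)"
proof -
  have y: "y \<in> S" and z: "z \<in> S"
    using yz by (simp_all add: dual_def central_def)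
  have "\<exists>w\<in>S. \<exists>c\<in>Comm. f y \<star> u = f z \<star> w + c" if "u \<in> S" for u
  proof -
    obtain u' where u': "u' \<in> S" "u = f u'"
      using iso_surj [OF \<open>u \<in> S\<close>] by blast
    obtain w c where w: "w \<in> S" "c \<in> Comm" "y \<star> u' = z \<star> w + c"
      using yz u'(1) by (auto simp: dual_def)
    have "f y \<star> u = f z \<star> f w + f c"
      using arg_cong [OF w(3), of f] iso_Comm [OF w(2)] y z u' w(1) by (simp add: iso_add iso_star qpolys_star)
    then show ?thesis
      using iso_S [OF w(1)] iso_Comm [OF w(2)] by blast
  qed
  moreover have "f z \<noteq> 0"
    using iso_inj [of z 0] z yz by (auto simp: iso_zero dual_def)
  ultimately show ?thesis
    using yz y by (simp add: dual_def iso_S iso_central)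
qed

end

lemma isos_inv: "f \<in> isos \<Longrightarrow> inv_into S f \<in> isos"
  using algebra_isos_inv [OF _ algebra_closed_twisted_algebra, of f n q v] by (simp add: twisted_algebra_def)

lemma isos_inv_cancel:
  assumes "f \<in> isos" "x \<in> S"
  shows "f (inv_into S f x) = x" "inv_into S f (f x) = x"
  using assms bij_betw_inv_into_right [of f S S x] bij_betw_inv_into_left [of f S S x] by (simp_all add: isos_iff)

text \<open>The definition of \<open>J\<close> refers only to the algebra structure.\<close>

lemma iso_J:
  assumes f: "f \<in> isos" and c: "c \<in> J"
  shows "f c \<in> J"
proof -
  have cS: "c \<in> S"
    using c by (simp add: J_def)
  let ?g = "inv_into S f"
  have g: "?g \<in> isos"
    by (rule isos_inv [OF f])
  have "\<exists>w\<in>S. f c \<star> pw y v = pw z v \<star> w" if yz: "dual y z" for y z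
  proof -
    have y: "y \<in> S" and z: "z \<in> S"
      using yz by (simp_all add: dual_def central_def)
    obtain w where w: "w \<in> S" "c \<star> pw (?g y) v = pw (?g z) v \<star> w"
      using c iso_dual [OF g yz] by (auto simp: J_def)
    have "f c \<star> pw y v = pw z v \<star> f w"
      using arg_cong [OF w(2), of f] cS w(1) iso_S [OF g y] iso_S [OF g z]
      by (simp add: iso_star [OF f] iso_pw [OF f] pw_S isos_inv_cancel [OF f] y z)
    then show ?thesis
      using iso_S [OF f w(1)] by blast
  qed
  then show ?thesis
    using iso_S [OF f cS] by (simp add: J_def)
qed

text \<open>The image of \<open>x^d\<close> divides \<open>x^d\<close>, since the inverse automorphism maps \<open>x^d\<close> into the ideal that
  it generates; and \<open>x^a\<close> divides a power of \<open>x^d\<close>. Factors of monomials are monomials.\<close>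

lemma iso_monomial:
  assumes f: "f \<in> isos" and a: "a \<in> M"
  obtains b x where "b \<in> M" "x \<noteq> 0" "f (single a 1) = single b x"
proof -
  let ?g = "inv_into S f" and ?D = "single dvec (1 :: 'k)"
  have g: "?g \<in> isos"
    by (rule isos_inv [OF f])
  have D: "?D \<in> S"
    by (rule qpolys_single [OF dvec_M])
  obtain w where w: "w \<in> S" "?g ?D = ?D \<star> w"
    using J_dvd [OF iso_J [OF g monomial_dvec_in_J]] by blast
  have "f ?D \<star> f w = single dvec 1"
    using arg_cong [OF w(2), of f] w(1) D by (simp add: isos_inv_cancel [OF f] iso_star [OF f])
  then obtain s x where s: "x \<noteq> 0" "f ?D = single s x"
    using star_eq_single_imp_single [OF q] one_neq_zero by metis
  \<comment> \<open>each entry of \<open>a\<close> is at most the degree, and each entry of \<open>dvec\<close> is positive\<close>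
  define N where "N = tdeg n a"
  obtain b' where b': "b' \<in> M" "of_nat N * dvec = a + b'"
  proof (rule mons_diff [OF mons_of_nat_mult [OF dvec_M] a])
    fix i assume i: "i \<in> {1..n}"
    have "lookup a i \<le> N"
      unfolding N_def tdeg_def using i by (intro member_le_sum) auto
    also have "N \<le> N * lookup dvec i"
      using dvec_pos [OF i] by simp
    finally show "lookup a i \<le> lookup (of_nat N * dvec) i"
      unfolding lookup_of_nat_mult .
  qed
  obtain d where d: "d \<noteq> 0" "pw ?D N = single (of_nat N * dvec) d"
    using pw_single [of 1 dvec N] by auto
  obtain d' where d': "d' \<noteq> 0" "pw (single s x) N = single (of_nat N * s) d'"
    using pw_single [OF s(1)] by blast
  let ?u = "single a (1 :: 'k)" and ?v = "single b' (d / q ^ cross n a b')"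
  have "?u \<star> ?v = pw ?D N"
    using q by (simp add: star_single d b')
  then have "f ?u \<star> f ?v = f (pw ?D N)"
    using a b' by (simp add: qpolys_single flip: iso_star [OF f])
  also have "\<dots> = single (of_nat N * s) d'"
    by (simp add: iso_pw [OF f D] s d')
  finally obtain b y where b: "b \<in> keys (f ?u)" "y \<noteq> 0" "f ?u = single b y"
    using star_eq_single_imp_single [OF q _ d'(1)] by blast
  moreover have "b \<in> M"
    using b(1) iso_S [OF f qpolys_single [OF a]] by (auto simp: qpolys_def)
  ultimately show thesis
    using that by blast
qed


section \<open>Additive bijections of the exponents permute the coordinates\<close>

lemma additive_sum:
  fixes p :: "exponent \<Rightarrow> exponent"
  assumes add: "\<And>a b. a \<in> M \<Longrightarrow> b \<in> M \<Longrightarrow> p (a + b) = p a + p b"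
  shows "p 0 = 0" and "a \<in> M \<Longrightarrow> p (of_nat k * a) = of_nat k * p a"
    and "finite I \<Longrightarrow> (\<And>i. i \<in> I \<Longrightarrow> h i \<in> M) \<Longrightarrow> p (\<Sum>i\<in>I. h i) = (\<Sum>i\<in>I. p (h i)) \<and> (\<Sum>i\<in>I. h i) \<in> M"
proof -
  show 0: "p 0 = 0"
    using add [of 0 0] by (metis add_cancel_right_right add_0 mons_zero)
  show "p (of_nat k * a) = of_nat k * p a" if "a \<in> M"
    using that by (induction k) (simp_all add: 0 distrib_right add mons_of_nat_mult)
  show "p (\<Sum>i\<in>I. h i) = (\<Sum>i\<in>I. p (h i)) \<and> (\<Sum>i\<in>I. h i) \<in> M" if "finite I" "\<And>i. i \<in> I \<Longrightarrow> h i \<in> M"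
    using that by (induction I rule: finite_induct) (simp_all add: 0 add mons_add)
qed

text \<open>On the vectors \<open>e i\<close>, an additive map determines \<open>v\<close> times its value everywhere.\<close>

lemma additive_lookup:
  fixes p :: "exponent \<Rightarrow> exponent"
  assumes add: "\<And>a b. a \<in> M \<Longrightarrow> b \<in> M \<Longrightarrow> p (a + b) = p a + p b" and a: "a \<in> M"
  shows "v * lookup (p a) k = (\<Sum>i\<in>{1..n}. lookup a i * lookup (p (e i)) k)"
proof -
  have E: "of_nat (lookup a i) * e i \<in> M" if "i \<in> {1..n}" for i
    by (intro mons_of_nat_mult e_M that)
  have "of_nat v * a = (\<Sum>i\<in>{1..n}. of_nat (lookup a i) * e i)"
  proof (rule mons_eqI)
    show "of_nat v * a \<in> M" "(\<Sum>i\<in>{1..n}. of_nat (lookup a i) * e i) \<in> M"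
      using a E additive_sum(3) [of "\<lambda>x. x" "{1..n}" "\<lambda>i. of_nat (lookup a i) * e i"]
      by (simp_all add: mons_of_nat_mult del: atLeastAtMost_iff)
    show "lookup (of_nat v * a) j = lookup (\<Sum>i\<in>{1..n}. of_nat (lookup a i) * e i) j"
      if "j \<in> {1..n}" for j
    proof -
      have "(\<Sum>i\<in>{1..n}. lookup a i * (if j = i then v else 0)) = (\<Sum>i\<in>{1..n}. if j = i then v * lookup a j else 0)"
        by (rule sum.cong) auto
      then show ?thesis
        unfolding lookup_sum lookup_of_nat_mult lookup_e using that by simp
    qed
  qed
  then have "of_nat v * p a = (\<Sum>i\<in>{1..n}. of_nat (lookup a i) * p (e i))"
    using additive_sum(2) [OF add a, of v] additive_sum(3) [OF add, of "{1..n}" "\<lambda>i. of_nat (lookup a i) * e i"] E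
      additive_sum(2) [OF add e_M] by (simp cong: sum.cong del: atLeastAtMost_iff)
  from arg_cong [OF this, of "\<lambda>x. lookup x k"] show ?thesis
    by (simp add: lookup_sum lookup_of_nat_mult)
qed

lemma e_inj: "e i = e j \<Longrightarrow> i = j"
  using v lookup_e [of i i] lookup_e [of j i] by (auto split: if_splits)

text \<open>The matrices of the map and of its inverse in terms of the vectors \<open>e i\<close> are non-negative and,
  up to the factor \<open>v * v\<close>, inverse to each other. So they have one non-zero entry in each row.
  This entry is \<open>v\<close>, as both entries involved are divisible by \<open>v\<close>.\<close>

lemma additive_bij_permutes:
  assumes bij: "bij_betw p M M" and add: "\<And>a b. a \<in> M \<Longrightarrow> b \<in> M \<Longrightarrow> p (a + b) = p a + p b"
  obtains \<sigma> where "bij_betw \<sigma> {1..n} {1..n}" "\<And>a i. a \<in> M \<Longrightarrow> i \<in> {1..n} \<Longrightarrow> lookup (p a) (\<sigma> i) = lookup a i"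
proof -
  let ?g = "inv_into M p"
  have gM: "?g a \<in> M" "p (?g a) = a" if "a \<in> M" for a
    using bij that by (simp_all add: bij_betw_def f_inv_into_f inv_into_into)
  have pM: "p a \<in> M" "?g (p a) = a" if "a \<in> M" for a
    using bij that by (auto simp: bij_betw_def)
  have gadd: "?g (a + b) = ?g a + ?g b" if "a \<in> M" "b \<in> M" for a b
    using pM(2) [of "?g a + ?g b"] add [of "?g a" "?g b"] gM that by (simp add: mons_add)
  define P where "P i k = lookup (p (e i)) k" for i k
  define Q where "Q i k = lookup (?g (e i)) k" for i k
  have QP: "(\<Sum>i\<in>{1..n}. Q j i * P i k) = (if k = j then v * v else 0)" if "j \<in> {1..n}" for j k
  proof -
    have "v * (if k = j then v else 0) = (\<Sum>i\<in>{1..n}. Q j i * P i k)"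
      using additive_lookup [of p "?g (e j)" k, OF add gM(1) [OF e_M [OF that]]]
      by (simp only: gM(2) [OF e_M [OF that]] lookup_e P_def Q_def)
    then show ?thesis
      by (cases "k = j") simp_all
  qed
  have PQ: "(\<Sum>i\<in>{1..n}. P j i * Q i k) = (if k = j then v * v else 0)" if "j \<in> {1..n}" for j k
  proof -
    have "v * (if k = j then v else 0) = (\<Sum>i\<in>{1..n}. P j i * Q i k)"
      using additive_lookup [of ?g "p (e j)" k, OF gadd pM(1) [OF e_M [OF that]]]
      by (simp only: pM(2) [OF e_M [OF that]] lookup_e P_def Q_def)
    then show ?thesis
      by (cases "k = j") simp_all
  qed
  have ex: "\<exists>s\<in>{1..n}. p (e j) = e s" if j: "j \<in> {1..n}" for j
  proof -
    have "\<exists>s\<in>{1..n}. P j s * Q s j \<noteq> 0"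
    proof (rule ccontr)
      assume "\<not> ?thesis"
      then have "(\<Sum>i\<in>{1..n}. P j i * Q i j) = 0"
        by (intro sum.neutral) auto
      then have "v * v = 0"
        unfolding PQ [OF j] by simp
      then show False
        using v by simp
    qed
    then obtain s where s: "s \<in> {1..n}" "P j s \<noteq> 0" "Q s j \<noteq> 0"
      by auto
    have Pz: "P j k = 0" if "k \<noteq> s" for k
    proof -
      have "(\<Sum>i\<in>{1..n}. Q s i * P i k) = 0"
        using QP [OF s(1), of k] that by simp
      then have "Q s j * P j k = 0"
        using j by simp
      then show ?thesis
        using s by simp
    qed
    have Qz: "Q s k = 0" if "k \<noteq> j" for k
    proof -
      have "(\<Sum>i\<in>{1..n}. P j i * Q i k) = 0"
        using PQ [OF j, of k] that by simp
      then have "P j s * Q s k = 0"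
        using s(1) by simp
      then show ?thesis
        using s by simp
    qed
    have prod: "P j s * Q s j = v * v"
    proof -
      have "(\<Sum>i\<in>{1..n}. P j i * Q i j) = (\<Sum>i\<in>{1..n}. if i = s then P j s * Q s j else 0)"
        by (rule sum.cong) (auto simp: Pz)
      then show ?thesis
        using PQ [OF j, of j] s(1) by simp
    qed
    have "tdeg n (p (e j)) = (\<Sum>i\<in>{1..n}. if i = s then P j s else 0)"
      unfolding tdeg_def by (rule sum.cong) (auto simp: Pz simp flip: P_def)
    then have "v dvd P j s"
      using mons_dvd [OF pM(1) [OF e_M [OF j]]] s(1) by simp
    moreover have "tdeg n (?g (e s)) = (\<Sum>i\<in>{1..n}. if i = j then Q s j else 0)"
      unfolding tdeg_def by (rule sum.cong) (auto simp: Qz simp flip: Q_def)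
    then have "v dvd Q s j"
      using mons_dvd [OF gM(1) [OF e_M [OF s(1)]]] j by simp
    ultimately obtain x y where xy: "P j s = v * x" "Q s j = v * y"
      by (auto elim!: dvdE)
    then have "(v * v) * (x * y) = v * v"
      using prod by (simp add: ac_simps)
    then have "x * y = 1"
      using v by simp
    then have "P j s = v"
      using xy by simp
    then have "p (e j) = e s"
      by (intro poly_mapping_eqI) (metis P_def Pz lookup_e)
    then show ?thesis
      using s(1) by blast
  qed
  define \<sigma> where "\<sigma> i = (SOME s. s \<in> {1..n} \<and> p (e i) = e s)" for i
  have \<sigma>: "\<sigma> i \<in> {1..n}" "p (e i) = e (\<sigma> i)" if "i \<in> {1..n}" for i
    using someI_ex [of "\<lambda>s. s \<in> {1..n} \<and> p (e i) = e s"] ex [OF that] unfolding \<sigma>_def by blast+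
  have inj: "inj_on \<sigma> {1..n}"
  proof (rule inj_onI)
    fix i j assume *: "i \<in> {1..n}" "j \<in> {1..n}" "\<sigma> i = \<sigma> j"
    then have "p (e i) = p (e j)"
      by (simp only: \<sigma>(2))
    then show "i = j"
      using bij e_M [OF *(1)] e_M [OF *(2)] e_inj by (metis bij_betw_def inj_onD)
  qed
  have "\<sigma> ` {1..n} = {1..n}"
    by (rule endo_inj_surj) (use inj \<sigma>(1) in auto)
  then have b: "bij_betw \<sigma> {1..n} {1..n}"
    using inj by (simp add: bij_betw_def)
  have "lookup (p a) (\<sigma> i) = lookup a i" if a: "a \<in> M" and i: "i \<in> {1..n}" for a i
  proof -
    have "v * lookup (p a) (\<sigma> i) = (\<Sum>j\<in>{1..n}. lookup a j * lookup (p (e j)) (\<sigma> i))"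
      by (rule additive_lookup [OF add a])
    also have "\<dots> = (\<Sum>j\<in>{1..n}. if j = i then lookup a i * v else 0)"
    proof (rule sum.cong [OF refl])
      fix j assume j: "j \<in> {1..n}"
      have "\<sigma> i = \<sigma> j \<longleftrightarrow> j = i"
        using inj_on_eq_iff [OF inj i j] by auto
      then show "lookup a j * lookup (p (e j)) (\<sigma> i) = (if j = i then lookup a i * v else 0)"
        by (simp add: \<sigma>(2) [OF j] lookup_e)
    qed
    also have "\<dots> = v * lookup a i"
      using i by (simp add: mult.commute)
    finally have "v * lookup (p a) (\<sigma> i) = v * lookup a i" .
    then show ?thesis
      using v by (simp only: mult_cancel1) simp
  qed
  with b that show thesis
    by blast
qed

section \<open>Commutation-preserving permutations are rotations\<close>

lemma com_prod_single:
  assumes "x \<in> {1..n}" "y \<in> {1..n}"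
  shows "com (single x 1) (single y 1) = (if y < x then q else if x < y then 1 / q else 1)"
  using assms q by (auto simp: com_def cross_single)

text \<open>Together with \<open>e 1\<close> these vectors generate the group spanned by \<open>M\<close>.\<close>

definition u :: "nat \<Rightarrow> exponent"
  where "u i = single i 1 + single 1 (v - 1)"

lemma u_M: "i \<in> {1..n} \<Longrightarrow> u i \<in> M"
  using n v Poly_Mapping.keys_add [of "single i 1" "single 1 (v - 1)"]
  by (auto simp: u_def mons_def tdeg_add tdeg_single split: if_splits)

lemma single_eq_of_nat_mult: "single (i :: nat) k = of_nat k * single i (1 :: nat)"
  by (rule poly_mapping_eqI) (simp add: lookup_of_nat_mult lookup_single when_def)

text \<open>Let \<open>\<delta> i j\<close> be the change of the commutation factor of \<open>x_i\<close> and \<open>x_j\<close> under \<open>\<sigma>\<close>, which is \<open>q^2\<close>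
  if \<open>\<sigma>\<close> inverts \<open>i < j\<close> and \<open>1\<close> otherwise. Invariance on the monomials in \<open>M\<close> does not give
  \<open>\<delta> i j = 1\<close>, but that \<open>\<delta>\<close> is a coboundary, so \<open>\<delta> i k * \<delta> k j = \<delta> i j\<close>. As \<open>q^2 \<noteq> 1\<close>, inversions
  are additive and \<open>\<sigma>\<close> is a rotation. Comparison with \<open>x_1^v\<close> gives \<open>\<delta> 1 j ^ v = 1\<close>, which is
  \<open>q^(2 v) = 1\<close> for an inverted pair.\<close>

lemma com_preserving_permutation:
  assumes bij: "bij_betw \<sigma> {1..n} {1..n}"
    and p: "\<And>a. a \<in> M \<Longrightarrow> p a \<in> M" "\<And>a i. a \<in> M \<Longrightarrow> i \<in> {1..n} \<Longrightarrow> lookup (p a) (\<sigma> i) = lookup a i"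
    and com: "\<And>a b. a \<in> M \<Longrightarrow> b \<in> M \<Longrightarrow> com (p a) (p b) = com a b"
  shows "\<And>i. i \<in> {1..n} \<Longrightarrow> \<sigma> i = rotn n (\<sigma> 1 - 1) i"
    and "\<sigma> 1 \<noteq> 1 \<Longrightarrow> q ^ v = 1 \<or> q ^ v = - 1"
proof -
  define c where "c i j = com (single i 1) (single j 1)" for i j :: nat
  define \<delta> where "\<delta> i j = c (\<sigma> i) (\<sigma> j) / c i j" for i j
  have one: "1 \<in> {1..n}"
    using n by auto
  have \<sigma>_in: "\<sigma> i \<in> {1..n}" if "i \<in> {1..n}" for i
    using bij that by (rule bij_betw_apply)
  have \<sigma>_eq: "\<sigma> i = \<sigma> j \<longleftrightarrow> i = j" if "i \<in> {1..n}" "j \<in> {1..n}" for i j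
    by (rule inj_on_eq_iff [OF bij_betw_imp_inj_on [OF bij] that])
  have p_eqI: "p a = b" if a: "a \<in> M" and b: "b \<in> M" and eq: "\<And>i. i \<in> {1..n} \<Longrightarrow> lookup b (\<sigma> i) = lookup a i" for a b
  proof (rule mons_eqI [OF p(1) [OF a] b])
    fix j assume "j \<in> {1..n}"
    then have "j \<in> \<sigma> ` {1..n}"
      using bij unfolding bij_betw_def by blast
    then obtain i where "i \<in> {1..n}" "j = \<sigma> i"
      by blast
    then show "lookup (p a) j = lookup b j"
      using p(2) [OF a] eq by metis
  qed
  have pe: "p (e 1) = e (\<sigma> 1)"
  proof (rule p_eqI [OF e_M [OF one] e_M [OF \<sigma>_in [OF one]]])
    show "lookup (e (\<sigma> 1)) (\<sigma> i) = lookup (e 1) i" if "i \<in> {1..n}" for i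
      using \<sigma>_eq [OF that one] by (simp add: lookup_e)
  qed
  have pu: "p (u i) = single (\<sigma> i) 1 + single (\<sigma> 1) (v - 1)" if i: "i \<in> {1..n}" for i
  proof (rule p_eqI [OF u_M [OF i]])
    show "single (\<sigma> i) 1 + single (\<sigma> 1) (v - 1) \<in> M"
      using v \<sigma>_in [OF i] \<sigma>_in [OF one] Poly_Mapping.keys_add [of "single (\<sigma> i) 1" "single (\<sigma> 1) (v - 1)"]
      by (auto simp: mons_def tdeg_add tdeg_single split: if_splits)
    show "lookup (single (\<sigma> i) 1 + single (\<sigma> 1) (v - 1)) (\<sigma> j) = lookup (u i) j"
      if "j \<in> {1..n}" for j
      using \<sigma>_eq [OF i that] \<sigma>_eq [OF one that] by (auto simp: u_def lookup_add lookup_single when_def)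
  qed
  have c_nz: "c i j \<noteq> 0" for i j
    by (simp add: c_def)
  have c_self: "c i i = 1" for i
    by (simp add: c_def)
  have c_swap: "c i j = inverse (c j i)" for i j
    unfolding c_def by (rule com_swap)
  have expand: "com (single x 1 + single z k) (single y 1 + single z k)
      = c x y * c x z ^ k * (c z y ^ k)" for x y z k
    unfolding com_add single_eq_of_nat_mult [of z k] com_of_nat_mult by (simp add: c_def)
  have cocycle: "\<delta> i j * \<delta> i 1 ^ (v - 1) * \<delta> 1 j ^ (v - 1) = 1" if "i \<in> {1..n}" "j \<in> {1..n}" for i j
  proof -
    have "com (p (u i)) (p (u j)) = com (u i) (u j)"
      by (intro com u_M that)
    then have "c (\<sigma> i) (\<sigma> j) * c (\<sigma> i) (\<sigma> 1) ^ (v - 1) * c (\<sigma> 1) (\<sigma> j) ^ (v - 1) = c i j * c i 1 ^ (v - 1) * c 1 j ^ (v - 1)"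
      unfolding pu [OF that(1)] pu [OF that(2)] unfolding u_def expand .
    then show ?thesis
      using c_nz by (simp add: \<delta>_def power_divide)
  qed
  have \<delta>_nz: "\<delta> i j \<noteq> 0" for i j
    by (simp add: \<delta>_def c_nz)
  have \<delta>_swap: "\<delta> i j * \<delta> j i = 1" for i j
    using c_nz c_swap [of "\<sigma> i" "\<sigma> j"] c_swap [of i j] by (simp add: \<delta>_def)
  have add: "\<delta> i k * \<delta> k j = \<delta> i j" if "i \<in> {1..n}" "k \<in> {1..n}" "j \<in> {1..n}" for i k j
  proof -
    let ?x = "\<delta> i 1 ^ (v - 1)" and ?y = "\<delta> 1 j ^ (v - 1)" and ?s = "\<delta> k 1 ^ (v - 1)" and ?t = "\<delta> 1 k ^ (v - 1)"
    have st: "?s * ?t = 1"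
      using \<delta>_swap [of k 1] by (simp flip: power_mult_distrib)
    have "(\<delta> i k * \<delta> k j) * (?x * ?y) = (\<delta> i k * \<delta> k j) * (?x * ?y) * (?s * ?t)"
      by (simp only: st mult_1_right)
    also have "\<dots> = (\<delta> i k * ?x * ?t) * (\<delta> k j * ?s * ?y)"
      by (simp only: ac_simps)
    also have "\<dots> = 1"
      by (simp only: cocycle that mult_1_right)
    also have "\<dots> = \<delta> i j * (?x * ?y)"
      by (simp only: cocycle that mult.assoc [symmetric])
    finally show ?thesis
      using \<delta>_nz by simp
  qed
  have \<delta>_val: "\<delta> i j = (if \<sigma> j < \<sigma> i then q ^ 2 else 1)" if "i \<in> {1..n}" "j \<in> {1..n}" "i < j" for i j
  proof -
    have "\<sigma> i \<noteq> \<sigma> j"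
      using \<sigma>_eq that by auto
    then show ?thesis
      using that(3) com_prod_single [OF that(1,2)] com_prod_single [OF \<sigma>_in [OF that(1)] \<sigma>_in [OF that(2)]] q
      by (auto simp: \<delta>_def c_def power2_eq_square)
  qed
  have q2: "q ^ 2 \<noteq> 1"
    using ord [of 2] m by (auto dest: dvd_imp_le)
  have triple: "(if \<sigma> k < \<sigma> i then q ^ 2 else 1) * (if \<sigma> j < \<sigma> k then q ^ 2 else 1) = (if \<sigma> j < \<sigma> i then q ^ 2 else 1)"
    if "1 \<le> i" "i < k" "k < j" "j \<le> n" for i k j
    using add [of i k j] \<delta>_val [of i k] \<delta>_val [of k j] \<delta>_val [of i j] that by simp
  have q2': "q ^ 2 * q ^ 2 \<noteq> q ^ 2"
    using q q2 by (simp only: mult_cancel_left2 power_eq_0_iff) simp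
  show "\<sigma> i = rotn n (\<sigma> 1 - 1) i" if "i \<in> {1..n}" for i
  proof (rule permutation_is_rotation [OF bij _ _ _ _ that])
    show "1 \<le> n"
      using n by simp
    fix i k j assume *: "1 \<le> i" "i < k" "k < j" "j \<le> n"
    show "\<not> (\<sigma> j < \<sigma> k \<and> \<sigma> k < \<sigma> i)"
      using triple [OF *] q2' by auto
    show "\<sigma> j < \<sigma> i" if "\<sigma> k < \<sigma> i"
      using triple [OF *] q2 q2' that by (auto split: if_splits)
    show "\<sigma> j < \<sigma> i" if "\<sigma> j < \<sigma> k"
      using triple [OF *] q2 q2' that by (auto split: if_splits)
  qed
  show "q ^ v = 1 \<or> q ^ v = - 1" if "\<sigma> 1 \<noteq> 1"
  proof -
    obtain j where j: "j \<in> {1..n}" "\<sigma> j = 1"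
      using bij one by (metis bij_betw_def imageE)
    have "j \<noteq> 1"
      using that j(2) by metis
    then have "1 < j" "\<sigma> j < \<sigma> 1"
      using that \<sigma>_in [OF one] j by simp_all
    then have d: "\<delta> 1 j = q ^ 2"
      using \<delta>_val [OF one j(1)] by simp
    have ev: "e i = of_nat v * single i 1" for i
      unfolding e_def by (rule single_eq_of_nat_mult)
    have "com (p (e 1)) (p (u j)) = com (e 1) (u j)"
      by (intro com e_M u_M one j(1))
    then have "c (\<sigma> 1) (\<sigma> j) ^ v = c 1 j ^ v"
      unfolding pe pu [OF j(1)] unfolding u_def ev com_of_nat_mult com_add(2) single_eq_of_nat_mult [of _ "v - 1"]
      by (simp add: c_def)
    then have "\<delta> 1 j ^ v = 1"
      using c_nz by (simp add: \<delta>_def power_divide)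
    then have "(q ^ v)\<^sup>2 = 1"
      unfolding d by (simp add: mult.commute flip: power_mult)
    then show ?thesis
      by (simp add: power2_eq_1_iff)
  qed
qed


section \<open>Monomial automorphisms\<close>

abbreviation B :: "('k, 'k qpoly) module"
  where "B \<equiv> twisted_algebra n q v"

lemma carrier_B [simp]: "carrier B = S"
  by (simp add: twisted_algebra_def)

lemma autos_iff: "f \<in> algebra_autos B \<longleftrightarrow> f \<in> isos \<and> f \<in> extensional S"
  by (simp add: algebra_autos_eq)

definition mmap :: "(exponent \<Rightarrow> exponent) \<Rightarrow> (exponent \<Rightarrow> 'k) \<Rightarrow> 'k qpoly \<Rightarrow> 'k qpoly"
  where "mmap g x p = (\<Sum>a\<in>keys p. single (g a) (x a * lookup p a))"

lemma mmap_add: "mmap g x (p + r) = mmap g x p + mmap g x r"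
  unfolding mmap_def by (rule setsum_keys_plus_distrib) (simp_all add: single_add [symmetric] algebra_simps)

lemma mmap_zero [simp]: "mmap g x 0 = 0"
  by (simp add: mmap_def)

lemma mmap_single: "mmap g x (single a c) = single (g a) (x a * c)"
  by (cases "c = 0") (simp_all add: mmap_def)

lemma mmap_S: "(\<And>a. a \<in> M \<Longrightarrow> g a \<in> M) \<Longrightarrow> p \<in> S \<Longrightarrow> mmap g x p \<in> S"
  by (erule S_induct) (simp_all add: mmap_add mmap_single qpolys_add qpolys_single)

lemma mmap_mmap:
  assumes "\<And>a. a \<in> M \<Longrightarrow> h (g a) = a" "\<And>a. a \<in> M \<Longrightarrow> y (g a) * x a = 1" and p: "p \<in> S"
  shows "mmap h y (mmap g x p) = p"
  using p
proof (induction p rule: S_induct)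
  case (add a c f)
  have "y (g a) * (x a * c) = c"
    unfolding mult.assoc [symmetric] assms(2) [OF add.hyps(1)] by simp
  then show ?case
    by (simp only: mmap_add mmap_single assms(1) [OF add.hyps(1)] add.IH)
qed simp

text \<open>A monomial map is multiplicative if the scalars make up for the change of the twist.\<close>

lemma mmap_auto:
  assumes bij: "bij_betw g M M" and add: "\<And>a b. a \<in> M \<Longrightarrow> b \<in> M \<Longrightarrow> g (a + b) = g a + g b"
    and nz: "\<And>a. a \<in> M \<Longrightarrow> x a \<noteq> 0"
    and mult: "\<And>a b. a \<in> M \<Longrightarrow> b \<in> M \<Longrightarrow> x (a + b) * q ^ cross n a b = x a * x b * q ^ cross n (g a) (g b)"
  shows "restrict (mmap g x) S \<in> algebra_autos B"
proof -
  let ?F = "mmap g x"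
  have gM: "g a \<in> M" if "a \<in> M" for a
    using bij that by (rule bij_betw_apply)
  have g0: "g 0 = 0"
    by (rule additive_sum(1) [OF add])
  have x0: "x 0 = 1"
    using mult [of 0 0] nz [of 0] by (simp add: g0)
  have star: "?F (p \<star> r) = ?F p \<star> ?F r" if p: "p \<in> S" and r: "r \<in> S" for p r
    using p
  proof (induction p rule: S_induct)
    case (add a c p)
    have "?F (single a c \<star> r) = ?F (single a c) \<star> ?F r"
      using r
    proof (induction r rule: S_induct)
      case (add b d r)
      have "x (a + b) * (q ^ cross n a b * c * d) = (x (a + b) * q ^ cross n a b) * (c * d)"
        by (simp only: mult.assoc)
      also have "\<dots> = q ^ cross n (g a) (g b) * (x a * c) * (x b * d)"
        unfolding mult [OF \<open>a \<in> M\<close> \<open>b \<in> M\<close>] by (simp only: ac_simps)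
      finally have "?F (single a c \<star> single b d) = ?F (single a c) \<star> ?F (single b d)"
        unfolding star_single mmap_single by (simp only: assms(2) [OF \<open>a \<in> M\<close> \<open>b \<in> M\<close>])
      with add show ?case
        by (simp add: star_add_right mmap_add)
    qed simp
    with add show ?case
      by (simp add: star_add_left mmap_add)
  qed simp
  have "?F 1 = 1"
    using mmap_single [of g x 0 1] by (simp add: g0 x0)
  moreover have "?F (single 0 c \<star> p) = single 0 c \<star> ?F p" if "p \<in> S" for c p
    using star [OF qpolys_single [of 0] that] by (simp add: mmap_single g0 x0)
  moreover have "bij_betw ?F S S"
  proof (rule bij_betw_byWitness [where f' = "mmap (inv_into M g) (\<lambda>b. 1 / x (inv_into M g b))"])
    have inv: "inv_into M g (g a) = a" "g (inv_into M g a) = a" "inv_into M g a \<in> M" if "a \<in> M" for a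
      using bij that by (auto simp: bij_betw_def f_inv_into_f inv_into_into)
    show "\<forall>p\<in>S. mmap (inv_into M g) (\<lambda>b. 1 / x (inv_into M g b)) (?F p) = p"
      by (intro ballI mmap_mmap) (simp_all add: inv nz)
    show "\<forall>p\<in>S. ?F (mmap (inv_into M g) (\<lambda>b. 1 / x (inv_into M g b)) p) = p"
      by (intro ballI mmap_mmap) (simp_all add: inv nz)
    show "?F ` S \<subseteq> S" "mmap (inv_into M g) (\<lambda>b. 1 / x (inv_into M g b)) ` S \<subseteq> S"
      using gM inv by (auto intro: mmap_S)
  qed
  ultimately show ?thesis
    using star by (simp add: autos_iff isos_iff mmap_add qpolys_add qpolys_star qpolys_single bij_betw_restrict_eq)
qed

lemma autos_eqI:
  assumes f: "f \<in> algebra_autos B" and g: "g \<in> algebra_autos B"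
    and eq: "\<And>a. a \<in> M \<Longrightarrow> f (single a 1) = g (single a 1)"
  shows "f = g"
proof (rule extensionalityI [of _ S])
  have f': "f \<in> isos" and g': "g \<in> isos"
    using f g by (simp_all add: autos_iff)
  show "f p = g p" if "p \<in> S" for p
    using that
  proof (induction p rule: S_induct)
    case (add a c p)
    then show ?case
      using iso_single [OF f', of a c] iso_single [OF g', of a c] eq
      by (simp add: iso_add [OF f'] iso_add [OF g'] qpolys_single)
  qed (simp add: iso_zero [OF f'] iso_zero [OF g'])
qed (use f g in \<open>simp_all add: autos_iff\<close>)

section \<open>The torus of diagonal automorphisms\<close>

abbreviation T :: "(nat \<Rightarrow> 'k) monoid"
  where "T \<equiv> product_group {1..n} (\<lambda>_. field_units)"

lemma group_T: "group T"
  by (intro product_group group_field_units)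

lemma T_nz: "c \<in> carrier T \<Longrightarrow> i \<in> {1..n} \<Longrightarrow> c i \<noteq> 0"
  by (auto simp: field_units_def PiE_iff)

text \<open>The character of the group spanned by \<open>M\<close> in terms of its values \<open>c 1\<close> on the basis vector
  \<open>v e_1\<close> and \<open>c i\<close> on \<open>e_i - e_1\<close>, where \<open>e_i\<close> are the unit vectors: the exponent vector \<open>a\<close> of
  degree \<open>v s\<close> is \<open>s (v e_1) + (\<Sum>i\<ge>2. a_i (e_i - e_1))\<close>.\<close>

definition chi :: "(nat \<Rightarrow> 'k) \<Rightarrow> exponent \<Rightarrow> 'k"
  where "chi c a = c 1 ^ (tdeg n a div v) * (\<Prod>i\<in>{2..n}. c i ^ lookup a i)"

lemma chi_add: "a \<in> M \<Longrightarrow> b \<in> M \<Longrightarrow> chi c (a + b) = chi c a * chi c b"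
  using mons_dvd [of a n v] mons_dvd [of b n v]
  by (simp add: chi_def tdeg_add lookup_add power_add prod.distrib div_plus_div_distrib_dvd_left ac_simps)

lemma chi_nz: "c \<in> carrier T \<Longrightarrow> chi c a \<noteq> 0"
  using T_nz [of c] n by (simp add: chi_def)

lemma one_in: "1 \<in> {1..n}"
  using n by simp

lemma chi_mult: "chi (c \<otimes>\<^bsub>T\<^esub> d) a = chi c a * chi d a"
proof -
  have *: "(c \<otimes>\<^bsub>T\<^esub> d) i = c i * d i" if "i \<in> {1..n}" for i
    using that by (simp add: field_units_def)
  have "(\<Prod>i\<in>{2..n}. (c \<otimes>\<^bsub>T\<^esub> d) i ^ lookup a i) = (\<Prod>i\<in>{2..n}. c i ^ lookup a i * d i ^ lookup a i)"
  proof (rule prod.cong [OF refl])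
    fix i assume "i \<in> {2..n}"
    then have "i \<in> {1..n}"
      by simp
    then show "(c \<otimes>\<^bsub>T\<^esub> d) i ^ lookup a i = c i ^ lookup a i * d i ^ lookup a i"
      by (simp only: * power_mult_distrib)
  qed
  then show ?thesis
    unfolding chi_def * [OF one_in] by (simp only: power_mult_distrib prod.distrib ac_simps)
qed

lemma chi_e: "chi c (e 1) = c 1"
  using n v by (simp add: chi_def e_def tdeg_single lookup_single when_def)

lemma lookup_u: "lookup (u i) j = (if j = i then 1 else 0) + (if j = 1 then v - 1 else 0)"
  by (simp add: u_def lookup_add lookup_single when_def)

lemma tdeg_u: "i \<in> {1..n} \<Longrightarrow> tdeg n (u i) = v"
  using n v by (simp add: u_def tdeg_add tdeg_single)

lemma chi_u: "i \<in> {2..n} \<Longrightarrow> chi c (u i) = c 1 * c i"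
proof -
  assume i: "i \<in> {2..n}"
  have "(\<Prod>j\<in>{2..n}. c j ^ lookup (u i) j) = (\<Prod>j\<in>{2..n}. if j = i then c i else 1)"
    by (rule prod.cong) (auto simp: lookup_u)
  then show ?thesis
    using i v tdeg_u [of i] by (simp add: chi_def)
qed

definition diag_auto :: "(nat \<Rightarrow> 'k) \<Rightarrow> 'k qpoly \<Rightarrow> 'k qpoly"
  where "diag_auto c = restrict (mmap (\<lambda>a. a) (chi c)) S"

lemma diag_auto_single: "a \<in> M \<Longrightarrow> diag_auto c (single a x) = single a (chi c a * x)"
  by (simp add: diag_auto_def mmap_single qpolys_single)

lemma diag_auto_in_autos: "c \<in> carrier T \<Longrightarrow> diag_auto c \<in> algebra_autos B"
  unfolding diag_auto_def by (rule mmap_auto) (simp_all add: bij_betw_def chi_nz chi_add ac_simps del: carrier_product_group)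

interpretation G: group "algebra_Aut B"
  by (rule group_algebra_Aut [OF algebra_closed_twisted_algebra])

lemma Aut_mult_apply:
  assumes "f \<in> algebra_autos B" "g \<in> algebra_autos B" "p \<in> S"
  shows "(f \<otimes>\<^bsub>algebra_Aut B\<^esub> g) p = f (g p)"
  using assms by (simp add: algebra_Aut_simps compose_def)

lemma diag_auto_hom: "diag_auto \<in> hom T (algebra_Aut B)"
proof (rule homI)
  show "diag_auto c \<in> carrier (algebra_Aut B)" if "c \<in> carrier T" for c
    using diag_auto_in_autos [OF that] by (simp add: algebra_Aut_simps)
  fix c d assume c: "c \<in> carrier T" and d: "d \<in> carrier T"
  have cd: "c \<otimes>\<^bsub>T\<^esub> d \<in> carrier T"
    using group_T c d by (simp only: group.is_monoid monoid.m_closed)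
  show "diag_auto (c \<otimes>\<^bsub>T\<^esub> d) = diag_auto c \<otimes>\<^bsub>algebra_Aut B\<^esub> diag_auto d"
  proof (rule autos_eqI)
    show "diag_auto (c \<otimes>\<^bsub>T\<^esub> d) \<in> algebra_autos B"
      by (rule diag_auto_in_autos [OF cd])
    show "diag_auto c \<otimes>\<^bsub>algebra_Aut B\<^esub> diag_auto d \<in> algebra_autos B"
      using G.m_closed [of "diag_auto c" "diag_auto d"] diag_auto_in_autos [OF c] diag_auto_in_autos [OF d] by (simp add: algebra_Aut_simps(1))
    show "diag_auto (c \<otimes>\<^bsub>T\<^esub> d) (single a 1) = (diag_auto c \<otimes>\<^bsub>algebra_Aut B\<^esub> diag_auto d) (single a 1)"
      if a: "a \<in> M" for a
      using Aut_mult_apply [OF diag_auto_in_autos [OF c] diag_auto_in_autos [OF d] qpolys_single [OF a]]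
      by (simp only: diag_auto_single [OF a] chi_mult mult_1_right)
  qed
qed

lemma diag_auto_inj: "inj_on diag_auto (carrier T)"
proof (rule inj_onI)
  fix c d assume c: "c \<in> carrier T" and d: "d \<in> carrier T" and eq: "diag_auto c = diag_auto d"
  have chi: "chi c a = chi d a" if "a \<in> M" for a
    using diag_auto_single [OF that, of c 1] diag_auto_single [OF that, of d 1] eq by (metis lookup_single_eq mult_1_right)
  have 1: "c 1 = d 1"
    using chi [OF e_M [OF one_in]] by (simp only: chi_e)
  have "c i = d i" if i: "i \<in> {2..n}" for i
  proof -
    have "c 1 * c i = d 1 * d i"
      using chi [OF u_M, of i] i by (simp add: chi_u)
    then show ?thesis
      using T_nz [OF d one_in] unfolding 1 by simp
  qed
  with 1 have "c i = d i" if "i \<in> {1..n}" for i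
    using that by (cases "i = 1") auto
  then show "c = d"
    using c d by (intro PiE_ext [of c "{1..n}" "\<lambda>_. carrier field_units"]) auto
qed

text \<open>The scalars of a diagonal automorphism are multiplicative in the exponent, hence determined by
  the values on \<open>e 1\<close> and on \<open>u i\<close>.\<close>

lemma diagonal_auto_in_torus:
  assumes f: "f \<in> algebra_autos B" and diag: "\<And>a. a \<in> M \<Longrightarrow> \<exists>x. f (single a 1) = single a x"
  shows "f \<in> diag_auto ` carrier T"
proof -
  have f': "f \<in> isos"
    using f by (simp add: autos_iff)
  define x where "x a = lookup (f (single a 1)) a" for a
  have fx: "f (single a c) = single a (c * x a)" if "a \<in> M" for a c
    using iso_single [OF f' that, of c] diag [OF that] by (auto simp: x_def star_single)
  have nz: "x a \<noteq> 0" if "a \<in> M" for a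
    using iso_inj [OF f' qpolys_single [OF that, of 1] qpolys_zero] fx [OF that, of 1] iso_zero [OF f']
    by (auto simp: single_eq_0_iff)
  have add: "x (a + b) = x a * x b" if a: "a \<in> M" and b: "b \<in> M" for a b
  proof -
    have "f (single a 1 \<star> single b 1) = f (single a 1) \<star> f (single b 1)"
      using a b by (simp add: iso_star [OF f'] qpolys_single)
    then have "single (a + b) (q ^ cross n a b * x (a + b)) = single (a + b) (q ^ cross n a b * (x a * x b))"
      by (simp add: star_single fx a b mons_add mult.assoc)
    then have "q ^ cross n a b * x (a + b) = q ^ cross n a b * (x a * x b)"
      by (metis lookup_single_eq)
    then show ?thesis
      using q by simp
  qed
  have x0: "x 0 = 1"
    using add [of 0 0] nz [of 0] by simp
  have pow: "x (of_nat k * a) = x a ^ k" if "a \<in> M" for a k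
    using that by (induction k) (simp_all add: x0 distrib_right add mons_of_nat_mult)
  have sum: "x (\<Sum>i\<in>I. h i) = (\<Prod>i\<in>I. x (h i)) \<and> (\<Sum>i\<in>I. h i) \<in> M" if "finite I" "\<And>i. i \<in> I \<Longrightarrow> h i \<in> M" for I :: "nat set" and h
    using that by (induction I rule: finite_induct) (simp_all add: x0 add mons_add)
  define c where "c = (\<lambda>i\<in>{1..n}. if i = 1 then x (e 1) else x (u i) / x (e 1))"
  have xe: "x (e 1) \<noteq> 0"
    by (rule nz [OF e_M [OF one_in]])
  have c: "c \<in> carrier T"
    using xe nz [OF u_M] by (auto simp: c_def field_units_def simp del: One_nat_def)
  have c1: "c 1 = x (e 1)"
    using one_in by (simp add: c_def)
  have "chi c a = x a" if a: "a \<in> M" for a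
  proof -
    let ?s = "tdeg n a div v" and ?r = "\<Sum>i\<in>{2..n}. lookup a i"
    have uM: "of_nat (lookup a i) * u i \<in> M" if "i \<in> {2..n}" for i
      using that by (intro mons_of_nat_mult u_M) auto
    have sM: "(\<Sum>i\<in>{2..n}. of_nat (lookup a i) * u i) \<in> M"
      using sum [of "{2..n}" "\<lambda>i. of_nat (lookup a i) * u i"] uM by blast
    have eM: "of_nat k * e 1 \<in> M" for k
      by (intro mons_of_nat_mult e_M one_in)
    have sv: "?s * v = lookup a 1 + ?r"
    proof -
      have "?s * v = tdeg n a"
        using mons_dvd [OF a] by simp
      also have "\<dots> = lookup a 1 + ?r"
        using n by (simp add: tdeg_def sum.atLeast_Suc_atMost numeral_2_eq_2)
      finally show ?thesis .
    qed
    \<comment> \<open>the expansion of \<open>a\<close> in the basis, with the negative coefficients of \<open>e 1\<close> moved to the left\<close>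
    have "a + of_nat ?r * e 1 = (\<Sum>i\<in>{2..n}. of_nat (lookup a i) * u i) + of_nat ?s * e 1"
    proof (rule mons_eqI [OF mons_add [OF a eM] mons_add [OF sM eM]])
      fix j assume j: "j \<in> {1..n}"
      show "lookup (a + of_nat ?r * e 1) j = lookup ((\<Sum>i\<in>{2..n}. of_nat (lookup a i) * u i) + of_nat ?s * e 1) j"
      proof (cases "j = 1")
        case True
        have "(\<Sum>i\<in>{2..n}. lookup a i * lookup (u i) 1) = (\<Sum>i\<in>{2..n}. lookup a i * (v - 1))"
          by (rule sum.cong) (auto simp: lookup_u)
        also have "\<dots> = ?r * (v - 1)"
          by (simp add: sum_distrib_right)
        finally have "lookup ((\<Sum>i\<in>{2..n}. of_nat (lookup a i) * u i) + of_nat ?s * e 1) 1 = ?r * (v - 1) + ?s * v"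
          by (simp only: lookup_add lookup_sum lookup_of_nat_mult lookup_e if_True refl)
        also have "\<dots> = lookup a 1 + (?r * (v - 1) + ?r)"
          unfolding sv by simp
        also have "?r * (v - 1) + ?r = ?r * v"
          using v by (cases v) simp_all
        finally show ?thesis
          unfolding True by (simp only: lookup_add lookup_of_nat_mult lookup_e if_True refl)
      next
        case False
        have "(\<Sum>i\<in>{2..n}. lookup a i * lookup (u i) j) = (\<Sum>i\<in>{2..n}. if i = j then lookup a j else 0)"
          by (rule sum.cong) (use False in \<open>auto simp: lookup_u\<close>)
        also have "\<dots> = lookup a j"
          using j False by simp
        finally show ?thesis
          using False by (simp only: lookup_add lookup_sum lookup_of_nat_mult lookup_e if_False mult_0_right add_0_right)
      qed
    qed
    then have "x (a + of_nat ?r * e 1) = x ((\<Sum>i\<in>{2..n}. of_nat (lookup a i) * u i) + of_nat ?s * e 1)"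
      by (rule arg_cong)
    then have "x a * x (e 1) ^ ?r = x (\<Sum>i\<in>{2..n}. of_nat (lookup a i) * u i) * x (e 1) ^ ?s"
      unfolding add [OF a eM] add [OF sM eM] pow [OF e_M [OF one_in]] .
    also have "x (\<Sum>i\<in>{2..n}. of_nat (lookup a i) * u i) = (\<Prod>i\<in>{2..n}. x (of_nat (lookup a i) * u i))"
      using sum [of "{2..n}" "\<lambda>i. of_nat (lookup a i) * u i"] uM by blast
    also have "\<dots> = (\<Prod>i\<in>{2..n}. c i ^ lookup a i * x (e 1) ^ lookup a i)"
    proof (rule prod.cong [OF refl])
      fix i assume i: "i \<in> {2..n}"
      then have "x (u i) = c i * x (e 1)"
        using xe by (auto simp: c_def)
      moreover have "u i \<in> M"
        using i by (intro u_M) auto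
      ultimately show "x (of_nat (lookup a i) * u i) = c i ^ lookup a i * x (e 1) ^ lookup a i"
        by (simp only: pow power_mult_distrib)
    qed
    also have "\<dots> = (\<Prod>i\<in>{2..n}. c i ^ lookup a i) * x (e 1) ^ ?r"
      by (simp only: prod.distrib power_sum)
    finally have "x a * x (e 1) ^ ?r = chi c a * x (e 1) ^ ?r"
      unfolding chi_def c1 by (simp only: ac_simps)
    then show ?thesis
      using xe by simp
  qed
  then have "f = diag_auto c"
    by (intro autos_eqI f diag_auto_in_autos c) (simp add: diag_auto_single fx)
  then show ?thesis
    using c by blast
qed

section \<open>Rotations\<close>

definition rot :: "exponent \<Rightarrow> exponent"
  where "rot a = vec n (\<lambda>i. if i = 1 then lookup a n else lookup a (i - 1))"

lemma rot_add: "rot (a + b) = rot a + rot b"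
  by (rule poly_mapping_eqI) (simp add: rot_def lookup_add lookup_vec)

lemma rot_zero [simp]: "rot 0 = 0"
  by (rule poly_mapping_eqI) (simp add: rot_def lookup_vec)

lemma lookup_rot: "i \<in> {1..n} \<Longrightarrow> lookup (rot a) (rotn n 1 i) = lookup a i"
  by (cases "i = n") (auto simp: rot_def lookup_vec rotn_def)

lemma rot_single: "i \<in> {1..n} \<Longrightarrow> rot (single i k) = single (rotn n 1 i) k"
  using n by (intro poly_mapping_eqI) (auto simp: rot_def lookup_vec rotn_def lookup_single when_def)

lemma rotn_in: "i \<in> {1..n} \<Longrightarrow> k \<le> n \<Longrightarrow> rotn n k i \<in> {1..n}"
  by (auto simp: rotn_def)

lemma tdeg_rot: "keys a \<subseteq> {1..n} \<Longrightarrow> tdeg n (rot a) = tdeg n a"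
  by (induction a rule: keys_subset_induct)
    (use n in \<open>simp_all add: rot_add tdeg_add rot_single tdeg_single rotn_in del: atLeastAtMost_iff One_nat_def\<close>)

lemma keys_rot: "keys (rot a) \<subseteq> {1..n}"
  by (auto simp: rot_def in_keys_iff lookup_vec split: if_splits)

lemma rot_M: "a \<in> M \<Longrightarrow> rot a \<in> M"
  using keys_rot [of a] tdeg_rot [of a] by (simp add: mons_def)

text \<open>Only the pairs with the index \<open>n\<close> change their order under the rotation.\<close>

lemma cross_rot:
  assumes a: "keys a \<subseteq> {1..n}" and b: "keys b \<subseteq> {1..n}"
  shows "cross n (rot a) (rot b) + lookup a n * tdeg n b = cross n a b + lookup b n * tdeg n a"
  using a
proof (induction a rule: keys_subset_induct)
  case (add i k a)
  have "cross n (rot (single i k)) (rot b) + lookup (single i k) n * tdeg n b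
      = cross n (single i k) b + lookup b n * tdeg n (single i k)"
    using b
  proof (induction b rule: keys_subset_induct)
    case (add j l b)
    have "cross n (rot (single i k)) (rot (single j l)) + lookup (single i k) n * tdeg n (single j l)
      = cross n (single i k) (single j l) + lookup (single j l) n * tdeg n (single i k)"
      using \<open>i \<in> {1..n}\<close> \<open>j \<in> {1..n}\<close> n rotn_in [of i 1] rotn_in [of j 1]
      by (auto simp: rot_single cross_single tdeg_single lookup_single when_def rotn_def)
    with add show ?case
      by (simp add: rot_add cross_add_right tdeg_add lookup_add algebra_simps)
  qed simp
  with add show ?case
    by (simp add: rot_add cross_add_left tdeg_add lookup_add algebra_simps)
qed simp

lemma rot_pow_M: "a \<in> M \<Longrightarrow> (rot ^^ k) a \<in> M"
  by (induction k) (simp_all add: rot_M)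

lemma lookup_rot_pow:
  assumes i: "i \<in> {1..n}" and k: "k \<le> n"
  shows "lookup ((rot ^^ k) a) (rotn n k i) = lookup a i"
  using k
proof (induction k)
  case 0
  then show ?case
    using i by (simp add: rotn_def)
next
  case (Suc k)
  have "rotn n (Suc k) i = rotn n 1 (rotn n k i)"
    using i Suc.prems by (auto simp: rotn_def)
  then show ?case
    using Suc lookup_rot [OF rotn_in [OF i, of k]] by simp
qed

lemma mons_eq_rot_pow:
  assumes a: "a \<in> M" and b: "b \<in> M" and r: "r \<le> n"
    and eq: "\<And>i. i \<in> {1..n} \<Longrightarrow> lookup b (rotn n r i) = lookup a i"
  shows "b = (rot ^^ r) a"
proof (rule mons_eqI [OF b rot_pow_M [OF a]])
  fix j assume j: "j \<in> {1..n}"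
  \<comment> \<open>the index that the rotation by \<open>r\<close> moves to \<open>j\<close>\<close>
  define i where "i = (if r < j then j - r else j + n - r)"
  have "i \<in> {1..n}" "j = rotn n r i"
    using j r by (auto simp: i_def rotn_def)
  then show "lookup b j = lookup ((rot ^^ r) a) j"
    using eq lookup_rot_pow [OF _ r] by simp
qed

lemma rot_pow_n: "a \<in> M \<Longrightarrow> (rot ^^ n) a = a"
  by (rule mons_eq_rot_pow [symmetric]) (auto simp: rotn_def)

lemma rot_bij: "bij_betw rot M M"
proof (rule bij_betw_byWitness [where f' = "rot ^^ (n - 1)"])
  have "(rot ^^ (n - 1)) (rot a) = (rot ^^ n) a" "rot ((rot ^^ (n - 1)) a) = (rot ^^ n) a" for a
    using n funpow_Suc_right [of "n - 1" rot] funpow.simps(2) [of "n - 1" rot] by (simp_all add: fun_eq_iff)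
  then show "\<forall>a\<in>M. (rot ^^ (n - 1)) (rot a) = a" "\<forall>a\<in>M. rot ((rot ^^ (n - 1)) a) = a"
    by (simp_all add: rot_pow_n)
qed (auto simp: rot_M rot_pow_M)

text \<open>Up to scalars, the action on the monomials is an additive bijection of \<open>M\<close>. Commutation factors
  are determined by the products of monomials, so it preserves them.\<close>

lemma auto_is_rotation:
  assumes f: "f \<in> algebra_autos B"
  obtains r where "r < n" "r \<noteq> 0 \<Longrightarrow> q ^ v = 1 \<or> q ^ v = - 1"
    "\<And>a. a \<in> M \<Longrightarrow> \<exists>x. f (single a 1) = single ((rot ^^ r) a) x"
proof -
  have f': "f \<in> isos"
    using f by (simp add: autos_iff)
  have "\<exists>b x. b \<in> M \<and> x \<noteq> 0 \<and> f (single a 1) = single b x" if "a \<in> M" for a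
    using iso_monomial [OF f' that] by metis
  then obtain p x where pM: "\<And>a. a \<in> M \<Longrightarrow> p a \<in> M" and x: "\<And>a. a \<in> M \<Longrightarrow> x a \<noteq> 0"
    and fp: "\<And>a. a \<in> M \<Longrightarrow> f (single a 1) = single (p a) (x a)"
    by metis
  have fpc: "f (single a c) = single (p a) (c * x a)" if "a \<in> M" for a c
    using iso_single [OF f' that, of c] by (simp add: fp that star_single)
  have single_eq: "a = b \<and> c = d" if "single a c = single b d" "c \<noteq> 0" for a b :: "exponent" and c d :: 'k
    using that by (metis lookup_single_eq lookup_single_not_eq)
  have mult: "p (a + b) = p a + p b \<and> q ^ cross n a b * x (a + b) = q ^ cross n (p a) (p b) * x a * x b" if a: "a \<in> M" and b: "b \<in> M" for a b
  proof -
    have "f (single a 1 \<star> single b 1) = f (single a 1) \<star> f (single b 1)"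
      using a b by (simp add: iso_star [OF f'] qpolys_single)
    then have "single (p (a + b)) (q ^ cross n a b * x (a + b)) = single (p a + p b) (q ^ cross n (p a) (p b) * x a * x b)"
      by (simp add: star_single fpc a b mons_add)
    then show ?thesis
      by (rule single_eq) (use q x [OF mons_add [OF a b]] in simp)
  qed
  have com: "com (p a) (p b) = com a b" if a: "a \<in> M" and b: "b \<in> M" for a b
  proof -
    have "q ^ cross n a b * x (a + b) * (q ^ cross n (p b) (p a) * x b * x a) = q ^ cross n b a * x (b + a) * (q ^ cross n (p a) (p b) * x a * x b)"
      using mult [OF a b] mult [OF b a] by simp
    then have "q ^ cross n a b * q ^ cross n (p b) (p a) * (x (a + b) * x a * x b) = q ^ cross n b a * q ^ cross n (p a) (p b) * (x (a + b) * x a * x b)"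
      by (simp only: ac_simps)
    then have "q ^ cross n a b * q ^ cross n (p b) (p a) = q ^ cross n b a * q ^ cross n (p a) (p b)"
      using x [OF a] x [OF b] x [OF mons_add [OF a b]] by simp
    then show ?thesis
      using q by (simp add: com_def frac_eq_eq mult.commute)
  qed
  have inj: "a = b" if a: "a \<in> M" and b: "b \<in> M" and eq: "p a = p b" for a b
  proof -
    have "f (single a (1 / x a)) = f (single b (1 / x b))"
      using x a b eq by (simp add: fpc)
    then have "single a (1 / x a) = single b (1 / x b)"
      by (rule iso_inj [OF f' qpolys_single [OF a] qpolys_single [OF b]])
    from single_eq [OF this] show ?thesis
      using x [OF a] by simp
  qed
  have surj: "\<exists>a\<in>M. p a = b" if b: "b \<in> M" for b
  proof -
    obtain a y where a: "a \<in> M" "y \<noteq> 0" "inv_into S f (single b 1) = single a y"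
      using iso_monomial [OF isos_inv [OF f'] b] by metis
    then have "single b 1 = single (p a) (y * x a)"
      using isos_inv_cancel(1) [OF f' qpolys_single [OF b, of 1]] by (simp add: fpc)
    from single_eq [OF this one_neq_zero] have "p a = b"
      by simp
    then show ?thesis
      using a by blast
  qed
  have "p ` M = M"
  proof
    show "p ` M \<subseteq> M"
      using pM by blast
    show "M \<subseteq> p ` M"
      using surj by blast
  qed
  then have bij: "bij_betw p M M"
    using inj unfolding bij_betw_def inj_on_def by blast
  obtain \<sigma> where \<sigma>: "bij_betw \<sigma> {1..n} {1..n}" "\<And>a i. a \<in> M \<Longrightarrow> i \<in> {1..n} \<Longrightarrow> lookup (p a) (\<sigma> i) = lookup a i"
    using additive_bij_permutes [OF bij] mult by blast
  note perm = com_preserving_permutation [OF \<sigma>(1) pM \<sigma>(2) com]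
  have \<sigma>1: "1 \<le> \<sigma> 1" "\<sigma> 1 \<le> n"
    using bij_betw_apply [OF \<sigma>(1) one_in] by simp_all
  show thesis
  proof (rule that [of "\<sigma> 1 - 1"])
    show "\<sigma> 1 - 1 < n"
      using \<sigma>1 by simp
    show "q ^ v = 1 \<or> q ^ v = - 1" if "\<sigma> 1 - 1 \<noteq> 0"
    proof -
      have "\<sigma> 1 \<noteq> 1"
        using that by simp
      with perm(2) show ?thesis
        by blast
    qed
    show "\<exists>x. f (single a 1) = single ((rot ^^ (\<sigma> 1 - 1)) a) x" if a: "a \<in> M" for a
    proof -
      have "p a = (rot ^^ (\<sigma> 1 - 1)) a"
      proof (rule mons_eq_rot_pow [OF a pM [OF a]])
        show "\<sigma> 1 - 1 \<le> n"
          using \<sigma>1 by simp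
        show "lookup (p a) (rotn n (\<sigma> 1 - 1) i) = lookup a i" if i: "i \<in> {1..n}" for i
        proof -
          have "\<sigma> i = rotn n (\<sigma> 1 - 1) i"
            using perm(1) i by blast
          then show ?thesis
            using \<sigma>(2) [OF a i] by simp
        qed
      qed
      then show ?thesis
        using fp [OF a] by auto
    qed
  qed
qed

text \<open>No rotation is available, so all automorphisms are diagonal.\<close>

lemma Aut_torus:
  assumes "q ^ v \<noteq> 1" "q ^ v \<noteq> - 1"
  shows "algebra_Aut B \<cong> T"
proof -
  have "f \<in> diag_auto ` carrier T" if f: "f \<in> algebra_autos B" for f
  proof (rule auto_is_rotation [OF f])
    fix r assume r: "r < n" "r \<noteq> 0 \<Longrightarrow> q ^ v = 1 \<or> q ^ v = - 1"
      "\<And>a. a \<in> M \<Longrightarrow> \<exists>x. f (single a 1) = single ((rot ^^ r) a) x"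
    have "r = 0"
      using r(2) assms by blast
    then show "f \<in> diag_auto ` carrier T"
      using r(3) by (intro diagonal_auto_in_torus [OF f]) simp
  qed
  moreover have "diag_auto ` carrier T \<subseteq> algebra_autos B"
    using diag_auto_in_autos by blast
  ultimately have "bij_betw diag_auto (carrier T) (carrier (algebra_Aut B))"
    using diag_auto_inj by (auto simp: bij_betw_def algebra_Aut_simps(1) simp del: carrier_product_group)
  then have "T \<cong> algebra_Aut B"
    using diag_auto_hom by (intro is_isoI isoI)
  then show ?thesis
    by (rule group.iso_sym [OF group_T])
qed

text \<open>With \<open>\<epsilon> = q^v\<close> and \<open>s = |a| / v\<close>, the twist changes under the rotation by \<open>\<epsilon>\<close> to the power
  \<open>b_n s + a_n s'\<close>, the polar form of \<open>a_n s\<close>. So \<open>x^a \<mapsto> \<epsilon>^(a_n s) x^(rot a)\<close> is an automorphism;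
  its \<open>n\<close>th power multiplies \<open>x^a\<close> by \<open>\<epsilon>^(v s s)\<close>. The additional term in the exponent
  \<open>a_n (s + v)\<close> is the character \<open>\<epsilon>^(a_n v)\<close> and changes this to \<open>\<epsilon>^(v s (s + v))\<close>, which is \<open>1\<close>
  because \<open>v s (s + v)\<close> is even.\<close>

lemma Aut_semidirect:
  assumes eps: "q ^ v = 1 \<or> q ^ v = - 1"
  shows "\<exists>\<theta>\<in>hom (integer_mod_group n) (AutoGroup T). algebra_Aut B \<cong> semidirect_product (integer_mod_group n) T \<theta>"
proof -
  let ?G = "algebra_Aut B"
  define \<epsilon> where "\<epsilon> = q ^ v"
  have \<epsilon>2: "\<epsilon> * \<epsilon> = 1"
    using eps by (auto simp: \<epsilon>_def)
  have \<epsilon>_nz: "\<epsilon> \<noteq> 0"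
    using q by (simp add: \<epsilon>_def)
  define x where "x a = \<epsilon> ^ (lookup a n * (tdeg n a div v + v))" for a
  define \<tau> where "\<tau> = restrict (mmap rot x) S"
  have \<tau>: "\<tau> \<in> algebra_autos B"
    unfolding \<tau>_def
  proof (rule mmap_auto [OF rot_bij rot_add])
    show "x a \<noteq> 0" for a
      using \<epsilon>_nz by (simp add: x_def)
    fix a b assume a: "a \<in> M" and b: "b \<in> M"
    let ?s = "tdeg n a div v" and ?t = "tdeg n b div v" and ?a = "lookup a n" and ?b = "lookup b n"
    have s: "tdeg n a = v * ?s" "tdeg n b = v * ?t"
      using mons_dvd [OF a] mons_dvd [OF b] by simp_all
    have st: "tdeg n (a + b) div v = ?s + ?t"
      using mons_dvd [OF a] mons_dvd [OF b] by (simp add: tdeg_add div_plus_div_distrib_dvd_left)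
    have sq: "\<epsilon> ^ k * \<epsilon> ^ k = 1" for k
      by (simp add: \<epsilon>2 flip: power_mult_distrib)
    have "q ^ (cross n (rot a) (rot b) + ?a * tdeg n b) = q ^ (cross n a b + ?b * tdeg n a)"
      using cross_rot [of a b] a b by (simp add: mons_def)
    then have "q ^ cross n (rot a) (rot b) * \<epsilon> ^ (?a * ?t) = q ^ cross n a b * \<epsilon> ^ (?b * ?s)"
      unfolding \<epsilon>_def power_mult [symmetric] power_add [symmetric] using s by (metis mult.assoc mult.commute)
    then have "q ^ cross n (rot a) (rot b) * \<epsilon> ^ (?a * ?t) * \<epsilon> ^ (?a * ?t) = q ^ cross n a b * \<epsilon> ^ (?b * ?s) * \<epsilon> ^ (?a * ?t)"
      by simp
    then have cr: "q ^ cross n (rot a) (rot b) = q ^ cross n a b * \<epsilon> ^ (?b * ?s) * \<epsilon> ^ (?a * ?t)"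
      by (simp add: mult.assoc sq)
    have "(?a + ?b) * (?s + ?t + v) = ?a * (?s + v) + ?b * (?t + v) + ?b * ?s + ?a * ?t"
      by (simp add: algebra_simps)
    then show "x (a + b) * q ^ cross n a b = x a * x b * q ^ cross n (rot a) (rot b)"
      unfolding x_def cr st lookup_add by (simp add: power_add ac_simps)
  qed
  have \<tau>G: "\<tau> \<in> carrier ?G"
    using \<tau> by (simp add: algebra_Aut_simps(1))
  have pow_auto: "\<tau> [^]\<^bsub>?G\<^esub> k \<in> algebra_autos B" for k :: nat
    using G.nat_pow_closed [OF \<tau>G, of k] by (simp add: algebra_Aut_simps(1))
  have pow: "(\<tau> [^]\<^bsub>?G\<^esub> k) (single a c) = single ((rot ^^ k) a) ((\<Prod>j<k. x ((rot ^^ j) a)) * c)"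
    if "a \<in> M" for k :: nat and a c
    using that
  proof (induction k arbitrary: a c)
    case 0
    then show ?case
      by (simp add: algebra_Aut_simps qpolys_single)
  next
    case (Suc k)
    have "(\<tau> [^]\<^bsub>?G\<^esub> Suc k) (single a c) = (\<tau> [^]\<^bsub>?G\<^esub> k) (\<tau> (single a c))"
      using Aut_mult_apply [OF pow_auto \<tau> qpolys_single [OF Suc.prems]] by simp
    also have "\<tau> (single a c) = single (rot a) (x a * c)"
      using Suc.prems by (simp add: \<tau>_def mmap_single qpolys_single)
    also have "(\<tau> [^]\<^bsub>?G\<^esub> k) \<dots> = single ((rot ^^ k) (rot a)) ((\<Prod>j<k. x ((rot ^^ j) (rot a))) * (x a * c))"
      by (rule Suc.IH [OF rot_M [OF Suc.prems]])
    also have "\<dots> = single ((rot ^^ Suc k) a) ((\<Prod>j<Suc k. x ((rot ^^ j) a)) * c)"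
      by (simp add: prod.lessThan_Suc_shift funpow_swap1 ac_simps del: prod.lessThan_Suc)
    finally show ?case .
  qed
  have \<tau>n: "\<tau> [^]\<^bsub>?G\<^esub> n = \<one>\<^bsub>?G\<^esub>"
  proof (rule autos_eqI)
    show "\<tau> [^]\<^bsub>?G\<^esub> n \<in> algebra_autos B" "\<one>\<^bsub>?G\<^esub> \<in> algebra_autos B"
      using pow_auto G.one_closed by (simp_all add: algebra_Aut_simps(1))
    fix a assume a: "a \<in> M"
    let ?s = "tdeg n a div v"
    have deg: "tdeg n ((rot ^^ j) a) = tdeg n a" for j
    proof (induction j)
      case (Suc j)
      then show ?case
        using tdeg_rot [of "(rot ^^ j) a"] rot_pow_M [OF a, of j] by (simp add: mons_def)
    qed simp
    have "(\<Prod>j<n. x ((rot ^^ j) a)) = (\<Prod>j<n. \<epsilon> ^ (lookup a (n - j) * (?s + v)))"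
    proof (rule prod.cong [OF refl])
      fix j assume "j \<in> {..<n}"
      then have "lookup ((rot ^^ j) a) n = lookup a (n - j)"
        using lookup_rot_pow [of "n - j" j a] by (simp add: rotn_def)
      then show "x ((rot ^^ j) a) = \<epsilon> ^ (lookup a (n - j) * (?s + v))"
        by (simp add: x_def deg)
    qed
    also have "\<dots> = \<epsilon> ^ ((\<Sum>j<n. lookup a (n - j)) * (?s + v))"
      by (simp only: power_sum [symmetric] sum_distrib_right)
    also have "(\<Sum>j<n. lookup a (n - j)) = tdeg n a"
      unfolding tdeg_def by (rule sum.reindex_bij_witness [of _ "\<lambda>i. n - i" "\<lambda>j. n - j"]) auto
    also have "tdeg n a * (?s + v) = v * ?s * (?s + v)"
      using mons_dvd [OF a] by simp
    also have "\<epsilon> ^ (v * ?s * (?s + v)) = 1"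
    proof -
      have "even (v * ?s * (?s + v))"
        by auto
      then obtain k where "v * ?s * (?s + v) = 2 * k"
        by (rule evenE)
      then show ?thesis
        by (simp only: power_mult power2_eq_square \<epsilon>2 power_one)
    qed
    finally show "(\<tau> [^]\<^bsub>?G\<^esub> n) (single a 1) = \<one>\<^bsub>?G\<^esub> (single a 1)"
      using a by (simp add: pow rot_pow_n algebra_Aut_simps qpolys_single)
  qed
  have mult_auto: "f \<otimes>\<^bsub>?G\<^esub> g \<in> algebra_autos B" if "f \<in> algebra_autos B" "g \<in> algebra_autos B" for f g
    using G.m_closed [of f g] that by (simp add: algebra_Aut_simps(1))
  have n0: "0 < n"
    using n by simp
  show ?thesis
  proof (rule G.cyclic_semidirect_product [OF group_T diag_auto_hom diag_auto_inj \<tau>G n0 \<tau>n])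
    fix h c assume h: "h < n" and c: "c \<in> carrier T"
    show "\<tau> [^]\<^bsub>?G\<^esub> h \<otimes>\<^bsub>?G\<^esub> diag_auto c \<otimes>\<^bsub>?G\<^esub> \<tau> [^]\<^bsub>?G\<^esub> (n - h) \<in> diag_auto ` carrier T"
    proof (rule diagonal_auto_in_torus)
      have hc: "\<tau> [^]\<^bsub>?G\<^esub> h \<otimes>\<^bsub>?G\<^esub> diag_auto c \<in> algebra_autos B"
        by (intro mult_auto pow_auto diag_auto_in_autos c)
      show "\<tau> [^]\<^bsub>?G\<^esub> h \<otimes>\<^bsub>?G\<^esub> diag_auto c \<otimes>\<^bsub>?G\<^esub> \<tau> [^]\<^bsub>?G\<^esub> (n - h) \<in> algebra_autos B"
        by (rule mult_auto [OF hc pow_auto])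
      fix a assume a: "a \<in> M"
      have b: "(rot ^^ (n - h)) a \<in> M"
        by (rule rot_pow_M [OF a])
      have "(rot ^^ h) ((rot ^^ (n - h)) a) = (rot ^^ n) a"
        using h funpow_add [of h "n - h" rot] by simp
      then have rot_back: "(rot ^^ h) ((rot ^^ (n - h)) a) = a"
        by (simp only: rot_pow_n [OF a])
      show "\<exists>y. (\<tau> [^]\<^bsub>?G\<^esub> h \<otimes>\<^bsub>?G\<^esub> diag_auto c \<otimes>\<^bsub>?G\<^esub> \<tau> [^]\<^bsub>?G\<^esub> (n - h)) (single a 1) = single a y"
        unfolding Aut_mult_apply [OF hc pow_auto qpolys_single [OF a]] pow [OF a]
          Aut_mult_apply [OF pow_auto diag_auto_in_autos [OF c] qpolys_single [OF b]] diag_auto_single [OF b] pow [OF b] rot_back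
        by blast
    qed
  next
    fix f assume "f \<in> carrier ?G"
    then have f: "f \<in> algebra_autos B"
      by (simp add: algebra_Aut_simps(1))
    obtain r where r: "r < n" and fr: "\<And>a. a \<in> M \<Longrightarrow> \<exists>y. f (single a 1) = single ((rot ^^ r) a) y"
      using auto_is_rotation [OF f] by metis
    let ?g = "f \<otimes>\<^bsub>?G\<^esub> \<tau> [^]\<^bsub>?G\<^esub> (n - r)"
    have "?g \<in> diag_auto ` carrier T"
    proof (rule diagonal_auto_in_torus)
      show "?g \<in> algebra_autos B"
        by (intro mult_auto pow_auto f)
      fix a assume a: "a \<in> M"
      have b: "(rot ^^ (n - r)) a \<in> M"
        by (rule rot_pow_M [OF a])
      have "(rot ^^ r) ((rot ^^ (n - r)) a) = (rot ^^ n) a"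
        using r funpow_add [of r "n - r" rot] by simp
      then have rot_back: "(rot ^^ r) ((rot ^^ (n - r)) a) = a"
        by (simp only: rot_pow_n [OF a])
      obtain y where y: "f (single ((rot ^^ (n - r)) a) 1) = single a y"
        using fr [OF b] rot_back by metis
      have "f \<in> isos"
        using f by (simp add: autos_iff)
      then have fw: "f (single ((rot ^^ (n - r)) a) w) = single a (w * y)" for w
        using iso_single [of f "(rot ^^ (n - r)) a" w] b by (simp add: y star_single)
      show "\<exists>y. ?g (single a 1) = single a y"
        unfolding Aut_mult_apply [OF f pow_auto qpolys_single [OF a]] pow [OF a] fw by blast
    qed
    then obtain c where c: "?g = diag_auto c" "c \<in> carrier T"
      by (rule imageE)
    have fG: "f \<in> carrier ?G" and pG: "\<tau> [^]\<^bsub>?G\<^esub> k \<in> carrier ?G" for k :: nat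
      using f pow_auto by (simp_all add: algebra_Aut_simps(1))
    have "diag_auto c \<otimes>\<^bsub>?G\<^esub> \<tau> [^]\<^bsub>?G\<^esub> r = f \<otimes>\<^bsub>?G\<^esub> \<tau> [^]\<^bsub>?G\<^esub> (n - r + r)"
      unfolding c(1) [symmetric] G.m_assoc [OF fG pG pG] G.nat_pow_mult [OF \<tau>G] ..
    also have "\<dots> = f"
      using r fG by (simp add: \<tau>n)
    finally show "\<exists>h<n. \<exists>c\<in>carrier T. f = diag_auto c \<otimes>\<^bsub>?G\<^esub> \<tau> [^]\<^bsub>?G\<^esub> h"
      using r c(2) by (intro exI [of _ r] conjI bexI [of _ c]) simp_all
  next
    fix h assume h: "h < n" and "\<tau> [^]\<^bsub>?G\<^esub> h \<in> diag_auto ` carrier T"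
    then obtain c where c: "c \<in> carrier T" "\<tau> [^]\<^bsub>?G\<^esub> h = diag_auto c"
      by blast
    have eM: "e 1 \<in> M"
      by (rule e_M [OF one_in])
    have "single ((rot ^^ h) (e 1)) ((\<Prod>j<h. x ((rot ^^ j) (e 1))) * 1) = single (e 1) (chi c (e 1) * 1)"
      using pow [OF eM, of h 1] diag_auto_single [OF eM, of c 1] c(2) by simp
    moreover have "chi c (e 1) * 1 \<noteq> 0"
      using chi_nz [OF c(1)] by simp
    ultimately have "(rot ^^ h) (e 1) = e 1"
      by (metis lookup_single_eq lookup_single_not_eq)
    then have "lookup (e 1) (rotn n h 1) = v"
      using lookup_rot_pow [OF one_in, of h "e 1"] h by (simp add: lookup_e)
    then show "h = 0"
      using v h by (simp add: lookup_e rotn_def split: if_splits)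
  qed
qed

end

theorem theorem0p2:
  fixes n m v :: nat
    and q :: "'k::field"
    and A :: "('k, (word \<Rightarrow>\<^sub>0 'k) set) module"
    and T :: "(nat \<Rightarrow> 'k) monoid"
  assumes "n \<ge> 2"
    and "q \<noteq> 0"
    and "group.ord field_units q = m"
    and "m > 2"
    and "v > 0"
    and "(even n \<and> \<not> m dvd v) \<or> (odd n \<and> gcd m v \<noteq> 1)"
  defines "A \<equiv> veronese (quantum_algebra n q) (quantum_component n q) v"
    and "T \<equiv> product_group {1..n} (\<lambda>_. field_units)"
  shows "(q ^ v = 1 \<or> q ^ v = - 1 \<longrightarrow>
           (\<exists>\<theta> \<in> hom (integer_mod_group n) (AutoGroup T).
              algebra_Aut A \<cong> semidirect_product (integer_mod_group n) T \<theta>))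
       \<and> (q ^ v \<noteq> 1 \<and> q ^ v \<noteq> - 1 \<longrightarrow> algebra_Aut A \<cong> T)"
proof -
  interpret F: group "field_units :: 'k monoid"
    by (rule group_field_units)
  have pow: "q [^]\<^bsub>field_units\<^esub> k = q ^ k" for k :: nat
    by (induction k) (simp_all add: field_units_def nat_pow_def mult.commute)
  have ord: "q ^ k = 1 \<longleftrightarrow> m dvd k" for k
    using F.pow_eq_id [of q k] assms(2,3) by (simp add: pow) (simp add: field_units_def)
  interpret quantum_veronese n v m q
    using assms ord by unfold_locales auto
  have AB: "algebra_Aut A \<cong> algebra_Aut (twisted_algebra n q v)"
    unfolding A_def by (rule algebra_Aut_veronese [OF assms(5)])
  show ?thesis
  proof (intro conjI impI)
    assume "q ^ v = 1 \<or> q ^ v = - 1"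
    from Aut_semidirect [OF this]
    show "\<exists>\<theta>\<in>hom (integer_mod_group n) (AutoGroup T). algebra_Aut A \<cong> semidirect_product (integer_mod_group n) T \<theta>"
      unfolding T_def using iso_trans [OF AB] by (elim bexE) (rule bexI)
  next
    assume "q ^ v \<noteq> 1 \<and> q ^ v \<noteq> - 1"
    then have "algebra_Aut (twisted_algebra n q v) \<cong> T"
      unfolding T_def by (intro Aut_torus) simp_all
    then show "algebra_Aut A \<cong> T"
      by (rule iso_trans [OF AB])
  qed
qed

end
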